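(* Let $\Gamma$ be a countable group, let $P\subset\mathbb{R}$ be a closed subset such that the action of $\mathbb{R}$ on the hull $\Omega_P$ is free and uniquely ergodic, and let $\varphi:\Gamma\to\mathbb{R}$ be a quasimorphism with $\varphi(e)=0$ which is not at bounded distance from a homomorphism $\Gamma\to\mathbb{R}$. Let $p$ be a symmetric probability measure on $\Gamma\times\mathbb{R}$, absolutely continuous with respect to Haar measure, whose support generates $\Gamma\times\mathbb{R}$ as a semigroup, and such that $\varphi$ is $p$-integrable. Let $\psi\in\mathcal{L}_p(\varphi)$, and let $\nu_\psi$ denote the unique $p$-stationary probability measure on $\Omega_{P(\psi)}$. Then for every $p$-stationary Borel probability measure $\nu$ on $\Omega_{P(\varphi)}$ there exists a measure-preserving, $\nu$-measurable, $\nu$-almost everywhere $(\Gamma\times\mathbb{R})$-equivariant map $(\Omega_{P(\varphi)},\nu)\to(\Omega_{P(\psi)},\nu_\psi)$.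
   Context: $\varphi:\Gamma\to\mathbb{R}$ is a quasimorphism if $\sup_{g,h}|\varphi(gh)-\varphi(g)-\varphi(h)|<\infty$. Functions are at bounded distance if their difference is bounded. $\Gamma$ is discrete. The twist of a closed $P\subset\mathbb{R}$ by a quasimorphism $\varphi$ is $P(\varphi):=\{(\gamma,t)\in\Gamma\times\mathbb{R}\mid\varphi(\gamma)+t\in P\}$. For a locally compact second countable group $G$, $\mathscr{C}(G)$ is the space of closed subsets of $G$ with the Chabauty-Fell topology and action $g.Q:=Qg^{-1}$. The hull $\Omega_Q$ of a closed $Q\subset G$ is the closure of its $G$-orbit in $\mathscr{C}(G)$; thus $\Omega_P\subset\mathscr{C}(\mathbb{R})$ and $\Omega_{P(\varphi)}\subset\mathscr{C}(\Gamma\times\mathbb{R})$. Uniquely ergodic means having exactly one invariant Borel probability measure. Let $p_\Gamma$ be the push-forward of $p$ to $\Gamma$. $\varphi$ is $p$-integrable if $\sum_\gamma p_\Gamma(\gamma)|\varphi(\gamma)|<\infty$. $\mathcal{L}_p(\varphi)$ is the set of $\psi:\Gamma\to\mathbb{R}$ with $\psi(e)=0$, $\|\psi-\varphi\|_\infty<\infty$ and $p_\Gamma*\psi=\psi$, i.e. $\sum_{\gamma'}p_\Gamma(\gamma')\psi(\gamma'^{-1}\gamma)=\psi(\gamma)$ for all $\gamma$ (left-$p$-harmonic quasimorphisms at bounded distance from $\varphi$). A Borel probability measure $\nu$ is $p$-stationary if $p*\nu=\nu$. It is a fact (part of the paper's results) that for $\psi\in\mathcal{L}_p(\varphi)$ the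 hull $\Omega_{P(\psi)}$ admits exactly one $p$-stationary Borel probability measure. *)

theory Defs
  imports "HOL-Probability.Probability"
begin

(* Groups are written additively but need not be commutative (class group_add).
   A countable discrete group is a type of class {group_add, countable, discrete_topology};
   its product with the reals carries the product group and topology instances. *)

definition chabauty_fell :: "'a::topological_space set topology" where
  "chabauty_fell = topology_generated_by
     ({{Q. closed Q \<and> Q \<inter> K = {}} | K. compact K} \<union>
      {{Q. closed Q \<and> Q \<inter> U \<noteq> {}} | U. open U})"

lemma topspace_chabauty_fell: "topspace chabauty_fell = {Q. closed Q}"
proof -
  have "{Q::'a set. closed Q} \<in> {{Q. closed Q \<and> Q \<inter> K = {}} | K. compact K}"
    by (auto intro!: exI[of _ "{}"])
  then show ?thesis
    unfolding chabauty_fell_def topology_generated_by_topspace by (intro antisym) auto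
qed

(* g.Q = Q g^{-1} *)
definition translate :: "'a::group_add \<Rightarrow> 'a set \<Rightarrow> 'a set" where
  "translate g Q = (\<lambda>q. q - g) ` Q"

lemma translate_0: "translate 0 Q = Q"
  by (simp add: translate_def)

lemma translate_translate: "translate g (translate h Q) = translate (g + h) Q"
  by (simp add: translate_def image_image diff_add_eq_diff_diff_swap)

definition chabauty_hull :: "'a::{group_add, topological_space} set \<Rightarrow> 'a set set" where
  "chabauty_hull Q = chabauty_fell closure_of (range (\<lambda>g. translate g Q))"

definition free_on :: "'a::group_add set set \<Rightarrow> bool" where
  "free_on X \<longleftrightarrow> (\<forall>Q\<in>X. \<forall>g. translate g Q = Q \<longrightarrow> g = 0)"

definition borel_of :: "'a topology \<Rightarrow> 'a measure" where
  "borel_of X = sigma (topspace X) {U. openin X U}"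

definition hull_prob :: "'a::{group_add, topological_space} set \<Rightarrow> 'a set measure \<Rightarrow> bool" where
  "hull_prob Q \<mu> \<longleftrightarrow> prob_space \<mu> \<and>
     sets \<mu> = sets (borel_of (subtopology chabauty_fell (chabauty_hull Q)))"

definition uniquely_ergodic_hull :: "'a::{group_add, topological_space} set \<Rightarrow> bool" where
  "uniquely_ergodic_hull Q \<longleftrightarrow>
     (\<exists>!\<mu>. hull_prob Q \<mu> \<and> (\<forall>g. distr \<mu> \<mu> (translate g) = \<mu>))"

(* p * nu is the image of the product measure of p and nu under the action map *)
definition stationary_hull ::
    "'a::{group_add, topological_space} measure \<Rightarrow> 'a set \<Rightarrow> 'a set measure \<Rightarrow> bool" where
  "stationary_hull p Q \<nu> \<longleftrightarrow>
     hull_prob Q \<nu> \<and> distr (p \<Otimes>\<^sub>M \<nu>) \<nu> (\<lambda>(g, R). translate g R) = \<nu>"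

definition quasimorphism :: "('g::group_add \<Rightarrow> real) \<Rightarrow> bool" where
  "quasimorphism \<phi> \<longleftrightarrow> (\<exists>D. \<forall>g h. \<bar>\<phi> (g + h) - \<phi> g - \<phi> h\<bar> \<le> D)"

definition homomorphism :: "('g::group_add \<Rightarrow> real) \<Rightarrow> bool" where
  "homomorphism \<alpha> \<longleftrightarrow> (\<forall>g h. \<alpha> (g + h) = \<alpha> g + \<alpha> h)"

definition bounded_distance :: "('g \<Rightarrow> real) \<Rightarrow> ('g \<Rightarrow> real) \<Rightarrow> bool" where
  "bounded_distance \<phi> \<psi> \<longleftrightarrow> bounded (range (\<lambda>g. \<phi> g - \<psi> g))"

definition twist :: "real set \<Rightarrow> ('g \<Rightarrow> real) \<Rightarrow> ('g \<times> real) set" where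
  "twist P \<phi> = {(\<gamma>, t). \<phi> \<gamma> + t \<in> P}"

(* Haar measure, normalised as counting measure times Lebesgue measure; only its null sets matter. *)
definition haar :: "('g::{group_add, countable, discrete_topology} \<times> real) measure" where
  "haar = count_space UNIV \<Otimes>\<^sub>M lborel"

lemma sets_haar:
  "sets (haar :: ('g::{group_add, countable, discrete_topology} \<times> real) measure) = sets borel"
proof (rule antisym)
  have "{a} \<times> B \<in> sets borel" if "B \<in> sets borel" for a :: 'g and B :: "real set"
  proof -
    have "fst -` {a} \<inter> snd -` B \<inter> space borel \<in> sets (borel :: ('g \<times> real) measure)"
    proof -
      have "fst \<in> borel_measurable (borel :: ('g \<times> real) measure)"
           "snd \<in> borel_measurable (borel :: ('g \<times> real) measure)"
        by (auto intro!: borel_measurable_continuous_onI continuous_intros)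
      from measurable_sets[OF this(1), of "{a}"] measurable_sets[OF this(2) that]
      have "(fst -` {a} \<inter> space borel) \<inter> (snd -` B \<inter> space borel) \<in> sets (borel :: ('g \<times> real) measure)"
        by (intro sets.Int) auto
      then show ?thesis by (simp add: Int_ac)
    qed
    moreover have "fst -` {a} \<inter> snd -` B \<inter> space borel = {a} \<times> B" by auto
    ultimately show ?thesis by simp
  qed
  then have "A \<times> B \<in> sets borel" if "B \<in> sets borel" for A :: "'g set" and B :: "real set"
  proof -
    have "A \<times> B = (\<Union>a\<in>A. {a} \<times> B)" by auto
    moreover have "\<dots> \<in> sets borel"
      using \<open>\<And>B a. B \<in> sets borel \<Longrightarrow> {a} \<times> B \<in> sets borel\<close> that
      by (intro sets.countable_UN') auto
    ultimately show ?thesis by simp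
  qed
  then show "sets (haar :: ('g \<times> real) measure) \<subseteq> sets borel"
    unfolding haar_def sets_pair_measure
    by (intro sets.sigma_sets_subset') auto
next
  have "U \<in> sets haar" if "open U" for U :: "('g \<times> real) set"
  proof -
    have "open (Pair a -` U)" for a
      using that by (intro open_vimage continuous_intros)
    then have "(\<Union>a. {a} \<times> Pair a -` U) \<in> sets haar"
      unfolding haar_def by (intro sets.countable_UN') (auto intro!: pair_measureI)
    moreover have "(\<Union>a. {a} \<times> Pair a -` U) = U" by auto
    ultimately show ?thesis by simp
  qed
  then have "sigma_sets (space haar) (Collect open) \<subseteq> sets (haar :: ('g \<times> real) measure)"
    by (intro sets.sigma_sets_subset) auto
  moreover have "space (haar :: ('g \<times> real) measure) = UNIV"
    by (simp add: haar_def space_pair_measure)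
  ultimately show "sets borel \<subseteq> sets (haar :: ('g \<times> real) measure)"
    by (simp add: sets_borel)
qed

lemma haar_invariant:
  fixes g :: "'g::{group_add, countable, discrete_topology} \<times> real"
  shows "distr haar haar ((+) g) = haar"
proof -
  obtain a s where g: "g = (a, s)" by (cases g)
  have 1: "distr (count_space UNIV) (count_space UNIV) ((+) a) = count_space UNIV"
    by (intro distr_bij_count_space) (auto intro!: bij_betwI[where g = "(+) (- a)"] simp flip: add.assoc)
  have 2: "distr lborel lborel ((+) s) = lborel"
    using lborel_distr_plus[of s] by (simp cong: distr_cong)
  interpret count: sigma_finite_measure "count_space (UNIV :: 'g set)"
    by (rule sigma_finite_measure_count_space)
  have "distr (count_space UNIV) (count_space UNIV) ((+) a) \<Otimes>\<^sub>M distr lborel lborel ((+) s)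
      = distr (count_space UNIV \<Otimes>\<^sub>M lborel) (count_space UNIV \<Otimes>\<^sub>M lborel)
          (\<lambda>(x, y). (a + x, s + y))"
    by (intro pair_measure_distr) (auto simp: 2 lborel.sigma_finite_measure_axioms)
  moreover have "(\<lambda>(x, y). (a + x, s + y)) = (+) g"
    by (auto simp: g fun_eq_iff)
  ultimately show ?thesis
    unfolding 1 2 by (simp add: haar_def)
qed

definition supp :: "'a::topological_space measure \<Rightarrow> 'a set" where
  "supp p = {x. \<forall>U. open U \<and> x \<in> U \<longrightarrow> emeasure p U > 0}"

definition generates_semigroup :: "'a::plus set \<Rightarrow> bool" where
  "generates_semigroup A \<longleftrightarrow> (\<lambda>S. \<forall>x\<in>S. \<forall>y\<in>S. x + y \<in> S) hull A = UNIV"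

definition symmetric_measure :: "'a::group_add measure \<Rightarrow> bool" where
  "symmetric_measure p \<longleftrightarrow> distr p p uminus = p"

definition proj_mass :: "('g \<times> real) measure \<Rightarrow> 'g \<Rightarrow> real" where
  "proj_mass p \<gamma> = measure (distr p (count_space UNIV) fst) {\<gamma>}"

(* has_sum and summable_on over the reals mean absolute convergence. *)
definition integrable_wrt :: "('g \<times> real) measure \<Rightarrow> ('g \<Rightarrow> real) \<Rightarrow> bool" where
  "integrable_wrt p \<phi> \<longleftrightarrow> (\<lambda>\<gamma>. proj_mass p \<gamma> * \<bar>\<phi> \<gamma>\<bar>) summable_on UNIV"

definition left_harmonic :: "('g::group_add \<times> real) measure \<Rightarrow> ('g \<Rightarrow> real) \<Rightarrow> bool" where
  "left_harmonic p \<psi> \<longleftrightarrow>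
     (\<forall>\<gamma>. ((\<lambda>\<gamma>'. proj_mass p \<gamma>' * \<psi> (- \<gamma>' + \<gamma>)) has_sum \<psi> \<gamma>) UNIV)"

definition harmonic_class ::
    "('g::group_add \<times> real) measure \<Rightarrow> ('g \<Rightarrow> real) \<Rightarrow> ('g \<Rightarrow> real) set" where
  "harmonic_class p \<phi> = {\<psi>. \<psi> 0 = 0 \<and> bounded_distance \<psi> \<phi> \<and> left_harmonic p \<psi>}"

(* nu-measurability is measurability for the completion of nu.  Equivariance holds, for
   almost every point, simultaneously for all (uncountably many) group elements. *)
definition ae_equivariant_factor ::
    "'a::group_add set measure \<Rightarrow> 'a set measure \<Rightarrow> ('a set \<Rightarrow> 'a set) \<Rightarrow> bool" where
  "ae_equivariant_factor \<nu> \<nu>' F \<longleftrightarrow>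
     F \<in> completion \<nu> \<rightarrow>\<^sub>M \<nu>' \<and>
     distr (completion \<nu>) \<nu>' F = \<nu>' \<and>
     (AE Q in \<nu>. \<forall>g. F (translate g Q) = translate g (F Q))"

end

(*
  By freeness an element Q of the hull of twist P phi is a fibre R over 0 in the hull of P together with
  a function eta on the group at bounded distance from psi, the fibre over g being R translated by eta g.
  The map (g, Q) |-> eta g is a cocycle, and its mean f(Q) under p vanishes when eta is harmonic.

  Since psi is harmonic and eta - psi is bounded, the partial sums of the series of P^k f (P the averaging
  operator of p) are uniformly bounded, and their limsup c is a bounded function with c <= f + P c.
  Translating the fibre over g by c(g.Q) is an equivariant map; it changes eta into the cohomologous
  cocycle eta(g) + c(g.Q) - c(Q), whose mean is nonnegative.

  It remains to identify the image measure.  The reals are central, so by a Choquet-Deny argument every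
  stationary measure is invariant under them, and unique ergodicity makes the fibre over 0 independent of
  the cocycle.  To see that the corrected cocycle has the same law as the harmonic cocycle coming from
  nu_psi, run the random walk on the product of both systems: the difference of the cocycles is bounded,
  hence a coboundary of a bounded submean function, and its increments tend to 0 in mean square while the
  two marginals do not change.
*)

theory Submission
  imports Defs
begin

subsection \<open>The Chabauty--Fell Borel structure\<close>

text \<open>Two obstacles shape the argument: the partial sums need not converge, and nothing
  relates a stationary measure on one hull to one on the other. The first is met by keeping only an
  inequality. With delta(g) = eta(g) - psi(g) along the orbit of Q, harmonicity of psi gives f(g.Q)
  = (P delta)(g) - delta(g), so the sums telescope to P^n delta - delta and stay bounded. One sign
  of the mean is enough afterwards: it makes the negated supremum of the difference cocycle submean,
  and a bounded submean function has a bounded energy that grows by at least its mean squared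
  increment at each step. The second is met by a coupling that starts from the product measure and
  moves both points by the same group element. This joint law need not be stationary, and no limit
  of it is taken; the argument uses only its marginals, which stay fixed, and the mean-square
  difference of the cocycles, which tends to 0. The corrector is only known to be measurable, so a
  corrected set need not lie in the target hull; that it does so almost surely is read off from the
  equality of laws at the very end.\<close>

lemma mem_translate_iff: "q \<in> translate g Q \<longleftrightarrow> q + g \<in> Q"
  unfolding translate_def by (force simp: image_iff)

definition cylinder :: "'a::topological_space set set \<Rightarrow> 'a set set \<Rightarrow> 'a set set" where
  "cylinder I J = {Q. closed Q \<and> (\<forall>U\<in>I. Q \<inter> U \<noteq> {}) \<and> (\<forall>V\<in>J. Q \<inter> V = {})}"

lemma openin_hits: "open U \<Longrightarrow> openin chabauty_fell {Q. closed Q \<and> Q \<inter> U \<noteq> {}}"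
  unfolding chabauty_fell_def by (rule topology_generated_by_Basis) blast

lemma openin_misses: "compact K \<Longrightarrow> openin chabauty_fell {Q. closed Q \<and> Q \<inter> K = {}}"
  unfolding chabauty_fell_def by (rule topology_generated_by_Basis) blast

text \<open>The sets \<open>cylinder I J\<close> need not be open, but there are countably many of them, which is all
  that is needed to describe the Borel sets.\<close>

lemma openin_chabauty_fell_cylinder:
  assumes B: "topological_basis B" and O: "openin chabauty_fell X" and Q: "Q \<in> X"
  shows "\<exists>I J. finite I \<and> finite J \<and> I \<subseteq> B \<and> J \<subseteq> B \<and> Q \<in> cylinder I J \<and> cylinder I J \<subseteq> X"
proof -
  let ?S = "{{Q. closed Q \<and> Q \<inter> K = {}} | K. compact K} \<union>
      {{Q. closed Q \<and> Q \<inter> U \<noteq> {}} | U. open U}"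
  have "generate_topology_on ?S X"
    using O unfolding chabauty_fell_def by (rule openin_topology_generated_by)
  then show ?thesis using Q
  proof (induction arbitrary: Q)
    case (Int a b)
    obtain I J where 1: "finite I" "finite J" "I \<subseteq> B" "J \<subseteq> B" "Q \<in> cylinder I J" "cylinder I J \<subseteq> a"
      using Int.IH(1)[of Q] Int.prems by auto
    obtain I' J' where 2: "finite I'" "finite J'" "I' \<subseteq> B" "J' \<subseteq> B" "Q \<in> cylinder I' J'" "cylinder I' J' \<subseteq> b"
      using Int.IH(2)[of Q] Int.prems by auto
    have "cylinder (I \<union> I') (J \<union> J') = cylinder I J \<inter> cylinder I' J'"
      by (auto simp: cylinder_def)
    with 1 2 show ?case
      by (intro exI[of _ "I \<union> I'"] exI[of _ "J \<union> J'"]) auto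
  next
    case (UN K)
    then obtain k where "k \<in> K" "Q \<in> k" by auto
    from UN.IH[OF this] obtain I J where "finite I" "finite J" "I \<subseteq> B" "J \<subseteq> B"
      "Q \<in> cylinder I J" "cylinder I J \<subseteq> k" by auto
    with \<open>k \<in> K\<close> show ?case by (intro exI[of _ I] exI[of _ J]) auto
  next
    case (Basis s)
    then consider K where "compact K" "s = {Q. closed Q \<and> Q \<inter> K = {}}"
      | U where "open U" "s = {Q. closed Q \<and> Q \<inter> U \<noteq> {}}" by auto
    then show ?case
    proof cases
      case 1
      \<comment> \<open>A compact set missed by \<open>Q\<close> is covered by finitely many basis
        sets that \<open>Q\<close> misses too, and every set missing all of these misses
        \<open>K\<close>.\<close>
      have "\<forall>x\<in>K. \<exists>V. V \<in> B \<and> x \<in> V \<and> V \<subseteq> - Q"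
      proof
        fix x assume "x \<in> K"
        then have "open (- Q)" "x \<in> - Q" using 1 Basis.prems by auto
        from topological_basisE[OF B this] obtain V where "V \<in> B" "x \<in> V" "V \<subseteq> - Q" .
        then show "\<exists>V. V \<in> B \<and> x \<in> V \<and> V \<subseteq> - Q" by blast
      qed
      from bchoice[OF this] obtain V where
        V: "\<forall>x\<in>K. V x \<in> B \<and> x \<in> V x \<and> V x \<subseteq> - Q" by blast
      obtain C where C: "C \<subseteq> K" "finite C" "K \<subseteq> (\<Union>x\<in>C. V x)"
      proof (rule compactE_image[OF 1(1), of K V])
        show "\<And>T. T \<in> K \<Longrightarrow> open (V T)" using V topological_basis_open[OF B] by auto
        show "K \<subseteq> (\<Union>c\<in>K. V c)" using V by auto
      qed auto
      have "Q \<in> cylinder {} (V ` C)" using V C 1 Basis.prems by (force simp: cylinder_def)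
      moreover have "cylinder {} (V ` C) \<subseteq> s" using C(3) 1(2) by (force simp: cylinder_def)
      moreover have "V ` C \<subseteq> B" using V C by auto
      ultimately show ?thesis using C(2) by (intro exI[of _ "{}"] exI[of _ "V ` C"]) auto
    next
      case 2
      then obtain x where x: "x \<in> Q" "x \<in> U" using Basis.prems by auto
      obtain V where V: "V \<in> B" "x \<in> V" "V \<subseteq> U" using topological_basisE[OF B 2(1) x(2)] by auto
      have "closed Q" using Basis.prems 2(2) by simp
      then have "Q \<in> cylinder {V} {}" using V(2) x(1) by (auto simp: cylinder_def)
      moreover have "cylinder {V} {} \<subseteq> s" using V(3) 2(2) by (auto simp: cylinder_def)
      ultimately show ?thesis using V(1) by (intro exI[of _ "{V}"] exI[of _ "{}"]) simp
    qed
  qed auto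
qed

lemma space_borel_of: "space (borel_of X) = topspace X"
  unfolding borel_of_def by (rule space_measure_of_conv)

lemma sets_borel_of: "sets (borel_of X) = sigma_sets (topspace X) {U. openin X U}"
  unfolding borel_of_def by (rule sets_measure_of) (auto dest: openin_subset)

lemma borel_of_open: "openin X U \<Longrightarrow> U \<in> sets (borel_of X)"
  by (simp add: sets_borel_of)

lemma borel_of_closed: "closedin X U \<Longrightarrow> U \<in> sets (borel_of X)"
proof -
  assume "closedin X U"
  then have "openin X (topspace X - U)" "topspace X - (topspace X - U) = U"
    by (auto simp: closedin_def)
  then show ?thesis
    using sets.compl_sets[OF borel_of_open, of X "topspace X - U"] by (simp add: space_borel_of)
qed

lemma space_chabauty [simp]: "space (borel_of chabauty_fell) = {Q. closed Q}"
  by (simp add: space_borel_of topspace_chabauty_fell)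

text \<open>An open set is the union of the cylinders it contains. Only finite subsets of
  \<open>B\<close> occur, so this union is countable, and each cylinder is a finite Boolean
  combination of hitting sets. Hence measurability of a set-valued map can be tested on hits of
  basis sets alone.\<close>

lemma sets_borel_of_chabauty:
  assumes B: "topological_basis B" "countable B"
  shows "sets (borel_of chabauty_fell) =
    sigma_sets {Q. closed Q} ((\<lambda>U. {Q. closed Q \<and> Q \<inter> U \<noteq> {}}) ` B)" (is "_ = sigma_sets _ ?H")
proof -
  interpret S: sigma_algebra "{Q::'a set. closed Q}" "sigma_sets {Q. closed Q} ?H"
    by (rule sigma_algebra_sigma_sets) auto
  have hit: "{Q. closed Q \<and> Q \<inter> U \<noteq> {}} \<in> sigma_sets {Q. closed Q} ?H" if "U \<in> B" for U
    using that by auto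
  have miss: "{Q. closed Q \<and> Q \<inter> U = {}} \<in> sigma_sets {Q. closed Q} ?H" if "U \<in> B" for U
  proof -
    have "{Q. closed Q \<and> Q \<inter> U = {}} = {Q. closed Q} - {Q. closed Q \<and> Q \<inter> U \<noteq> {}}" by auto
    with S.compl_sets[OF hit[OF that]] show ?thesis by simp
  qed
  have cyl: "cylinder I J \<in> sigma_sets {Q. closed Q} ?H"
    if "finite I" "finite J" "I \<subseteq> B" "J \<subseteq> B" for I J
  proof -
    have "cylinder I {} \<in> sigma_sets {Q. closed Q} ?H" using that(1,3)
    proof (induction I)
      case empty
      then show ?case using S.top by (simp add: cylinder_def)
    next
      case (insert U I)
      have "cylinder (insert U I) {} = {Q. closed Q \<and> Q \<inter> U \<noteq> {}} \<inter> cylinder I {}"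
        by (auto simp: cylinder_def)
      with insert S.Int[OF hit] show ?case by simp
    qed
    moreover have "cylinder {} J \<in> sigma_sets {Q. closed Q} ?H" using that(2,4)
    proof (induction J)
      case empty
      then show ?case using S.top by (simp add: cylinder_def)
    next
      case (insert U I)
      have "cylinder {} (insert U I) = {Q. closed Q \<and> Q \<inter> U = {}} \<inter> cylinder {} I"
        by (auto simp: cylinder_def)
      with insert S.Int[OF miss] show ?case by simp
    qed
    moreover have "cylinder I J = cylinder I {} \<inter> cylinder {} J" by (auto simp: cylinder_def)
    ultimately show ?thesis using S.Int by simp
  qed
  have "X \<in> sigma_sets {Q. closed Q} ?H" if X: "openin chabauty_fell X" for X
  proof -
    let ?F = "{I. finite I \<and> I \<subseteq> B}"
    let ?C = "{(I, J) \<in> ?F \<times> ?F. cylinder I J \<subseteq> X}"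
    have "countable ?F" using countable_Collect_finite_subset[OF B(2)] by (simp add: conj_commute)
    then have "countable (?F \<times> ?F)" by blast
    then have "countable ?C" by (rule countable_subset[rotated]) auto
    moreover have "X = (\<Union>(I, J)\<in>?C. cylinder I J)"
    proof (intro equalityI subsetI)
      fix Q assume "Q \<in> X"
      from openin_chabauty_fell_cylinder[OF B(1) X this] obtain I J where
        "finite I" "finite J" "I \<subseteq> B" "J \<subseteq> B" "Q \<in> cylinder I J" "cylinder I J \<subseteq> X" by blast
      then show "Q \<in> (\<Union>(I, J)\<in>?C. cylinder I J)" by (intro UN_I[of "(I, J)"]) auto
    qed auto
    moreover have "(\<Union>(I, J)\<in>?C. cylinder I J) \<in> sigma_sets {Q. closed Q} ?H"
      by (rule S.countable_UN''[OF \<open>countable ?C\<close>]) (clarsimp, rule cyl, auto)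
    ultimately show ?thesis by simp
  qed
  then have "sigma_sets {Q. closed Q} {X. openin chabauty_fell X} \<subseteq> sigma_sets {Q. closed Q} ?H"
    by (intro S.sigma_sets_subset) auto
  moreover have "sigma_sets {Q. closed Q} ?H \<subseteq> sigma_sets {Q. closed Q} {X. openin chabauty_fell X}"
    by (rule sigma_sets_mono) (use openin_hits topological_basis_open[OF B(1)] in auto)
  ultimately show ?thesis
    by (simp add: sets_borel_of topspace_chabauty_fell)
qed

lemma measurable_chabautyI:
  assumes B: "topological_basis B" "countable B"
    and f: "\<And>x. x \<in> space M \<Longrightarrow> closed (f x)"
    and m: "\<And>U. U \<in> B \<Longrightarrow> {x \<in> space M. f x \<inter> U \<noteq> {}} \<in> sets M"
  shows "f \<in> M \<rightarrow>\<^sub>M borel_of chabauty_fell"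
proof (rule measurable_sigma_sets[OF sets_borel_of_chabauty[OF B]])
  fix A assume "A \<in> (\<lambda>U. {Q. closed Q \<and> Q \<inter> U \<noteq> {}}) ` B"
  then obtain U where "U \<in> B" "A = {Q. closed Q \<and> Q \<inter> U \<noteq> {}}" by auto
  moreover from this have "f -` A \<inter> space M = {x \<in> space M. f x \<inter> U \<noteq> {}}" using f by auto
  ultimately show "f -` A \<inter> space M \<in> sets M" using m by simp
qed (use f in auto)

text \<open>Meant for \<open>stationary_invariant_under_reals\<close>: stability under intersection
  lets a measure be identified on \<open>E\<close>, and countability lets one null set serve for all
  members of \<open>E\<close>. Cylinders with hitting conditions only suffice, and two of them
  intersect in the cylinder of the united conditions.\<close>

lemma chabauty_generator:
  fixes X :: "'a::topological_space set set" and B :: "'a set set"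
  assumes B: "topological_basis B" "countable B" and X: "X \<subseteq> {Q. closed Q}"
  shows "\<exists>E. countable E \<and> Int_stable E \<and> X \<in> E \<and> E \<subseteq> Pow X \<and>
    sets (restrict_space (borel_of chabauty_fell) X) = sigma_sets X E"
proof -
  let ?H = "(\<lambda>U. {Q. closed Q \<and> Q \<inter> U \<noteq> {}}) ` B"
  let ?E = "(\<lambda>I. cylinder I {} \<inter> X) ` {I. finite I \<and> I \<subseteq> B}"
  have cyl_Un: "cylinder (I \<union> J) {} = cylinder I {} \<inter> cylinder J {}" for I J :: "'a set set"
    by (auto simp: cylinder_def)
  have "countable {I. finite I \<and> I \<subseteq> B}"
    using countable_Collect_finite_subset[OF B(2)] by (simp add: conj_commute)
  moreover have "Int_stable ?E"
  proof (rule Int_stableI, elim imageE, clarsimp)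
    fix I J assume "finite I" "I \<subseteq> B" "finite J" "J \<subseteq> B"
    then show "cylinder I {} \<inter> X \<inter> (cylinder J {} \<inter> X) \<in> ?E"
      by (intro image_eqI[of _ _ "I \<union> J"]) (auto simp: cyl_Un)
  qed
  moreover have "X \<in> ?E"
    using X by (intro image_eqI[of _ _ "{}"]) (auto simp: cylinder_def)
  moreover have "sets (restrict_space (borel_of chabauty_fell) X) = sigma_sets X ?E"
  proof
    have "sets (restrict_space (borel_of chabauty_fell) X)
        = sets (vimage_algebra X (\<lambda>x. x) (sigma {Q. closed Q} ?H))"
      unfolding restrict_space_eq_vimage_algebra[OF X[folded space_chabauty]]
      by (rule sets_vimage_algebra_cong) (simp add: sets_borel_of_chabauty[OF B] sets_measure_of_conv, auto)
    also have "\<dots> = sigma_sets X {(\<lambda>x. x) -` A \<inter> X |A. A \<in> ?H}"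
      by (subst vimage_algebra_sigma) (use X in \<open>auto intro!: sets_measure_of del: equalityI\<close>)
    also have "\<dots> \<subseteq> sigma_sets X ?E"
    proof (rule sigma_sets_mono, safe)
      fix U assume "U \<in> B"
      then have "(\<lambda>x. x) -` {Q. closed Q \<and> Q \<inter> U \<noteq> {}} \<inter> X \<in> ?E"
        by (intro image_eqI[of _ _ "{U}"]) (auto simp: cylinder_def)
      then show "(\<lambda>x. x) -` {Q. closed Q \<and> Q \<inter> U \<noteq> {}} \<inter> X \<in> sigma_sets X ?E" by auto
    qed
    finally show "sets (restrict_space (borel_of chabauty_fell) X) \<subseteq> sigma_sets X ?E" .
    have "cylinder I {} \<in> sets (borel_of chabauty_fell)" if "finite I" "I \<subseteq> B" for I
      using that
    proof (induction I)
      case empty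
      then show ?case using sets.top[of "borel_of chabauty_fell"] by (simp add: cylinder_def)
    next
      case (insert U I)
      have "cylinder (insert U I) {} = {Q. closed Q \<and> Q \<inter> U \<noteq> {}} \<inter> cylinder I {}"
        by (auto simp: cylinder_def)
      moreover have "{Q. closed Q \<and> Q \<inter> U \<noteq> {}} \<in> sets (borel_of chabauty_fell)"
        using insert.prems topological_basis_open[OF B(1)] by (intro borel_of_open openin_hits) auto
      ultimately show ?case using insert by auto
    qed
    then have "?E \<subseteq> sets (restrict_space (borel_of chabauty_fell) X)"
      by (auto simp: sets_restrict_space)
    moreover have "space (restrict_space (borel_of chabauty_fell) X) = X"
      using X by (auto simp: space_restrict_space)
    ultimately show "sigma_sets X ?E \<subseteq> sets (restrict_space (borel_of chabauty_fell) X)"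
      using sets.sigma_sets_subset[of ?E "restrict_space (borel_of chabauty_fell) X"] by simp
  qed
  ultimately show ?thesis by (intro exI[of _ ?E]) auto
qed

lemma sets_borel_of_subtopology:
  assumes "A \<subseteq> topspace X"
  shows "sets (borel_of (subtopology X A)) = sets (restrict_space (borel_of X) A)"
proof -
  have "sets (restrict_space (borel_of X) A)
      = sets (vimage_algebra A (\<lambda>x. x) (sigma (topspace X) {U. openin X U}))"
    using assms by (subst restrict_space_eq_vimage_algebra) (auto simp: borel_of_def space_measure_of_conv)
  also have "\<dots> = sigma_sets A {(\<lambda>x. x) -` U \<inter> A |U. U \<in> {U. openin X U}}"
    by (subst vimage_algebra_sigma) (use assms in \<open>auto dest: openin_subset intro!: sets_measure_of simp del: Collect_mem_eq\<close>)
  also have "{(\<lambda>x. x) -` U \<inter> A |U. U \<in> {U. openin X U}} = {U. openin (subtopology X A) U}"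
    by (auto simp: openin_subtopology)
  finally show ?thesis using assms by (simp add: sets_borel_of inf_absorb2 topspace_subtopology)
qed

lemma measurable_borel_of_continuous:
  assumes "continuous_map X Y f"
  shows "f \<in> borel_of X \<rightarrow>\<^sub>M borel_of Y"
  unfolding borel_of_def[of Y]
proof (rule measurable_measure_of)
  show "f \<in> space (borel_of X) \<rightarrow> topspace Y"
    using assms by (auto simp: space_borel_of continuous_map_def)
  fix U assume "U \<in> {U. openin Y U}"
  moreover have "f -` U \<inter> space (borel_of X) = {x \<in> topspace X. f x \<in> U}"
    by (auto simp: space_borel_of)
  ultimately show "f -` U \<inter> space (borel_of X) \<in> sets (borel_of X)"
    using assms by (auto intro!: borel_of_open simp: continuous_map_def)
qed (auto dest: openin_subset)

subsection \<open>Submean functions along a stationary random walk\<close>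

lemma prob_space_pair:
  assumes "prob_space M" "prob_space N"
  shows "prob_space (M \<Otimes>\<^sub>M N)"
proof -
  interpret P: pair_prob_space M N
    using assms by (simp add: pair_prob_space_def pair_sigma_finite_def prob_space_imp_sigma_finite)
  show ?thesis by (rule P.P.prob_space_axioms)
qed

lemma (in finite_measure) integrable_bounded:
  fixes f :: "'a \<Rightarrow> real"
  assumes "f \<in> borel_measurable M" "\<And>x. x \<in> space M \<Longrightarrow> \<bar>f x\<bar> \<le> C"
  shows "integrable M f"
  using assms by (intro integrable_const_bound[of _ C]) (auto intro!: AE_I2)

lemma (in finite_measure) integrable_bounded_mult:
  fixes f g :: "'a \<Rightarrow> real"
  assumes "f \<in> borel_measurable M" "g \<in> borel_measurable M"
    and "\<And>x. x \<in> space M \<Longrightarrow> \<bar>f x\<bar> \<le> C" "\<And>x. x \<in> space M \<Longrightarrow> \<bar>g x\<bar> \<le> C"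
  shows "integrable M (\<lambda>x. f x * g x)"
proof (rule integrable_bounded[of _ "C * C"])
  fix x assume "x \<in> space M"
  from assms(3,4)[OF this] show "\<bar>f x * g x\<bar> \<le> C * C"
    unfolding abs_mult by (intro mult_mono) auto
qed (use assms(1,2) in simp)

text \<open>\<open>m k\<close> is the law of the walk after \<open>k\<close> steps. The initial law
  is arbitrary: it is instantiated by a product of two stationary measures, which need not be
  stationary for the joint action, and by a point mass at the neutral element.\<close>

locale random_walk =
  fixes p :: "'g measure" and M :: "'x measure" and act :: "'g \<Rightarrow> 'x \<Rightarrow> 'x" and m :: "nat \<Rightarrow> 'x measure"
  assumes prob_p: "prob_space p"
    and act [measurable]: "(\<lambda>(g, y). act g y) \<in> p \<Otimes>\<^sub>M M \<rightarrow>\<^sub>M M"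
    and prob_m0: "prob_space (m 0)" and sets_m0: "sets (m 0) = sets M"
    and m_Suc: "\<And>k. m (Suc k) = distr (p \<Otimes>\<^sub>M m k) M (\<lambda>(g, y). act g y)"
begin

lemma sets_m [measurable_cong]: "sets (m k) = sets M"
  by (cases k) (auto simp: sets_m0 m_Suc)

lemma space_m: "space (m k) = space M"
  by (rule sets_eq_imp_space_eq[OF sets_m])

lemma prob_m: "prob_space (m k)"
proof (induction k)
  case (Suc k)
  then show ?case unfolding m_Suc
    by (intro prob_space.prob_space_distr prob_space_pair prob_p) simp_all
qed (rule prob_m0)

lemma act_space: "g \<in> space p \<Longrightarrow> y \<in> space M \<Longrightarrow> act g y \<in> space M"
  using measurable_space[OF act, of "(g, y)"] by (simp add: space_pair_measure)

lemma integral_m_Suc: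
  fixes f :: "'x \<Rightarrow> real"
  assumes [measurable]: "f \<in> borel_measurable M"
  shows "integral\<^sup>L (m (Suc k)) f = (\<integral>(g, y). f (act g y) \<partial>(p \<Otimes>\<^sub>M m k))"
  unfolding m_Suc by (subst integral_distr) (auto simp: case_prod_unfold)

text \<open>Energy argument: the mean squared increment at time \<open>k\<close> is at most the gain
  of the energy \<open>w\<close> from \<open>k\<close> to \<open>k + 1\<close>, and \<open>w\<close>
  is bounded. So \<open>w\<close> converges and its gains tend to 0.\<close>

lemma submean_increments:
  fixes b :: "'x \<Rightarrow> real"
  assumes b [measurable]: "b \<in> borel_measurable M" and bound: "\<And>y. y \<in> space M \<Longrightarrow> \<bar>b y\<bar> \<le> C"
    and sub: "\<And>y. y \<in> space M \<Longrightarrow> b y \<le> (\<integral>g. b (act g y) \<partial>p)"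
  shows "(\<lambda>k. \<integral>(g, y). (b (act g y) - b y)\<^sup>2 \<partial>(p \<Otimes>\<^sub>M m k)) \<longlonglongrightarrow> 0"
proof -
  \<comment> \<open>The linear term makes the error term have a sign: the squared increment equals
    the gain of b^2 + 2 C b minus 2 (C + b(y)) (b(g y) - b(y)). Since C + b is nonnegative and
    \<open>b\<close> is submean, the subtracted term has nonnegative mean.\<close>
  define w where "w k = (\<integral>y. (b y)\<^sup>2 + 2 * C * b y \<partial>m k)" for k
  define d where "d k = (\<integral>(g, y). (b (act g y) - b y)\<^sup>2 \<partial>(p \<Otimes>\<^sub>M m k))" for k
  obtain y0 where "y0 \<in> space M" using prob_space.not_empty[OF prob_m0] space_m[of 0] by auto
  then have C: "0 \<le> C" using bound[of y0] by linarith
  have d_nonneg: "0 \<le> d k" for k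
    unfolding d_def by (intro integral_nonneg_AE) auto
  have d_le: "d k \<le> w (Suc k) - w k" for k
  proof -
    interpret p: prob_space p by (rule prob_p)
    interpret mk: prob_space "m k" by (rule prob_m)
    interpret J: pair_prob_space p "m k" ..
    let ?J = "p \<Otimes>\<^sub>M m k"
    let ?h1 = "\<lambda>z. b (act (fst z) (snd z))" and ?h2 = "\<lambda>z. b (snd z)"
    note act[unfolded case_prod_unfold, measurable]
    have sp: "fst z \<in> space p" "snd z \<in> space M" if "z \<in> space ?J" for z
      using that by (auto simp: space_pair_measure space_m)
    have h1b: "\<bar>?h1 z\<bar> \<le> C" and h2b: "\<bar>?h2 z\<bar> \<le> C" if "z \<in> space ?J" for z
      using sp[OF that] by (auto simp: case_prod_unfold intro!: bound act_space)
    have i: "integrable ?J ?h1" "integrable ?J ?h2"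
      by (rule J.P.integrable_const_bound[of _ C]; use h1b h2b in \<open>auto intro!: AE_I2\<close>)+
    have i11: "integrable ?J (\<lambda>z. ?h1 z * ?h1 z)"
      using h1b by (intro J.P.integrable_bounded_mult[of _ _ C]) auto
    have i12: "integrable ?J (\<lambda>z. ?h2 z * ?h1 z)"
      using h1b h2b by (intro J.P.integrable_bounded_mult[of _ _ C]) auto
    have i22: "integrable ?J (\<lambda>z. ?h2 z * ?h2 z)"
      using h2b by (intro J.P.integrable_bounded_mult[of _ _ C]) auto
    have pos: "0 \<le> (\<integral>z. (C + ?h2 z) * (?h1 z - ?h2 z) \<partial>?J)"
    proof -
      have "integrable ?J (\<lambda>z. (C + ?h2 z) * (?h1 z - ?h2 z))"
        using i i12 i22 by (simp add: algebra_simps)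
      then have "(\<integral>z. (C + ?h2 z) * (?h1 z - ?h2 z) \<partial>?J)
          = (\<integral>y. (\<integral>g. (C + b y) * (b (act g y) - b y) \<partial>p) \<partial>m k)"
        by (subst J.integral_snd) (auto simp: case_prod_unfold)
      also have "0 \<le> \<dots>"
      proof (rule integral_nonneg_AE, rule AE_I2)
        fix y assume "y \<in> space (m k)"
        then have y: "y \<in> space M" by (simp add: space_m)
        have "integrable p (\<lambda>g. b (act g y))"
          by (rule p.integrable_const_bound[of _ C]) (use y in \<open>auto intro!: AE_I2 bound act_space\<close>)
        then have "(\<integral>g. (C + b y) * (b (act g y) - b y) \<partial>p) = (C + b y) * ((\<integral>g. b (act g y) \<partial>p) - b y)"
          by (simp add: p.prob_space)
        also have "0 \<le> \<dots>" using bound[OF y] sub[OF y] by (intro mult_nonneg_nonneg) auto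
        finally show "0 \<le> (\<integral>g. (C + b y) * (b (act g y) - b y) \<partial>p)" .
      qed
      finally show ?thesis .
    qed
    have w1: "w (Suc k) = (\<integral>z. ?h1 z * ?h1 z + 2 * C * ?h1 z \<partial>?J)"
      unfolding w_def by (subst integral_m_Suc) (auto simp: case_prod_unfold power2_eq_square)
    have w0: "w k = (\<integral>z. ?h2 z * ?h2 z + 2 * C * ?h2 z \<partial>?J)"
    proof -
      have "integrable ?J (\<lambda>z. ?h2 z * ?h2 z + 2 * C * ?h2 z)" using i i22 by auto
      then have "(\<integral>z. ?h2 z * ?h2 z + 2 * C * ?h2 z \<partial>?J) = (\<integral>y. (\<integral>g. b y * b y + 2 * C * b y \<partial>p) \<partial>m k)"
        by (subst J.integral_snd) (auto simp: case_prod_unfold)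
      then show ?thesis by (simp add: w_def power2_eq_square p.prob_space)
    qed
    have "d k = (\<integral>z. ((?h1 z * ?h1 z + 2 * C * ?h1 z) - (?h2 z * ?h2 z + 2 * C * ?h2 z))
        - 2 * ((C + ?h2 z) * (?h1 z - ?h2 z)) \<partial>?J)"
      unfolding d_def by (intro Bochner_Integration.integral_cong)
        (auto simp: algebra_simps power2_eq_square)
    also have "\<dots> = w (Suc k) - w k - 2 * (\<integral>z. (C + ?h2 z) * (?h1 z - ?h2 z) \<partial>?J)"
    proof -
      have "integrable ?J (\<lambda>z. (C + ?h2 z) * (?h1 z - ?h2 z))"
        using i i12 i22 by (simp add: algebra_simps)
      moreover have "integrable ?J (\<lambda>z. ?h1 z * ?h1 z + 2 * C * ?h1 z)"
        "integrable ?J (\<lambda>z. ?h2 z * ?h2 z + 2 * C * ?h2 z)"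
        using i i11 i22 by auto
      ultimately show ?thesis unfolding w1 w0
        by (subst Bochner_Integration.integral_diff, simp, simp)+ (simp)
    qed
    finally show ?thesis using pos by linarith
  qed
  have w_bound: "w k \<le> 3 * C * C" for k
  proof -
    interpret mk: prob_space "m k" by (rule prob_m)
    have "(b y)\<^sup>2 + 2 * C * b y \<le> 3 * C * C" if "y \<in> space M" for y
    proof -
      have "(b y)\<^sup>2 \<le> C * C" using bound[OF that] C by (metis abs_le_square_iff abs_of_nonneg power2_eq_square)
      moreover have "C * b y \<le> C * C" using bound[OF that] C by (intro mult_left_mono) auto
      ultimately show ?thesis by (simp add: algebra_simps)
    qed
    moreover have "integrable (m k) (\<lambda>y. (b y)\<^sup>2 + 2 * C * b y)"
      unfolding power2_eq_square
      by (intro Bochner_Integration.integrable_add mk.integrable_bounded_mult[of _ _ C]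
          integrable_mult_right mk.integrable_bounded[of _ C]) (auto simp: space_m bound)
    ultimately show ?thesis unfolding w_def
      by (intro mk.integral_le_const) (auto intro!: AE_I2 simp: space_m)
  qed
  have inc: "incseq w" using d_le d_nonneg by (intro incseq_SucI) (metis diff_ge_0_iff_ge order_trans)
  have "\<forall>k. w k \<le> 3 * C * C" using w_bound by simp
  from incseq_convergent[OF inc this] obtain L where L: "w \<longlonglongrightarrow> L" .
  then have "(\<lambda>k. w (Suc k) - w k) \<longlonglongrightarrow> L - L"
    by (intro tendsto_diff) (auto simp: LIMSEQ_Suc)
  then have "(\<lambda>k. w (Suc k) - w k) \<longlonglongrightarrow> 0" by simp
  from tendsto_sandwich[OF _ _ tendsto_const this, of d] have "d \<longlonglongrightarrow> 0"
    using d_nonneg d_le by simp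
  then show ?thesis unfolding d_def .
qed

end

lemma fst_measurable_prod:
  fixes p :: "('g::{group_add, countable, discrete_topology} \<times> real) measure"
  assumes "sets p = sets borel"
  shows "fst \<in> p \<rightarrow>\<^sub>M count_space UNIV"
proof -
  have "sets p = sets (count_space (UNIV :: 'g set) \<Otimes>\<^sub>M lborel)"
    using assms sets_haar[where 'g = 'g] by (simp add: haar_def)
  then have "p \<rightarrow>\<^sub>M count_space UNIV = count_space (UNIV :: 'g set) \<Otimes>\<^sub>M lborel \<rightarrow>\<^sub>M count_space (UNIV :: 'g set)"
    by (intro measurable_cong_sets refl)
  then show ?thesis using measurable_fst by simp
qed

lemma slice_in_sets:
  fixes p :: "('g::{group_add, countable, discrete_topology} \<times> real) measure"
  assumes "sets p = sets borel" "B \<in> sets borel"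
  shows "{\<gamma>} \<times> B \<in> sets p"
proof -
  have "{\<gamma>} \<times> B \<in> sets haar" unfolding haar_def using assms(2) by (intro pair_measureI) auto
  then show ?thesis by (simp add: assms(1) sets_haar)
qed

text \<open>The elements whose first coordinate preserves \<open>P\<close> under addition on the
  right form a semigroup. It contains the support of \<open>p\<close>, because a slice over a point
  of the discrete group is open and therefore has positive mass as soon as it meets the
  support.\<close>

lemma generates_semigroup_induct [consumes 1, case_names neutral step]:
  fixes p :: "('g::{group_add, countable, discrete_topology} \<times> real) measure"
  assumes gen: "generates_semigroup (supp p)" and "P 0"
    and step: "\<And>\<gamma> \<gamma>'. P \<gamma>' \<Longrightarrow> emeasure p ({\<gamma>} \<times> UNIV) > 0 \<Longrightarrow> P (\<gamma>' + \<gamma>)"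
  shows "P \<gamma>"
proof -
  let ?S = "{x :: 'g \<times> real. \<forall>\<gamma>'. P \<gamma>' \<longrightarrow> P (\<gamma>' + fst x)}"
  have "supp p \<subseteq> ?S"
  proof safe
    fix a t \<gamma>' assume "(a, t) \<in> supp p" "P \<gamma>'"
    moreover have "open ({a} \<times> (UNIV :: real set))" by (simp add: open_Times discrete_topology_class.open_discrete)
    ultimately have "emeasure p ({a} \<times> UNIV) > 0" by (auto simp: supp_def)
    with step \<open>P \<gamma>'\<close> show "P (\<gamma>' + fst (a, t))" by simp
  qed
  moreover have "\<forall>x\<in>?S. \<forall>y\<in>?S. x + y \<in> ?S"
    by (auto simp flip: add.assoc)
  ultimately have "(\<lambda>S. \<forall>x\<in>S. \<forall>y\<in>S. x + y \<in> S) hull supp p \<subseteq> ?S"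
    by (rule hull_minimal)
  then have "UNIV \<subseteq> ?S" using gen by (simp add: generates_semigroup_def)
  then have "(\<gamma>, 0) \<in> ?S" by (rule subsetD) simp
  then show ?thesis using \<open>P 0\<close> by force
qed

text \<open>The function \<open>- sup \<alpha>\<close> is a bounded primitive of the cocycle, and it is submean by the
  hypothesis on the mean, so its increments along the walk tend to 0.\<close>

lemma cocycle_vanishes:
  fixes p :: "('g::{group_add, countable, discrete_topology} \<times> real) measure" and \<alpha> :: "'g \<Rightarrow> 'x \<Rightarrow> real"
  assumes walk: "random_walk p M act m"
    and sets_p: "sets p = sets borel" and gen: "generates_semigroup (supp p)"
    and meas: "\<And>\<gamma>. \<alpha> \<gamma> \<in> borel_measurable M"
    and bound: "\<And>\<gamma> y. y \<in> space M \<Longrightarrow> \<bar>\<alpha> \<gamma> y\<bar> \<le> C"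
    and zero: "\<And>y. y \<in> space M \<Longrightarrow> \<alpha> 0 y = 0"
    and cocycle: "\<And>\<gamma> g y. y \<in> space M \<Longrightarrow> \<alpha> (\<gamma> + fst g) y = \<alpha> \<gamma> (act g y) + \<alpha> (fst g) y"
    and mean: "\<And>y. y \<in> space M \<Longrightarrow> 0 \<le> (\<integral>g. \<alpha> (fst g) y \<partial>p)"
  shows "(\<lambda>k. \<integral>y. (\<alpha> \<gamma> y)\<^sup>2 \<partial>m k) \<longlonglongrightarrow> 0"
proof -
  interpret random_walk p M act m by (rule walk)
  interpret p: prob_space p by (rule prob_p)
  have [simp]: "space p = UNIV" using sets_eq_imp_space_eq[OF sets_p] by simp
  have [simp]: "measure p UNIV = 1" using p.prob_space by simp
  note [measurable] = fst_measurable_prod[OF sets_p] meas act[unfolded case_prod_unfold]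
  have act_sp: "act g y \<in> space M" if "y \<in> space M" for g y using that by (simp add: act_space)
  define b where "b y = - (SUP \<gamma>. \<alpha> \<gamma> y)" for y
  have bdd: "bdd_above (range (\<lambda>\<gamma>. \<alpha> \<gamma> y))" if "y \<in> space M" for y
    using bound[OF that] by (intro bdd_aboveI[of _ C]) (auto simp: abs_le_iff)
  have [measurable]: "b \<in> borel_measurable M"
    unfolding b_def by (intro borel_measurable_uminus borel_measurable_cSUP) (auto intro!: bdd)
  have b_bound: "\<bar>b y\<bar> \<le> C" if "y \<in> space M" for y
  proof -
    have "(SUP \<gamma>. \<alpha> \<gamma> y) \<le> C" using bound[OF that] by (intro cSUP_least) (auto simp: abs_le_iff)
    moreover have "- C \<le> (SUP \<gamma>. \<alpha> \<gamma> y)"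
      using cSUP_upper[OF _ bdd[OF that], of 0] bound[OF that, of 0] by (auto simp: abs_le_iff)
    ultimately show ?thesis by (simp add: b_def abs_le_iff)
  qed
  \<comment> \<open>The cocycle identity turns the supremum at \<open>act g y\<close> into the one
    at \<open>y\<close>, reindexed by the bijection that adds \<open>fst g\<close> on the right and
    lowered by the constant \<open>\<alpha> (fst g) y\<close>.\<close>
  have b_act: "b (act g y) = b y + \<alpha> (fst g) y" if y: "y \<in> space M" for g y
  proof -
    have "\<alpha> \<gamma> (act g y) = - \<alpha> (fst g) y + \<alpha> (\<gamma> + fst g) y" for \<gamma> using cocycle[OF y, of \<gamma> g] by simp
    then have "(SUP \<gamma>. \<alpha> \<gamma> (act g y)) = (SUP \<gamma>. - \<alpha> (fst g) y + \<alpha> (\<gamma> + fst g) y)" by simp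
    also have "\<dots> = - \<alpha> (fst g) y + (SUP \<gamma>. \<alpha> (\<gamma> + fst g) y)"
      by (intro Sup_add_eq) (auto intro!: bdd_aboveI[of _ C] intro: order_trans[OF abs_ge_self bound[OF y]])
    also have "range (\<lambda>\<gamma>. \<alpha> (\<gamma> + fst g) y) = range (\<lambda>\<gamma>. \<alpha> \<gamma> y)"
    proof (intro equalityI subsetI)
      fix x assume "x \<in> range (\<lambda>\<gamma>. \<alpha> \<gamma> y)"
      then obtain \<gamma> where "x = \<alpha> (\<gamma> - fst g + fst g) y" by auto
      then show "x \<in> range (\<lambda>\<gamma>. \<alpha> (\<gamma> + fst g) y)" by blast
    qed auto
    finally show ?thesis by (simp add: b_def)
  qed
  define e where "e k = (\<integral>z. (\<alpha> (fst (fst z)) (snd z))\<^sup>2 \<partial>(p \<Otimes>\<^sub>M m k))" for k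
  have e: "e \<longlonglongrightarrow> 0"
  proof -
    have "(\<lambda>k. \<integral>(g, y). (b (act g y) - b y)\<^sup>2 \<partial>(p \<Otimes>\<^sub>M m k)) \<longlonglongrightarrow> 0"
    proof (rule submean_increments[of _ C])
      fix y assume y: "y \<in> space M"
      have "integrable p (\<lambda>g. \<alpha> (fst g) y)"
        using bound[OF y] by (intro p.integrable_bounded[of _ C]) auto
      then have "(\<integral>g. b y + \<alpha> (fst g) y \<partial>p) = b y + (\<integral>g. \<alpha> (fst g) y \<partial>p)"
        by simp
      then show "b y \<le> (\<integral>g. b (act g y) \<partial>p)" using mean[OF y] b_act[OF y] by simp
    qed (use b_bound in auto)
    moreover have "(\<integral>(g, y). (b (act g y) - b y)\<^sup>2 \<partial>(p \<Otimes>\<^sub>M m k)) = e k" for k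
      unfolding e_def by (intro Bochner_Integration.integral_cong)
        (auto simp: space_pair_measure space_m b_act)
    ultimately show ?thesis by simp
  qed
  have [measurable]: "(\<lambda>z. \<alpha> (fst (fst z)) (snd z)) \<in> borel_measurable (p \<Otimes>\<^sub>M M)"
    by (rule measurable_compose_countable'[where f = "\<lambda>\<gamma> z. \<alpha> \<gamma> (snd z)" and g = "\<lambda>z. fst (fst z)" and I = UNIV]) auto
  show ?thesis using gen
  proof (induction \<gamma> rule: generates_semigroup_induct)
    case neutral
    have "(\<integral>y. (\<alpha> 0 y)\<^sup>2 \<partial>m k) = 0" for k
      using zero by (intro integral_eq_zero_AE) (auto intro!: AE_I2 simp: space_m)
    then show ?case by simp
  next
    case (step \<gamma> \<gamma>')
    let ?q = "measure p ({\<gamma>} \<times> UNIV)"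
    have q: "0 < ?q" using step(2) by (simp add: p.emeasure_eq_measure)
    \<comment> \<open>On the slice over \<gamma> the cocycle at \<gamma>' + \<gamma> splits into its
      value at \<gamma>' after one step of the walk, which is controlled at time
      \<open>k + 1\<close> by induction, and an increment, which is controlled by
      \<open>e k\<close>. The mass \<open>?q\<close> of the slice is positive and can be divided
      out.\<close>
    have le: "?q * (\<integral>y. (\<alpha> (\<gamma>' + \<gamma>) y)\<^sup>2 \<partial>m k) \<le> 2 * (\<integral>y. (\<alpha> \<gamma>' y)\<^sup>2 \<partial>m (Suc k)) + 2 * e k" for k
    proof -
      interpret mk: prob_space "m k" by (rule prob_m)
      interpret J: pair_prob_space p "m k" ..
      let ?J = "p \<Otimes>\<^sub>M m k" and ?A = "{\<gamma>} \<times> (UNIV :: real set)"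
      have A: "?A \<in> sets p"
        by (rule slice_in_sets[OF sets_p]) simp
      have sp: "snd z \<in> space M" if "z \<in> space ?J" for z using that by (auto simp: space_pair_measure space_m)
      have i1: "integrable ?J (\<lambda>z. (\<alpha> \<gamma>' (act (fst z) (snd z)))\<^sup>2)"
        unfolding power2_eq_square using sp
        by (intro J.P.integrable_bounded_mult[of _ _ C]) (auto intro!: bound act_sp)
      have i2: "integrable ?J (\<lambda>z. (\<alpha> (fst (fst z)) (snd z))\<^sup>2)"
        unfolding power2_eq_square using sp
        by (intro J.P.integrable_bounded_mult[of _ _ C]) (auto intro!: bound)
      have "integrable ?J (\<lambda>z. indicator ?A (fst z) * (\<alpha> (\<gamma>' + \<gamma>) (snd z))\<^sup>2)"
        by (rule J.P.integrable_bounded[of _ "C\<^sup>2"])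
          (use A sp bound in \<open>auto simp: indicator_def abs_le_square_iff[symmetric] intro!: order_trans[OF bound abs_ge_self]\<close>)
      then have i3: "integrable ?J (\<lambda>(g, y). indicator ?A g * (\<alpha> (\<gamma>' + \<gamma>) y)\<^sup>2)"
        by (simp add: case_prod_unfold)
      have "?q * (\<integral>y. (\<alpha> (\<gamma>' + \<gamma>) y)\<^sup>2 \<partial>m k)
          = (\<integral>y. (\<integral>g. indicator ?A g * (\<alpha> (\<gamma>' + \<gamma>) y)\<^sup>2 \<partial>p) \<partial>m k)"
        using A by simp
      also have "\<dots> = (\<integral>(g, y). indicator ?A g * (\<alpha> (\<gamma>' + \<gamma>) y)\<^sup>2 \<partial>?J)"
        by (rule J.integral_snd[OF i3])
      also have "\<dots> \<le> (\<integral>z. 2 * (\<alpha> \<gamma>' (act (fst z) (snd z)))\<^sup>2 + 2 * (\<alpha> (fst (fst z)) (snd z))\<^sup>2 \<partial>?J)"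
      proof (rule integral_mono[OF i3])
        fix z assume z: "z \<in> space ?J"
        obtain g y where [simp]: "z = (g, y)" by (cases z)
        show "(case z of (g, y) \<Rightarrow> indicator ?A g * (\<alpha> (\<gamma>' + \<gamma>) y)\<^sup>2)
          \<le> 2 * (\<alpha> \<gamma>' (act (fst z) (snd z)))\<^sup>2 + 2 * (\<alpha> (fst (fst z)) (snd z))\<^sup>2"
        proof (cases "fst g = \<gamma>")
          case True
          have "\<alpha> (\<gamma>' + \<gamma>) y = \<alpha> \<gamma>' (act g y) + \<alpha> (fst g) y"
            using cocycle[of y \<gamma>' g] sp[OF z] True by simp
          then show ?thesis using True sum_squares_bound[of "\<alpha> \<gamma>' (act g y)" "\<alpha> (fst g) y"]
            by (simp add: power2_sum indicator_def)
        qed (auto simp: indicator_def)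
      qed (use i1 i2 in auto)
      also have "\<dots> = 2 * (\<integral>y. (\<alpha> \<gamma>' y)\<^sup>2 \<partial>m (Suc k)) + 2 * e k"
        using i1 i2 by (subst integral_m_Suc) (auto simp: e_def case_prod_unfold)
      finally show ?thesis .
    qed
    have "(\<lambda>k. 2 * (\<integral>y. (\<alpha> \<gamma>' y)\<^sup>2 \<partial>m (Suc k)) + 2 * e k) \<longlonglongrightarrow> 2 * 0 + 2 * 0"
      using step(1) e by (intro tendsto_intros LIMSEQ_Suc)
    then have lim: "(\<lambda>k. 2 * (\<integral>y. (\<alpha> \<gamma>' y)\<^sup>2 \<partial>m (Suc k)) + 2 * e k) \<longlonglongrightarrow> 0" by simp
    have "0 \<le> ?q * (\<integral>y. (\<alpha> (\<gamma>' + \<gamma>) y)\<^sup>2 \<partial>m k)" for k by simp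
    then have "(\<lambda>k. ?q * (\<integral>y. (\<alpha> (\<gamma>' + \<gamma>) y)\<^sup>2 \<partial>m k)) \<longlonglongrightarrow> 0"
      using le by (intro tendsto_sandwich[OF _ _ tendsto_const lim] always_eventually allI)
    then have "(\<lambda>k. inverse ?q * (?q * (\<integral>y. (\<alpha> (\<gamma>' + \<gamma>) y)\<^sup>2 \<partial>m k))) \<longlonglongrightarrow> inverse ?q * 0"
      by (intro tendsto_mult tendsto_const)
    then show ?case using q by (simp flip: mult.assoc)
  qed
qed

section \<open>Comparing the laws of two cocycles\<close>

lemma sets_PiM_real_halfspaces:
  "sets (\<Pi>\<^sub>M i\<in>(UNIV :: 'i set). (borel :: real measure)) =
    sigma_sets UNIV ((\<lambda>(J, a). {f. \<forall>i\<in>J. f i \<le> a i}) ` ({J. finite J} \<times> UNIV))" (is "_ = sigma_sets _ ?E")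
proof
  have [simp]: "space (sigma UNIV ?E) = UNIV" by (simp add: space_measure_of_conv)
  have "(\<lambda>f i. f i) \<in> sigma UNIV ?E \<rightarrow>\<^sub>M (\<Pi>\<^sub>M i\<in>(UNIV :: 'i set). (borel :: real measure))"
  proof (rule measurable_PiM_single')
    fix i :: 'i
    show "(\<lambda>f. f i) \<in> borel_measurable (sigma UNIV ?E)"
      unfolding borel_measurable_iff_le
    proof
      fix a
      have "{w. w i \<le> a} \<in> ?E" by (rule image_eqI[of _ _ "({i}, \<lambda>_. a)"]) auto
      then show "{w \<in> space (sigma UNIV ?E). w i \<le> a} \<in> sets (sigma UNIV ?E)"
        by (simp add: sets_measure_of_conv del: image_eqI)
    qed
  qed auto
  from measurable_sets[OF this] show "sets (\<Pi>\<^sub>M i\<in>(UNIV :: 'i set). (borel :: real measure)) \<subseteq> sigma_sets UNIV ?E"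
    by (auto simp: sets_measure_of_conv)
  have "{f. \<forall>i\<in>J. f i \<le> a i} \<in> sets (\<Pi>\<^sub>M i\<in>(UNIV :: 'i set). (borel :: real measure))" if "finite J" for J a
  proof -
    have "{f. \<forall>i\<in>J. f i \<le> a i} = {f \<in> space (\<Pi>\<^sub>M i\<in>(UNIV :: 'i set). (borel :: real measure)). \<forall>i\<in>J. f i \<le> a i}"
      by (auto simp: space_PiM)
    also have "\<dots> \<in> sets (\<Pi>\<^sub>M i\<in>(UNIV :: 'i set). (borel :: real measure))"
      using that by (intro sets.sets_Collect_finite_All) measurable
    finally show ?thesis .
  qed
  then have "?E \<subseteq> sets (\<Pi>\<^sub>M i\<in>(UNIV :: 'i set). (borel :: real measure))" by auto
  from sets.sigma_sets_subset[OF this]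
  show "sigma_sets UNIV ?E \<subseteq> sets (\<Pi>\<^sub>M i\<in>(UNIV :: 'i set). (borel :: real measure))"
    by (simp add: space_PiM)
qed

lemma prob_measure_PiM_real_eqI:
  fixes M N :: "('i \<Rightarrow> real) measure"
  assumes M: "prob_space M" "sets M = sets (\<Pi>\<^sub>M i\<in>UNIV. borel)"
    and N: "prob_space N" "sets N = sets (\<Pi>\<^sub>M i\<in>UNIV. borel)"
    and eq: "\<And>J a. finite J \<Longrightarrow> measure M {f. \<forall>i\<in>J. f i \<le> a i} = measure N {f. \<forall>i\<in>J. f i \<le> a i}"
  shows "M = N"
proof -
  interpret M: prob_space M by fact
  interpret N: prob_space N by fact
  let ?E = "(\<lambda>(J, a). {f. \<forall>i\<in>J. f i \<le> a i}) ` ({J :: 'i set. finite J} \<times> (UNIV :: ('i \<Rightarrow> real) set))"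
  show ?thesis
  proof (rule measure_eqI_generator_eq[of ?E UNIV M N "\<lambda>_. UNIV"])
    show "Int_stable ?E"
    proof (rule Int_stableI, elim imageE, clarsimp)
      fix I J :: "'i set" and a b :: "'i \<Rightarrow> real" assume "finite I" "finite J"
      define c where "c i = (if i \<in> I \<inter> J then min (a i) (b i) else if i \<in> I then a i else b i)" for i
      have "{f. \<forall>i\<in>I. f i \<le> a i} \<inter> {f. \<forall>i\<in>J. f i \<le> b i} = {f. \<forall>i\<in>I \<union> J. f i \<le> c i}"
        by (auto simp: c_def)
      with \<open>finite I\<close> \<open>finite J\<close> show "{f. \<forall>i\<in>I. f i \<le> a i} \<inter> {f. \<forall>i\<in>J. f i \<le> b i} \<in> ?E"
        by (intro image_eqI[of _ _ "(I \<union> J, c)"]) auto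
    qed
    show "range (\<lambda>_. UNIV) \<subseteq> ?E" by (auto intro!: image_eqI[of _ _ "({}, \<lambda>_. 0)"])
  qed (auto simp: M N sets_PiM_real_halfspaces M.emeasure_eq_measure N.emeasure_eq_measure eq)
qed

text \<open>Each \<open>m k\<close> couples the two laws. By Markov's inequality the two families
  differ by at least \<open>e\<close> at some index in \<open>J\<close> only on a set whose mass
  tends to 0 with \<open>k\<close>; elsewhere a bound \<open>a\<close> for the first family gives
  the bound \<open>a + e\<close> for the second. The slack \<open>e\<close> is removed after
  \<open>k\<close> has gone to infinity.\<close>

lemma coupling_le:
  fixes m :: "nat \<Rightarrow> 'z measure" and \<beta>\<^sub>1 :: "'i \<Rightarrow> 'x \<Rightarrow> real" and \<beta>\<^sub>2 :: "'i \<Rightarrow> 'y \<Rightarrow> real"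
  assumes m: "\<And>k. prob_space (m k)"
    and f\<^sub>1: "\<And>k. f\<^sub>1 \<in> m k \<rightarrow>\<^sub>M N\<^sub>1" "\<And>k. distr (m k) N\<^sub>1 f\<^sub>1 = N\<^sub>1"
    and f\<^sub>2: "\<And>k. f\<^sub>2 \<in> m k \<rightarrow>\<^sub>M N\<^sub>2" "\<And>k. distr (m k) N\<^sub>2 f\<^sub>2 = N\<^sub>2"
    and \<beta>: "\<And>i. \<beta>\<^sub>1 i \<in> borel_measurable N\<^sub>1" "\<And>i. \<beta>\<^sub>2 i \<in> borel_measurable N\<^sub>2"
    and bound: "\<And>k i z. z \<in> space (m k) \<Longrightarrow> \<bar>\<beta>\<^sub>1 i (f\<^sub>1 z) - \<beta>\<^sub>2 i (f\<^sub>2 z)\<bar> \<le> C"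
    and lim: "\<And>i. (\<lambda>k. \<integral>z. (\<beta>\<^sub>1 i (f\<^sub>1 z) - \<beta>\<^sub>2 i (f\<^sub>2 z))\<^sup>2 \<partial>m k) \<longlonglongrightarrow> 0"
    and J: "finite J"
  shows "measure N\<^sub>1 {x \<in> space N\<^sub>1. \<forall>i\<in>J. \<beta>\<^sub>1 i x \<le> a i} \<le> measure N\<^sub>2 {y \<in> space N\<^sub>2. \<forall>i\<in>J. \<beta>\<^sub>2 i y \<le> a i}"
proof -
  note [measurable] = f\<^sub>1(1) f\<^sub>2(1) \<beta>
  define B where "B e = {y \<in> space N\<^sub>2. \<forall>i\<in>J. \<beta>\<^sub>2 i y \<le> a i + e}" for e
  have B_mono: "B e \<subseteq> B e'" if "e \<le> e'" for e e'
  proof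
    fix y assume y: "y \<in> B e"
    have "\<beta>\<^sub>2 i y \<le> a i + e'" if "i \<in> J" for i
    proof -
      have "\<beta>\<^sub>2 i y \<le> a i + e" using y that by (simp add: B_def)
      with \<open>e \<le> e'\<close> show ?thesis by linarith
    qed
    with y show "y \<in> B e'" by (simp add: B_def)
  qed
  have [measurable]: "B e \<in> sets N\<^sub>2" for e
    unfolding B_def using J by (intro sets.sets_Collect_finite_All) measurable
  have A [measurable]: "{x \<in> space N\<^sub>1. \<forall>i\<in>J. \<beta>\<^sub>1 i x \<le> a i} \<in> sets N\<^sub>1" (is "?A \<in> _")
    using J by (intro sets.sets_Collect_finite_All) measurable
  have N2: "prob_space N\<^sub>2"
    using prob_space.prob_space_distr[OF m f\<^sub>2(1)] by (simp add: f\<^sub>2(2))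
  have main: "measure N\<^sub>1 ?A \<le> measure N\<^sub>2 (B e)" if e: "e > 0" for e
  proof -
    define s where "s k = (\<Sum>i\<in>J. (\<integral>z. (\<beta>\<^sub>1 i (f\<^sub>1 z) - \<beta>\<^sub>2 i (f\<^sub>2 z))\<^sup>2 \<partial>m k) / e\<^sup>2)" for k
    have "measure N\<^sub>1 ?A \<le> measure N\<^sub>2 (B e) + s k" for k
    proof -
      interpret mk: prob_space "m k" by (rule m)
      let ?D = "\<lambda>i. {z \<in> space (m k). e\<^sup>2 \<le> (\<beta>\<^sub>1 i (f\<^sub>1 z) - \<beta>\<^sub>2 i (f\<^sub>2 z))\<^sup>2}"
      have D: "?D i \<in> sets (m k)" for i by measurable
      have BD: "f\<^sub>2 -` B e \<inter> space (m k) \<in> sets (m k)" "(\<Union>i\<in>J. ?D i) \<in> sets (m k)"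
        using J D by (auto intro!: measurable_sets[OF f\<^sub>2(1)])
      have "measure N\<^sub>1 ?A = measure (m k) (f\<^sub>1 -` ?A \<inter> space (m k))"
        by (subst f\<^sub>1(2)[symmetric, of k], subst measure_distr) auto
      also have "\<dots> \<le> measure (m k) ((f\<^sub>2 -` B e \<inter> space (m k)) \<union> (\<Union>i\<in>J. ?D i))"
      proof (rule mk.finite_measure_mono)
        show "f\<^sub>1 -` ?A \<inter> space (m k) \<subseteq> (f\<^sub>2 -` B e \<inter> space (m k)) \<union> (\<Union>i\<in>J. ?D i)"
        proof
          fix z assume z: "z \<in> f\<^sub>1 -` ?A \<inter> space (m k)"
          then have sp: "f\<^sub>2 z \<in> space N\<^sub>2" using measurable_space[OF f\<^sub>2(1)] by auto
          show "z \<in> (f\<^sub>2 -` B e \<inter> space (m k)) \<union> (\<Union>i\<in>J. ?D i)"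
          proof (cases "\<exists>i\<in>J. e \<le> \<bar>\<beta>\<^sub>1 i (f\<^sub>1 z) - \<beta>\<^sub>2 i (f\<^sub>2 z)\<bar>")
            case True
            then obtain i where "i \<in> J" "e \<le> \<bar>\<beta>\<^sub>1 i (f\<^sub>1 z) - \<beta>\<^sub>2 i (f\<^sub>2 z)\<bar>" by auto
            then have "z \<in> ?D i" using z e abs_le_square_iff[of e "\<beta>\<^sub>1 i (f\<^sub>1 z) - \<beta>\<^sub>2 i (f\<^sub>2 z)"] by auto
            with \<open>i \<in> J\<close> show ?thesis by auto
          next
            case False
            have "\<beta>\<^sub>2 i (f\<^sub>2 z) \<le> a i + e" if "i \<in> J" for i
            proof -
              have "\<bar>\<beta>\<^sub>1 i (f\<^sub>1 z) - \<beta>\<^sub>2 i (f\<^sub>2 z)\<bar> < e" using False that by force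
              moreover have "\<beta>\<^sub>1 i (f\<^sub>1 z) \<le> a i" using z that by auto
              ultimately show ?thesis by linarith
            qed
            then show ?thesis using z sp by (auto simp: B_def)
          qed
        qed
      qed (use BD in blast)
      also have "\<dots> \<le> measure (m k) (f\<^sub>2 -` B e \<inter> space (m k)) + measure (m k) (\<Union>i\<in>J. ?D i)"
        using BD by (rule measure_Un_le)
      also have "measure (m k) (f\<^sub>2 -` B e \<inter> space (m k)) = measure N\<^sub>2 (B e)"
        by (subst f\<^sub>2(2)[symmetric, of k], subst measure_distr) auto
      also have "measure (m k) (\<Union>i\<in>J. ?D i) \<le> (\<Sum>i\<in>J. measure (m k) (?D i))"
        using J D by (intro mk.finite_measure_subadditive_finite) auto
      also have "\<dots> \<le> s k"
        unfolding s_def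
      proof (rule sum_mono)
        fix i assume "i \<in> J"
        have "integrable (m k) (\<lambda>z. (\<beta>\<^sub>1 i (f\<^sub>1 z) - \<beta>\<^sub>2 i (f\<^sub>2 z))\<^sup>2)"
          unfolding power2_eq_square by (intro mk.integrable_bounded_mult[of _ _ C]) (auto simp: bound)
        then show "measure (m k) (?D i) \<le> (\<integral>z. (\<beta>\<^sub>1 i (f\<^sub>1 z) - \<beta>\<^sub>2 i (f\<^sub>2 z))\<^sup>2 \<partial>m k) / e\<^sup>2"
          using e by (intro integral_Markov_inequality_measure[of _ _ "{}"]) auto
      qed
      finally show ?thesis by simp
    qed
    moreover have "(\<lambda>k. measure N\<^sub>2 (B e) + s k) \<longlonglongrightarrow> measure N\<^sub>2 (B e) + (\<Sum>i\<in>J. 0 / e\<^sup>2)"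
      unfolding s_def using lim e by (intro tendsto_intros) auto
    ultimately show ?thesis
      by (intro LIMSEQ_le_const[of "\<lambda>k. measure N\<^sub>2 (B e) + s k"]) auto
  qed
  \<comment> \<open>The inequalities defining \<open>B\<close> are not strict, so these sets
    decrease to exactly \<open>B 0\<close> and continuity from above applies.\<close>
  have "(\<lambda>n. measure N\<^sub>2 (B (inverse (real (Suc n))))) \<longlonglongrightarrow> measure N\<^sub>2 (\<Inter>n. B (inverse (real (Suc n))))"
  proof (rule finite_measure.finite_Lim_measure_decseq)
    show "finite_measure N\<^sub>2" using N2 by (rule prob_space.finite_measure)
    show "decseq (\<lambda>n. B (inverse (real (Suc n))))"
      by (intro decseq_SucI B_mono) (simp add: field_simps)
  qed auto
  moreover have "(\<Inter>n. B (inverse (real (Suc n)))) = B 0"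
  proof (intro equalityI subsetI)
    fix y assume y: "y \<in> (\<Inter>n. B (inverse (real (Suc n))))"
    have "\<beta>\<^sub>2 i y \<le> a i" if "i \<in> J" for i
    proof (rule LIMSEQ_le_const)
      show "(\<lambda>n. a i + inverse (real (Suc n))) \<longlonglongrightarrow> a i"
        using LIMSEQ_inverse_real_of_nat_add[of "a i"] by simp
      show "\<exists>N. \<forall>n\<ge>N. \<beta>\<^sub>2 i y \<le> a i + inverse (real (Suc n))"
        using y that by (auto simp: B_def)
    qed
    with y show "y \<in> B 0" by (auto simp: B_def)
  next
    fix y assume "y \<in> B 0"
    then show "y \<in> (\<Inter>n. B (inverse (real (Suc n))))"
      using B_mono[of 0] by (auto simp: subset_iff)
  qed
  ultimately have "(\<lambda>n. measure N\<^sub>2 (B (inverse (real (Suc n))))) \<longlonglongrightarrow> measure N\<^sub>2 (B 0)" by simp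
  then have "measure N\<^sub>1 ?A \<le> measure N\<^sub>2 (B 0)"
    by (rule LIMSEQ_le_const) (auto intro!: main)
  then show ?thesis by (simp add: B_def)
qed


text \<open>An equivariant map carries the walk to the walk on \<open>N\<close>, which starts in a
  stationary law and keeps it, even when the laws \<open>m k\<close> themselves change with
  \<open>k\<close>.\<close>

lemma random_walk_marginal:
  assumes walk: "random_walk p M act m"
    and \<pi>: "\<pi> \<in> M \<rightarrow>\<^sub>M N" and equi: "\<And>g y. g \<in> space p \<Longrightarrow> y \<in> space M \<Longrightarrow> \<pi> (act g y) = a g (\<pi> y)"
    and a: "(\<lambda>(g, x). a g x) \<in> p \<Otimes>\<^sub>M N \<rightarrow>\<^sub>M N"
    and stationary: "distr (p \<Otimes>\<^sub>M N) N (\<lambda>(g, x). a g x) = N"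
    and initial: "distr (m 0) N \<pi> = N"
  shows "distr (m k) N \<pi> = N"
proof (induction k)
  case (Suc k)
  interpret random_walk p M act m by (rule walk)
  have [measurable]: "\<pi> \<in> m k \<rightarrow>\<^sub>M N" using \<pi> by simp
  have sf: "sigma_finite_measure (distr (m k) N \<pi>)"
    by (intro prob_space_imp_sigma_finite prob_space.prob_space_distr prob_m) simp
  have "distr (m (Suc k)) N \<pi> = distr (p \<Otimes>\<^sub>M m k) N (\<lambda>z. \<pi> (act (fst z) (snd z)))"
    unfolding m_Suc using \<pi> by (subst distr_distr) (auto simp: comp_def case_prod_unfold)
  also have "\<dots> = distr (p \<Otimes>\<^sub>M m k) N (\<lambda>z. a (fst z) (\<pi> (snd z)))"
    by (rule distr_cong) (auto simp: space_pair_measure space_m equi)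
  also have "\<dots> = distr (distr (p \<Otimes>\<^sub>M m k) (p \<Otimes>\<^sub>M N) (\<lambda>(g, y). (g, \<pi> y))) N (\<lambda>(g, x). a g x)"
    using a by (subst distr_distr) (auto simp: comp_def case_prod_unfold)
  also have "distr (p \<Otimes>\<^sub>M m k) (p \<Otimes>\<^sub>M N) (\<lambda>(g, y). (g, \<pi> y)) = distr p p (\<lambda>g. g) \<Otimes>\<^sub>M distr (m k) N \<pi>"
    using sf by (intro pair_measure_distr[symmetric]) auto
  finally show ?case by (simp add: Suc stationary)
qed (rule initial)

text \<open>Both coordinates are driven by the same group element, which makes the difference of the
  two cocycles a cocycle on the product, so that \<open>cocycle_vanishes\<close> applies to it. The
  mean is assumed to have one sign only, but the resulting mean-square bound is symmetric in the two
  cocycles and yields both inequalities between their distribution functions.\<close>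

lemma cocycle_laws_eq:
  fixes p :: "('g::{group_add, countable, discrete_topology} \<times> real) measure"
    and \<alpha>\<^sub>1 :: "'g \<Rightarrow> 'x \<Rightarrow> real" and \<alpha>\<^sub>2 :: "'g \<Rightarrow> 'y \<Rightarrow> real"
  assumes p: "prob_space p" "sets p = sets borel" "generates_semigroup (supp p)"
    and N\<^sub>1: "prob_space N\<^sub>1" "(\<lambda>(g, x). a\<^sub>1 g x) \<in> p \<Otimes>\<^sub>M N\<^sub>1 \<rightarrow>\<^sub>M N\<^sub>1" "distr (p \<Otimes>\<^sub>M N\<^sub>1) N\<^sub>1 (\<lambda>(g, x). a\<^sub>1 g x) = N\<^sub>1"
    and N\<^sub>2: "prob_space N\<^sub>2" "(\<lambda>(g, x). a\<^sub>2 g x) \<in> p \<Otimes>\<^sub>M N\<^sub>2 \<rightarrow>\<^sub>M N\<^sub>2" "distr (p \<Otimes>\<^sub>M N\<^sub>2) N\<^sub>2 (\<lambda>(g, x). a\<^sub>2 g x) = N\<^sub>2"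
    and meas: "\<And>\<gamma>. \<alpha>\<^sub>1 \<gamma> \<in> borel_measurable N\<^sub>1" "\<And>\<gamma>. \<alpha>\<^sub>2 \<gamma> \<in> borel_measurable N\<^sub>2"
    and bound: "\<And>\<gamma> x y. x \<in> space N\<^sub>1 \<Longrightarrow> y \<in> space N\<^sub>2 \<Longrightarrow> \<bar>\<alpha>\<^sub>1 \<gamma> x - \<alpha>\<^sub>2 \<gamma> y\<bar> \<le> C"
    and zero: "\<And>x. x \<in> space N\<^sub>1 \<Longrightarrow> \<alpha>\<^sub>1 0 x = 0" "\<And>x. x \<in> space N\<^sub>2 \<Longrightarrow> \<alpha>\<^sub>2 0 x = 0"
    and cocycle: "\<And>\<gamma> g x. x \<in> space N\<^sub>1 \<Longrightarrow> \<alpha>\<^sub>1 (\<gamma> + fst g) x = \<alpha>\<^sub>1 \<gamma> (a\<^sub>1 g x) + \<alpha>\<^sub>1 (fst g) x"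
      "\<And>\<gamma> g x. x \<in> space N\<^sub>2 \<Longrightarrow> \<alpha>\<^sub>2 (\<gamma> + fst g) x = \<alpha>\<^sub>2 \<gamma> (a\<^sub>2 g x) + \<alpha>\<^sub>2 (fst g) x"
    and mean: "\<And>x y. x \<in> space N\<^sub>1 \<Longrightarrow> y \<in> space N\<^sub>2 \<Longrightarrow> 0 \<le> (\<integral>g. \<alpha>\<^sub>1 (fst g) x - \<alpha>\<^sub>2 (fst g) y \<partial>p)"
  shows "distr N\<^sub>1 (\<Pi>\<^sub>M \<gamma>\<in>UNIV. borel) (\<lambda>x \<gamma>. \<alpha>\<^sub>1 \<gamma> x) = distr N\<^sub>2 (\<Pi>\<^sub>M \<gamma>\<in>UNIV. borel) (\<lambda>x \<gamma>. \<alpha>\<^sub>2 \<gamma> x)"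
proof -
  interpret N1: prob_space N\<^sub>1 by fact
  interpret N2: prob_space N\<^sub>2 by fact
  interpret N12: pair_prob_space N\<^sub>1 N\<^sub>2 ..
  let ?M = "N\<^sub>1 \<Otimes>\<^sub>M N\<^sub>2"
  let ?act = "\<lambda>g z. (a\<^sub>1 g (fst z), a\<^sub>2 g (snd z))"
  define m where "m k = rec_nat ?M (\<lambda>_ mk. distr (p \<Otimes>\<^sub>M mk) ?M (\<lambda>(g, z). ?act g z)) k" for k :: nat
  note [measurable] = meas N\<^sub>1(2)[unfolded case_prod_unfold] N\<^sub>2(2)[unfolded case_prod_unfold]
  have a1: "(\<lambda>z. a\<^sub>1 (fst z) (fst (snd z))) \<in> p \<Otimes>\<^sub>M ?M \<rightarrow>\<^sub>M N\<^sub>1"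
    by (rule measurable_compose[of "\<lambda>z. (fst z, fst (snd z))" _ "p \<Otimes>\<^sub>M N\<^sub>1", OF _ N\<^sub>1(2)[unfolded case_prod_unfold], simplified]) simp
  have a2: "(\<lambda>z. a\<^sub>2 (fst z) (snd (snd z))) \<in> p \<Otimes>\<^sub>M ?M \<rightarrow>\<^sub>M N\<^sub>2"
    by (rule measurable_compose[of "\<lambda>z. (fst z, snd (snd z))" _ "p \<Otimes>\<^sub>M N\<^sub>2", OF _ N\<^sub>2(2)[unfolded case_prod_unfold], simplified]) simp
  have walk: "random_walk p ?M ?act m"
  proof (rule random_walk.intro)
    show "(\<lambda>(g, z). ?act g z) \<in> p \<Otimes>\<^sub>M ?M \<rightarrow>\<^sub>M ?M"
      unfolding case_prod_unfold using a1 a2 by simp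
  qed (simp_all add: m_def p N12.P.prob_space_axioms)
  interpret random_walk p ?M ?act m by (rule walk)
  have m0: "m 0 = ?M" by (simp add: m_def)
  have fst_m: "fst \<in> m k \<rightarrow>\<^sub>M N\<^sub>1" and snd_m: "snd \<in> m k \<rightarrow>\<^sub>M N\<^sub>2" for k by simp_all
  have marg1: "distr (m k) N\<^sub>1 fst = N\<^sub>1" for k
    by (rule random_walk_marginal[OF walk _ _ N\<^sub>1(2,3)]) (auto simp: m0 N2.distr_pair_fst)
  have marg2: "distr (m k) N\<^sub>2 snd = N\<^sub>2" for k
  proof (rule random_walk_marginal[OF walk _ _ N\<^sub>2(2,3)])
    show "distr (m 0) N\<^sub>2 snd = N\<^sub>2"
    proof (rule measure_eqI)
      fix A assume "A \<in> sets (distr (m 0) N\<^sub>2 snd)"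
      then have A: "A \<in> sets N\<^sub>2" by simp
      have "snd -` A \<inter> space ?M = space N\<^sub>1 \<times> A"
        using sets.sets_into_space[OF A] by (auto simp: space_pair_measure)
      then show "emeasure (distr (m 0) N\<^sub>2 snd) A = emeasure N\<^sub>2 A"
        using A by (simp add: m0 emeasure_distr N2.emeasure_pair_measure_Times N1.emeasure_space_1)
    qed simp
  qed auto
  let ?\<alpha> = "\<lambda>\<gamma> z. \<alpha>\<^sub>1 \<gamma> (fst z) - \<alpha>\<^sub>2 \<gamma> (snd z)"
  have lim: "(\<lambda>k. \<integral>z. (?\<alpha> \<gamma> z)\<^sup>2 \<partial>m k) \<longlonglongrightarrow> 0" for \<gamma>
  proof (rule cocycle_vanishes[OF walk p(2,3), of ?\<alpha> C])
    fix \<gamma> g z assume "z \<in> space ?M"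
    then show "?\<alpha> (\<gamma> + fst g) z = ?\<alpha> \<gamma> (?act g z) + ?\<alpha> (fst g) z"
      using cocycle(1)[of "fst z" \<gamma> g] cocycle(2)[of "snd z" \<gamma> g] by (auto simp: space_pair_measure)
  qed (auto simp: space_pair_measure zero intro!: bound mean)
  have lim': "(\<lambda>k. \<integral>z. (\<alpha>\<^sub>2 \<gamma> (snd z) - \<alpha>\<^sub>1 \<gamma> (fst z))\<^sup>2 \<partial>m k) \<longlonglongrightarrow> 0" for \<gamma>
    using lim[of \<gamma>] by (simp add: power2_commute)
  have bd: "\<bar>?\<alpha> \<gamma> z\<bar> \<le> C" if "z \<in> space (m k)" for \<gamma> z k
    using that by (auto simp: space_m space_pair_measure intro!: bound)
  have eq: "measure N\<^sub>1 {x \<in> space N\<^sub>1. \<forall>i\<in>J. \<alpha>\<^sub>1 i x \<le> a i} = measure N\<^sub>2 {y \<in> space N\<^sub>2. \<forall>i\<in>J. \<alpha>\<^sub>2 i y \<le> a i}"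
    if J: "finite J" for J a
  proof (rule antisym)
    show "measure N\<^sub>1 {x \<in> space N\<^sub>1. \<forall>i\<in>J. \<alpha>\<^sub>1 i x \<le> a i} \<le> measure N\<^sub>2 {y \<in> space N\<^sub>2. \<forall>i\<in>J. \<alpha>\<^sub>2 i y \<le> a i}"
      by (rule coupling_le[OF prob_m fst_m marg1 snd_m marg2 meas bd lim J])
    show "measure N\<^sub>2 {x \<in> space N\<^sub>2. \<forall>i\<in>J. \<alpha>\<^sub>2 i x \<le> a i} \<le> measure N\<^sub>1 {y \<in> space N\<^sub>1. \<forall>i\<in>J. \<alpha>\<^sub>1 i y \<le> a i}"
      by (rule coupling_le[OF prob_m snd_m marg2 fst_m marg1 meas(2,1) _ lim' J])
        (subst abs_minus_commute, rule bd)
  qed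
  have m1: "(\<lambda>x \<gamma>. \<alpha>\<^sub>1 \<gamma> x) \<in> N\<^sub>1 \<rightarrow>\<^sub>M (\<Pi>\<^sub>M \<gamma>\<in>UNIV. borel)"
    and m2: "(\<lambda>x \<gamma>. \<alpha>\<^sub>2 \<gamma> x) \<in> N\<^sub>2 \<rightarrow>\<^sub>M (\<Pi>\<^sub>M \<gamma>\<in>UNIV. borel)"
    by (auto intro!: measurable_PiM_single' simp: meas)
  have half: "{f. \<forall>i\<in>J. f i \<le> a i} \<in> sets (\<Pi>\<^sub>M \<gamma>\<in>UNIV. borel)" if "finite J" for J :: "'g set" and a :: "'g \<Rightarrow> real"
    unfolding sets_PiM_real_halfspaces using that by (intro sigma_sets.Basic image_eqI[of _ _ "(J, a)"]) auto
  show ?thesis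
  proof (rule prob_measure_PiM_real_eqI)
    fix J :: "'g set" and a :: "'g \<Rightarrow> real" assume J: "finite J"
    show "measure (distr N\<^sub>1 (\<Pi>\<^sub>M \<gamma>\<in>UNIV. borel) (\<lambda>x \<gamma>. \<alpha>\<^sub>1 \<gamma> x)) {f. \<forall>i\<in>J. f i \<le> a i}
      = measure (distr N\<^sub>2 (\<Pi>\<^sub>M \<gamma>\<in>UNIV. borel) (\<lambda>x \<gamma>. \<alpha>\<^sub>2 \<gamma> x)) {f. \<forall>i\<in>J. f i \<le> a i}"
      using eq[OF J, of a] by (simp add: measure_distr m1 m2 half[OF J] vimage_def Int_def conj_commute)
  qed (auto intro!: N1.prob_space_distr N2.prob_space_distr m1 m2)
qed

section \<open>Invariance of stationary measures under the central reals\<close>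

lemma steinhaus:
  fixes B :: "real set"
  assumes B: "B \<in> sets borel" and pos: "emeasure lborel B > 0"
  shows "\<exists>d>0. \<forall>t. \<bar>t\<bar> < d \<longrightarrow> (\<exists>x\<in>B. \<exists>y\<in>B. x - y = t)"
proof -
  have "\<exists>n. 0 < emeasure lborel (B \<inter> {- real n..real n})"
  proof (rule ccontr)
    assume "\<not> ?thesis"
    then have "emeasure lborel (\<Union>n. B \<inter> {- real n..real n}) = 0"
      using B by (intro emeasure_UN_eq_0) (auto simp: zero_less_iff_neq_zero)
    moreover have "(\<Union>n. B \<inter> {- real n..real n}) = B"
    proof (intro equalityI subsetI)
      fix x assume "x \<in> B"
      moreover obtain n where "\<bar>x\<bar> \<le> real n" using real_arch_simple by blast
      ultimately show "x \<in> (\<Union>n. B \<inter> {- real n..real n})" by (auto simp: abs_le_iff intro!: exI[of _ n])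
    qed auto
    ultimately show False using pos by simp
  qed
  then obtain n where n: "0 < emeasure lborel (B \<inter> {- real n..real n})" by blast
  define I where "I = {- real n..real n}"
  define B0 where "B0 = B \<inter> I"
  have B0: "B0 \<in> sets borel" "0 < emeasure lborel B0" using B n by (auto simp: B0_def I_def)
  have finI: "emeasure lborel I < \<infinity>" by (simp add: I_def)
  have fin: "emeasure lborel X < \<infinity>" if "X \<subseteq> I" for X
    using order.strict_trans1[OF emeasure_mono[OF that, of lborel] finI] by (simp add: I_def)
  define e where "e = measure lborel B0"
  have e: "e > 0" using B0 fin[of B0] by (simp add: e_def B0_def measure_def enn2real_positive_iff)
  \<comment> \<open>Inner regularity by complements in the bounded interval \<open>I\<close>: an
    open set slightly larger than \<open>I - B0\<close> leaves a compact part \<open>K\<close> of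
    \<open>B0\<close>, of positive measure because the excess is below \<open>e\<close>, the measure
    of \<open>B0\<close>.\<close>
  obtain V where V: "open V" "I - B0 \<subseteq> V" "emeasure lborel (V - (I - B0)) < ennreal e"
    by (rule outer_regular_lborel[of "I - B0" e]) (use B0 e in \<open>auto simp: I_def\<close>)
  define K where "K = I - V"
  have K: "compact K" "K \<subseteq> B0" "K \<subseteq> I"
    using V by (auto simp: K_def I_def intro!: compact_diff)
  have Kb: "K \<in> sets borel" using K(1) by (simp add: borel_compact)
  have "emeasure lborel B0 \<le> emeasure lborel (K \<union> (V - (I - B0)))"
    using V(1) B0 Kb by (intro emeasure_mono) (auto simp: K_def B0_def I_def)
  also have "\<dots> \<le> emeasure lborel K + emeasure lborel (V - (I - B0))"
    using V(1) B0 Kb by (intro emeasure_subadditive) (auto simp: I_def)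
  finally have "ennreal e \<le> emeasure lborel K + emeasure lborel (V - (I - B0))"
    using fin[of B0] by (simp add: e_def emeasure_eq_ennreal_measure B0_def)
  then have Kpos: "emeasure lborel K \<noteq> 0" using V(3) by auto
  define k where "k = measure lborel K"
  have Kk: "emeasure lborel K = ennreal k" using fin[OF K(3)] by (simp add: k_def emeasure_eq_ennreal_measure)
  have k: "k > 0" using Kpos Kk by (metis ennreal_eq_0_iff not_le)
  \<comment> \<open>The neighbourhood \<open>U\<close> has measure below twice that of
    \<open>K\<close>. For small \<open>t\<close> both \<open>K\<close> and its shift by
    \<open>t\<close> lie in \<open>U\<close>, so they cannot be disjoint, and a common point
    exhibits \<open>t\<close> as a difference.\<close>
  obtain U where U: "open U" "K \<subseteq> U" "emeasure lborel (U - K) < ennreal k"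
    by (rule outer_regular_lborel[OF Kb k])
  have "emeasure lborel U \<le> emeasure lborel K + emeasure lborel (U - K)"
    using U Kb emeasure_subadditive[of K lborel "U - K"] by (simp add: Un_absorb1)
  also have "\<dots> < ennreal k + ennreal k"
    using U(3) Kk by (simp add: ennreal_add_left_cancel_less)
  finally have Uk: "emeasure lborel U < ennreal k + ennreal k" .
  obtain d where d: "d > 0" "(\<Union>x\<in>K. ball x d) \<subseteq> U"
    by (rule compact_subset_open_imp_ball_epsilon_subset[OF K(1) U(1,2)])
  have "\<exists>x\<in>K. \<exists>y\<in>K. x - y = t" if t: "\<bar>t\<bar> < d" for t
  proof (rule ccontr)
    assume no: "\<not> (\<exists>x\<in>K. \<exists>y\<in>K. x - y = t)"
    let ?K' = "(+) (- t) -` K"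
    have K'b: "?K' \<in> sets borel"
      using measurable_sets[of "(+) (- t)" borel borel K] Kb by auto
    have "emeasure lborel ?K' = emeasure (distr lborel borel ((+) (- t))) K"
      using Kb by (simp add: emeasure_distr)
    also have "\<dots> = ennreal k" by (simp add: lborel_distr_plus Kk)
    finally have K'k: "emeasure lborel ?K' = ennreal k" .
    have "?K' \<subseteq> U"
    proof
      fix x assume "x \<in> ?K'"
      then have "- t + x \<in> K" by simp
      moreover from this have "x \<in> ball (- t + x) d" using t by (simp add: dist_real_def)
      ultimately show "x \<in> U" using d(2) by blast
    qed
    then have "emeasure lborel (K \<union> ?K') \<le> emeasure lborel U"
      using U(1,2) by (intro emeasure_mono) auto
    moreover have "K \<inter> ?K' = {}"
    proof (rule ccontr)
      assume "K \<inter> ?K' \<noteq> {}"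
      then obtain x where "x \<in> K" "- t + x \<in> K" by auto
      moreover have "x - (- t + x) = t" by simp
      ultimately show False using no by blast
    qed
    then have "emeasure lborel (K \<union> ?K') = ennreal k + ennreal k"
      using Kb K'b by (subst plus_emeasure[symmetric]) (auto simp: Kk K'k)
    ultimately show False using Uk by simp
  qed
  with d(1) K(2) show ?thesis unfolding B0_def by blast
qed

lemma plus_measurable_prod:
  fixes p :: "('g::{group_add, countable, discrete_topology} \<times> real) measure"
  assumes p: "sets p = sets borel"
  shows "(\<lambda>(g, h). g + h) \<in> p \<Otimes>\<^sub>M p \<rightarrow>\<^sub>M p"
proof -
  let ?q = "count_space (UNIV :: 'g set) \<Otimes>\<^sub>M (borel :: real measure)"
  have pq: "sets p = sets ?q"
  proof -
    have "sets (haar :: ('g \<times> real) measure) = sets ?q"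
      unfolding haar_def by (rule sets_pair_measure_cong) simp_all
    with p sets_haar[where 'g = 'g] show ?thesis by simp
  qed
  have [measurable]: "(\<lambda>z. fst z + snd z) \<in> count_space (UNIV :: 'g set) \<Otimes>\<^sub>M count_space UNIV \<rightarrow>\<^sub>M count_space UNIV"
    by (subst pair_measure_countable) auto
  have "(\<lambda>z. fst (fst z) + fst (snd z)) \<in> ?q \<Otimes>\<^sub>M ?q \<rightarrow>\<^sub>M count_space UNIV"
    by (rule measurable_compose[of "\<lambda>z. (fst (fst z), fst (snd z))" _ "count_space UNIV \<Otimes>\<^sub>M count_space UNIV"
          "\<lambda>z. fst z + snd z", simplified]) measurable
  then have "(\<lambda>z. (fst (fst z) + fst (snd z), snd (fst z) + snd (snd z))) \<in> ?q \<Otimes>\<^sub>M ?q \<rightarrow>\<^sub>M ?q"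
    by measurable
  moreover have "(\<lambda>z. (fst (fst z) + fst (snd z), snd (fst z) + snd (snd z))) = (\<lambda>(g, h). (g :: 'g \<times> real) + h)"
    by (auto simp: fun_eq_iff)
  moreover have "p \<Otimes>\<^sub>M p \<rightarrow>\<^sub>M p = ?q \<Otimes>\<^sub>M ?q \<rightarrow>\<^sub>M ?q"
    by (intro measurable_cong_sets sets_pair_measure_cong pq)
  ultimately show ?thesis by simp
qed

lemma snd_measurable_prod:
  fixes p :: "('g::{group_add, countable, discrete_topology} \<times> real) measure"
  assumes "sets p = sets borel"
  shows "snd \<in> p \<rightarrow>\<^sub>M borel"
proof -
  have "(snd :: 'g \<times> real \<Rightarrow> real) \<in> borel \<rightarrow>\<^sub>M borel"
    by (intro borel_measurable_continuous_onI continuous_intros)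
  then show ?thesis using assms by (simp cong: measurable_cong_sets)
qed

lemma uminus_measurable_prod:
  fixes p :: "('g::{group_add, countable, discrete_topology} \<times> real) measure"
  assumes p: "sets p = sets borel"
  shows "uminus \<in> p \<rightarrow>\<^sub>M p"
proof -
  have [measurable]: "(\<lambda>z. - fst z) \<in> p \<rightarrow>\<^sub>M count_space UNIV"
    using measurable_compose[OF fst_measurable_prod[OF p], of uminus "count_space UNIV"] by simp
  note [measurable] = snd_measurable_prod[OF p]
  have "(\<lambda>z. (- fst z, - snd z)) \<in> p \<rightarrow>\<^sub>M count_space UNIV \<Otimes>\<^sub>M lborel" by measurable
  moreover have "p \<rightarrow>\<^sub>M count_space (UNIV :: 'g set) \<Otimes>\<^sub>M lborel = p \<rightarrow>\<^sub>M p"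
    by (rule measurable_cong_sets) (simp_all add: p sets_haar[unfolded haar_def])
  moreover have "(\<lambda>z. (- fst z, - snd z)) = (uminus :: 'g \<times> real \<Rightarrow> _)" by (auto simp: fun_eq_iff)
  ultimately show ?thesis by simp
qed

lemma prob_space_exists_atom:
  fixes p :: "('g::{group_add, countable, discrete_topology} \<times> real) measure"
  assumes "prob_space p" "sets p = sets borel"
  shows "\<exists>\<gamma>. emeasure p ({\<gamma>} \<times> UNIV) > 0"
proof (rule ccontr)
  interpret prob_space p by fact
  assume "\<not> ?thesis"
  then have "{\<gamma>} \<times> UNIV \<in> null_sets p" for \<gamma>
    using slice_in_sets[OF assms(2), of UNIV] by (auto simp: zero_less_iff_neq_zero null_sets_def)
  then have "(\<Union>\<gamma>. {\<gamma>} \<times> UNIV) \<in> null_sets p" by (rule null_sets_UN)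
  moreover have "(\<Union>\<gamma>. {\<gamma>} \<times> UNIV) = space p" using sets_eq_imp_space_eq[OF assms(2)] by auto
  ultimately show False using emeasure_space_1 by (simp add: null_sets_def)
qed


text \<open>The function \<open>u A\<close> below is bounded and harmonic, so its increments along the right random walk
  \<open>S\<close> tend to 0; two steps that add up to \<open>(0, t)\<close> commute with \<open>S\<close>, hence \<open>u A (0, t) = u A 0\<close>.  Absolute
  continuity yields this for a set of \<open>t\<close> of positive measure, which generates the reals.\<close>

lemma stationary_invariant_under_reals:
  fixes p :: "('g::{group_add, countable, discrete_topology} \<times> real) measure"
    and a :: "'g \<times> real \<Rightarrow> 'x \<Rightarrow> 'x"
  assumes p: "prob_space p" "sets p = sets borel" "symmetric_measure p" "absolutely_continuous haar p"
    and N: "prob_space N" and a: "(\<lambda>(g, x). a g x) \<in> p \<Otimes>\<^sub>M N \<rightarrow>\<^sub>M N"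
    and stationary: "distr (p \<Otimes>\<^sub>M N) N (\<lambda>(g, x). a g x) = N"
    and a_plus: "\<And>g h x. x \<in> space N \<Longrightarrow> a g (a h x) = a (g + h) x"
    and a_0: "\<And>x. x \<in> space N \<Longrightarrow> a 0 x = x"
    and E: "countable E" "Int_stable E" "space N \<in> E" "E \<subseteq> Pow (space N)" "sets N = sigma_sets (space N) E"
  shows "distr N N (a (0, s)) = N"
proof -
  interpret p: prob_space p by fact
  interpret N: prob_space N by fact
  interpret pN: pair_prob_space p N ..
  interpret pp: pair_prob_space p p ..
  have sp [simp]: "space p = UNIV" using sets_eq_imp_space_eq[OF p(2)] by simp
  note a' [measurable] = a[unfolded case_prod_unfold]
  note plus [measurable] = plus_measurable_prod[OF p(2), unfolded case_prod_unfold]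
  have ag [measurable]: "a g \<in> N \<rightarrow>\<^sub>M N" for g
    using measurable_Pair2[OF a, of g] by simp
  \<comment> \<open>\<open>u A g\<close> is the mass that the image of \<open>N\<close> under
    \<open>a g\<close> gives to \<open>A\<close>. Invariance under (0, s) amounts to equality of
    \<open>u A\<close> at (0, s) and at 0 for all \<open>A\<close> in the generator, and
    stationarity makes \<open>u A\<close> harmonic for steps added on the right.\<close>
  define u where "u A g = (\<integral>x. indicator A (a g x) \<partial>N :: real)" for A g
  have u_meas [measurable]: "u A \<in> borel_measurable p" if "A \<in> sets N" for A
    unfolding u_def using that by (intro N.borel_measurable_lebesgue_integral) (simp add: case_prod_unfold)
  have u_bound: "\<bar>u A g\<bar> \<le> 1" if "A \<in> sets N" for A g
  proof -
    have "0 \<le> u A g" unfolding u_def by (intro integral_nonneg_AE) auto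
    moreover have "u A g \<le> 1" unfolding u_def
      using that by (intro N.integral_le_const N.integrable_bounded[of _ 1]) (auto simp: indicator_def)
    ultimately show ?thesis by simp
  qed
  have u_harm: "(\<integral>h. u A (g + h) \<partial>p) = u A g" if A [measurable]: "A \<in> sets N" for A g
  proof -
    have "(\<integral>h. u A (g + h) \<partial>p) = (\<integral>h. (\<integral>x. indicator A (a g (a h x)) \<partial>N) \<partial>p)"
      unfolding u_def by (intro Bochner_Integration.integral_cong refl) (simp_all add: a_plus)
    also have "\<dots> = (\<integral>z. indicator A (a g (a (fst z) (snd z))) \<partial>(p \<Otimes>\<^sub>M N))"
    proof -
      have "integrable (p \<Otimes>\<^sub>M N) (\<lambda>z. indicator A (a g (a (fst z) (snd z))) :: real)"
        by (rule pN.P.integrable_bounded[of _ 1]) (auto simp: indicator_def)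
      from pN.integral_fst'[OF this] show ?thesis by simp
    qed
    also have "\<dots> = (\<integral>y. indicator A (a g y) \<partial>distr (p \<Otimes>\<^sub>M N) N (\<lambda>(g, x). a g x))"
      by (subst integral_distr) (auto simp: case_prod_unfold)
    finally show ?thesis unfolding stationary u_def .
  qed
  \<comment> \<open>Law of a sum of \<open>k\<close> independent steps, started at 0 and extended on
    the right. This is the side on which \<open>u A\<close> is harmonic, so averaging
    \<open>u A (z + S)\<close> over \<open>S\<close> returns \<open>u A z\<close>.\<close>
  define m where "m k = rec_nat (return p 0) (\<lambda>_ mk. distr (p \<Otimes>\<^sub>M mk) p (\<lambda>(g, y). y + g)) k" for k :: nat
  have flip: "(\<lambda>(g, y). y + g) \<in> p \<Otimes>\<^sub>M p \<rightarrow>\<^sub>M p"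
    using measurable_compose[OF measurable_Pair[OF measurable_snd measurable_fst] plus]
    by (simp add: case_prod_unfold)
  have walk: "random_walk p p (\<lambda>h S. S + h) m"
    by (rule random_walk.intro) (simp_all add: m_def p flip prob_space_return)
  interpret random_walk p p "\<lambda>h S. S + h" m by (rule walk)
  have u_harm_m: "(\<integral>S. u A (z + S) \<partial>m k) = u A z" if A [measurable]: "A \<in> sets N" for A z k
  proof (induction k)
    case 0
    have "(\<integral>S. u A (z + S) \<partial>return p 0) = u A (z + 0)"
      by (intro integral_return) simp_all
    then show ?case by (simp add: m_def)
  next
    case (Suc k)
    interpret mk: prob_space "m k" by (rule prob_m)
    interpret J: pair_prob_space p "m k" ..
    have "(\<integral>S. u A (z + S) \<partial>m (Suc k)) = (\<integral>(h, S). u A (z + (S + h)) \<partial>(p \<Otimes>\<^sub>M m k))"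
      by (rule integral_m_Suc) simp
    also have "\<dots> = (\<integral>S. (\<integral>h. u A (z + S + h) \<partial>p) \<partial>m k)"
    proof -
      have "integrable (p \<Otimes>\<^sub>M m k) (\<lambda>(h, S). u A (z + S + h))"
        by (rule J.P.integrable_bounded[of _ 1]) (auto simp: u_bound case_prod_unfold)
      from J.integral_snd[OF this] show ?thesis by (simp add: add.assoc)
    qed
    also have "\<dots> = u A z" by (simp add: u_harm Suc)
    finally show ?case .
  qed
  have key: "AE z in p \<Otimes>\<^sub>M p. fst (fst z + snd z) = 0 \<longrightarrow> u A (fst z + snd z) = u A 0"
    if A [measurable]: "A \<in> sets N" for A
  proof -
    define F where "F g S = ennreal ((u A (S + g) - u A S)\<^sup>2)" for g S
    have F [measurable]: "(\<lambda>z. F (fst z) (snd z)) \<in> borel_measurable (p \<Otimes>\<^sub>M p)"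
      unfolding F_def by measurable
    have F' [measurable]: "F h \<in> borel_measurable p" for h
      using measurable_compose_Pair1[OF _ F, of h] by simp
    have u_diff: "\<bar>u A g - u A h\<bar> \<le> 2" for g h
      using u_bound[OF A, of g] u_bound[OF A, of h] by linarith
    define D where "D k = (\<integral>(g, y). (u A (y + g) - u A y)\<^sup>2 \<partial>(p \<Otimes>\<^sub>M m k))" for k
    have D: "D \<longlonglongrightarrow> 0"
      unfolding D_def by (rule submean_increments[of _ 1]) (simp_all add: u_bound u_harm)
    have FD: "(\<integral>\<^sup>+z. F (fst z) (snd z) \<partial>(p \<Otimes>\<^sub>M m k)) = ennreal (D k)" for k
    proof -
      interpret mk: prob_space "m k" by (rule prob_m)
      interpret J: pair_prob_space p "m k" ..
      have "integrable (p \<Otimes>\<^sub>M m k) (\<lambda>z. (u A (snd z + fst z) - u A (snd z))\<^sup>2)"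
        unfolding power2_eq_square
        by (rule J.P.integrable_bounded_mult[of _ _ 2]) (simp_all add: u_diff)
      then show ?thesis unfolding F_def D_def
        by (subst nn_integral_eq_integral) (auto simp: case_prod_unfold)
    qed
    \<comment> \<open>Mean squared deviation over two independent steps, restricted to the pairs
      whose sum lies in the copy of the reals. It does not involve \<open>k\<close>, so the bound
      \<open>W_le\<close> by increments at times \<open>k\<close> and \<open>k + 1\<close> forces it
      to vanish.\<close>
    define W where "W = (\<integral>\<^sup>+h1. (\<integral>\<^sup>+h2. (if fst (h1 + h2) = 0 then ennreal ((u A (h1 + h2) - u A 0)\<^sup>2) else 0) \<partial>p) \<partial>p)"
    have W_le: "W \<le> 2 * ennreal (D (Suc k)) + 2 * ennreal (D k)" for k
    proof -
      interpret mk: prob_space "m k" by (rule prob_m)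
      interpret J: pair_prob_space p "m k" ..
      have "W \<le> (\<integral>\<^sup>+h1. (\<integral>\<^sup>+h2. (\<integral>\<^sup>+S. F (h1 + h2) S \<partial>m k) \<partial>p) \<partial>p)"
        unfolding W_def
      proof (intro nn_integral_mono)
        fix h1 h2
        show "(if fst (h1 + h2) = 0 then ennreal ((u A (h1 + h2) - u A 0)\<^sup>2) else 0)
          \<le> (\<integral>\<^sup>+S. F (h1 + h2) S \<partial>m k)"
        proof (cases "fst (h1 + h2) = 0")
          case True
          define z where "z = h1 + h2"
          have comm: "z + S = S + z" for S
            using True unfolding z_def[symmetric] by (cases z; cases S) (simp add: add.commute)
          have i: "integrable (m k) (\<lambda>S. u A (S + z))" "integrable (m k) (u A)"
            by (auto intro!: mk.integrable_bounded[of _ 1] u_bound)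
          have i2: "integrable (m k) (\<lambda>S. (u A (S + z) - u A S)\<^sup>2)"
            unfolding power2_eq_square by (rule mk.integrable_bounded_mult[of _ _ 2]) (simp_all add: u_diff)
          \<comment> \<open>Both values are means along the walk. As \<open>z\<close> is central,
            \<open>z + S\<close> equals \<open>S + z\<close>, and their difference becomes the mean
            of an increment; its square is at most the mean square because a variance is
            nonnegative.\<close>
          have "u A z - u A 0 = (\<integral>S. u A (S + z) - u A S \<partial>m k)"
            using u_harm_m[OF A, of k z] u_harm_m[OF A, of k 0] i by (simp add: comm)
          moreover have "(\<integral>S. u A (S + z) - u A S \<partial>m k)\<^sup>2 \<le> (\<integral>S. (u A (S + z) - u A S)\<^sup>2 \<partial>m k)"
          proof -
            define w where "w S = u A (S + z) - u A S" for S
            have "integrable (m k) w" "integrable (m k) (\<lambda>S. (w S)\<^sup>2)"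
              using i i2 unfolding w_def by auto
            from mk.variance_eq[OF this] mk.variance_positive[of w]
            show ?thesis unfolding w_def[symmetric] by linarith
          qed
          ultimately have "(u A z - u A 0)\<^sup>2 \<le> (\<integral>S. (u A (S + z) - u A S)\<^sup>2 \<partial>m k)" by simp
          then have "ennreal ((u A z - u A 0)\<^sup>2) \<le> ennreal (\<integral>S. (u A (S + z) - u A S)\<^sup>2 \<partial>m k)"
            by (rule ennreal_leI)
          also have "\<dots> = (\<integral>\<^sup>+S. F z S \<partial>m k)"
            unfolding F_def by (subst nn_integral_eq_integral[OF i2]) auto
          finally show ?thesis using True by (simp add: z_def)
        qed simp
      qed
      \<comment> \<open>The increment by \<open>h1 + h2\<close> from \<open>S\<close> is the
        increment by \<open>h1\<close> from \<open>S\<close> plus the increment by \<open>h2\<close>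
        from \<open>S + h1\<close>. The latter starting point has law \<open>m (Suc k)\<close>, so
        both squares are increments of the walk itself.\<close>
      also have "\<dots> \<le> (\<integral>\<^sup>+h1. (\<integral>\<^sup>+h2. (\<integral>\<^sup>+S. 2 * F h2 (S + h1) + 2 * F h1 S \<partial>m k) \<partial>p) \<partial>p)"
      proof (intro nn_integral_mono)
        fix h1 h2 S
        define x where "x = u A (S + h1 + h2) - u A (S + h1)"
        define y where "y = u A (S + h1) - u A S"
        have "(x + y)\<^sup>2 \<le> 2 * x\<^sup>2 + 2 * y\<^sup>2"
          using sum_squares_bound[of x y] by (simp add: power2_sum)
        then have "ennreal ((x + y)\<^sup>2) \<le> 2 * ennreal (x\<^sup>2) + 2 * ennreal (y\<^sup>2)"
          by (simp add: ennreal_leI flip: ennreal_plus ennreal_mult'' ennreal_numeral)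
        then show "F (h1 + h2) S \<le> 2 * F h2 (S + h1) + 2 * F h1 S"
          by (simp add: F_def x_def y_def add.assoc)
      qed
      also have "\<dots> = (\<integral>\<^sup>+h1. (\<integral>\<^sup>+h2. 2 * (\<integral>\<^sup>+S. F h2 (S + h1) \<partial>m k) + 2 * (\<integral>\<^sup>+S. F h1 S \<partial>m k) \<partial>p) \<partial>p)"
        by (intro nn_integral_cong) (simp add: nn_integral_add nn_integral_cmult F_def)
      also have "\<dots> = 2 * (\<integral>\<^sup>+h1. (\<integral>\<^sup>+h2. (\<integral>\<^sup>+S. F h2 (S + h1) \<partial>m k) \<partial>p) \<partial>p)
          + 2 * (\<integral>\<^sup>+h1. (\<integral>\<^sup>+S. F h1 S \<partial>m k) \<partial>p)"
        by (simp add: nn_integral_add nn_integral_cmult F_def p.emeasure_space_1[simplified])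
      also have "(\<integral>\<^sup>+h1. (\<integral>\<^sup>+S. F h1 S \<partial>m k) \<partial>p) = ennreal (D k)"
        unfolding FD[symmetric] by (subst mk.nn_integral_fst[symmetric]) auto
      also have "(\<integral>\<^sup>+h1. (\<integral>\<^sup>+h2. (\<integral>\<^sup>+S. F h2 (S + h1) \<partial>m k) \<partial>p) \<partial>p)
          = (\<integral>\<^sup>+h2. (\<integral>\<^sup>+h1. (\<integral>\<^sup>+S. F h2 (S + h1) \<partial>m k) \<partial>p) \<partial>p)"
        by (rule pp.Fubini') (simp add: F_def)
      also have "\<dots> = (\<integral>\<^sup>+h2. (\<integral>\<^sup>+S. F h2 S \<partial>m (Suc k)) \<partial>p)"
      proof (rule nn_integral_cong)
        fix h2
        have "(\<integral>\<^sup>+h1. (\<integral>\<^sup>+S. F h2 (S + h1) \<partial>m k) \<partial>p) = (\<integral>\<^sup>+z. F h2 (snd z + fst z) \<partial>(p \<Otimes>\<^sub>M m k))"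
          by (subst mk.nn_integral_fst[symmetric]) (auto simp: F_def)
        also have "\<dots> = (\<integral>\<^sup>+S. F h2 S \<partial>m (Suc k))"
          unfolding m_Suc by (subst nn_integral_distr) (auto simp: F_def case_prod_unfold)
        finally show "(\<integral>\<^sup>+h1. (\<integral>\<^sup>+S. F h2 (S + h1) \<partial>m k) \<partial>p) = (\<integral>\<^sup>+S. F h2 S \<partial>m (Suc k))" .
      qed
      also have "\<dots> = ennreal (D (Suc k))"
      proof -
        interpret mS: prob_space "m (Suc k)" by (rule prob_m)
        show ?thesis unfolding FD[symmetric] by (subst mS.nn_integral_fst[symmetric]) auto
      qed
      finally show ?thesis by (simp add: add.commute)
    qed
    have "(\<lambda>k. 2 * ennreal (D (Suc k)) + 2 * ennreal (D k)) \<longlonglongrightarrow> 2 * ennreal 0 + 2 * ennreal 0"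
      using D by (intro tendsto_add ennreal_tendsto_cmult tendsto_ennrealI LIMSEQ_Suc) auto
    then have "W \<le> 2 * ennreal 0 + 2 * ennreal 0"
      by (rule LIMSEQ_le_const) (auto intro!: W_le)
    then have "W = 0" by simp
    moreover have "W = (\<integral>\<^sup>+z. (if fst (fst z + snd z) = 0 then ennreal ((u A (fst z + snd z) - u A 0)\<^sup>2) else 0) \<partial>(p \<Otimes>\<^sub>M p))"
      unfolding W_def
    proof (subst p.nn_integral_fst[symmetric])
      have [measurable]: "(\<lambda>z. fst (fst z + snd z)) \<in> p \<Otimes>\<^sub>M p \<rightarrow>\<^sub>M count_space UNIV"
        using measurable_compose[OF plus fst_measurable_prod[OF p(2)]] by simp
      show "(\<lambda>z. (if fst (fst z + snd z) = 0 then ennreal ((u A (fst z + snd z) - u A 0)\<^sup>2) else 0))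
          \<in> borel_measurable (p \<Otimes>\<^sub>M p)"
        by measurable
    qed (simp only: fst_conv snd_conv)
    moreover have "(\<lambda>z. (if fst (fst z + snd z) = 0 then ennreal ((u A (fst z + snd z) - u A 0)\<^sup>2) else 0))
        \<in> borel_measurable (p \<Otimes>\<^sub>M p)"
    proof -
      have [measurable]: "(\<lambda>z. fst (fst z + snd z)) \<in> p \<Otimes>\<^sub>M p \<rightarrow>\<^sub>M count_space UNIV"
        using measurable_compose[OF plus fst_measurable_prod[OF p(2)]] by simp
      show ?thesis by measurable
    qed
    ultimately have "AE z in p \<Otimes>\<^sub>M p. (if fst (fst z + snd z) = 0 then ennreal ((u A (fst z + snd z) - u A 0)\<^sup>2) else 0) = 0"
      by (subst nn_integral_0_iff_AE[symmetric]) auto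
    then show ?thesis by eventually_elim (auto split: if_splits)
  qed
  define T where "T = {s. distr N N (a (0, s)) = N}"
  have E_sets: "A \<in> sets N" if "A \<in> E" for A using E(5) that by auto
  have T_I: "t \<in> T" if eq: "\<And>A. A \<in> E \<Longrightarrow> u A (0, t) = u A 0" for t
  proof -
    have u_eq: "u A g = measure (distr N N (a g)) A" if "A \<in> sets N" for A g
    proof -
      have "u A g = (\<integral>x. indicator (a g -` A \<inter> space N) x \<partial>N)"
        unfolding u_def by (intro Bochner_Integration.integral_cong refl) (auto simp: indicator_def)
      also have "\<dots> = measure N (a g -` A \<inter> space N)"
        using that by simp
      finally show ?thesis using that by (simp add: measure_distr)
    qed
    have "distr N N (a 0) = distr N N (\<lambda>x. x)" by (rule distr_cong) (auto simp: a_0)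
    then have 0: "u A 0 = measure N A" if "A \<in> sets N" for A using u_eq[OF that, of 0] by simp
    interpret Nt: prob_space "distr N N (a (0, t))" by (intro N.prob_space_distr) simp
    have "distr N N (a (0, t)) = N"
    proof (rule measure_eqI_generator_eq[of E "space N" _ _ "\<lambda>_. space N"])
      fix A assume "A \<in> E"
      then show "emeasure (distr N N (a (0, t))) A = emeasure N A"
        using eq[OF \<open>A \<in> E\<close>] 0[OF E_sets] u_eq[OF E_sets]
        by (simp only: Nt.emeasure_eq_measure N.emeasure_eq_measure)
    qed (use E in auto)
    then show ?thesis by (simp add: T_def)
  qed
  have T_diff: "s - t \<in> T" if "s \<in> T" "t \<in> T" for s t
  proof -
    have "distr N N (a (0, s - t)) = distr (distr N N (a (0, t))) N (a (0, s - t))"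
      using that by (simp add: T_def)
    also have "\<dots> = distr N N (\<lambda>x. a (0, s - t) (a (0, t) x))"
      by (subst distr_distr) (auto simp: comp_def)
    also have "\<dots> = distr N N (a (0, s))"
      by (rule distr_cong) (auto simp: a_plus)
    finally show ?thesis using that by (simp add: T_def)
  qed
  \<comment> \<open>As \<open>E\<close> is countable, a single null set works for all its members,
    so that \<open>T_I\<close> can be applied to one pair of steps at a time.\<close>
  have "AE z in p \<Otimes>\<^sub>M p. \<forall>A\<in>E. fst (fst z + snd z) = 0 \<longrightarrow> u A (fst z + snd z) = u A 0"
    unfolding AE_ball_countable[OF E(1)] using key[OF E_sets] by blast
  then have "AE z in p \<Otimes>\<^sub>M p. fst (fst z) + fst (snd z) = 0 \<longrightarrow> snd (fst z) + snd (snd z) \<in> T"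
  proof eventually_elim
    case (elim z)
    show ?case
    proof
      assume 0: "fst (fst z) + fst (snd z) = 0"
      then have "fst z + snd z = (0, snd (fst z) + snd (snd z))" by (simp add: plus_prod_def)
      with elim 0 show "snd (fst z) + snd (snd z) \<in> T" by (intro T_I) auto
    qed
  qed
  from pp.AE_pair[OF this] have AE1: "AE g in p. AE h in p. fst g + fst h = 0 \<longrightarrow> snd g + snd h \<in> T" by simp
  obtain \<gamma> where \<gamma>: "emeasure p ({\<gamma>} \<times> UNIV) > 0" using prob_space_exists_atom[OF p(1,2)] by blast
  have sl: "{\<gamma>} \<times> B \<in> sets p" if "B \<in> sets borel" for \<gamma> and B :: "real set"
    using that by (rule slice_in_sets[OF p(2)])
  \<comment> \<open>The slice over \<gamma> has positive mass, so it contains a good first step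
    (\<gamma>, t). The second step then ranges over the slice over - \<gamma>.\<close>
  have "\<exists>g. fst g = \<gamma> \<and> (AE h in p. fst g + fst h = 0 \<longrightarrow> snd g + snd h \<in> T)"
  proof (rule ccontr)
    assume "\<not> ?thesis"
    with AE1 have "AE g in p. g \<notin> {\<gamma>} \<times> UNIV" by (auto elim!: eventually_mono)
    then have "emeasure p ({\<gamma>} \<times> UNIV) = 0" using sl[of UNIV \<gamma>]
      by (subst (asm) AE_iff_measurable[OF _ refl]) (auto simp: Times_eq_image_sum)
    with \<gamma> show False by simp
  qed
  then obtain t where t: "AE h in p. \<gamma> + fst h = 0 \<longrightarrow> t + snd h \<in> T" by auto
  then obtain Z where Z: "{h \<in> space p. \<not> (\<gamma> + fst h = 0 \<longrightarrow> t + snd h \<in> T)} \<subseteq> Z" "emeasure p Z = 0" "Z \<in> sets p"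
    by (rule AE_E)
  define B where "B = Pair (- \<gamma>) -` (- Z)"
  have B: "B \<in> sets borel"
  proof -
    have "- Z \<in> sets (haar :: ('g \<times> real) measure)" using sets.compl_sets[OF Z(3)]
      by (simp add: p(2) sets_haar Compl_eq_Diff_UNIV)
    from sets_Pair1[OF this[unfolded haar_def]] show ?thesis by (simp add: B_def)
  qed
  have BT: "t + x \<in> T" if "x \<in> B" for x using subsetD[OF Z(1), of "(- \<gamma>, x)"] that by (auto simp: B_def)
  \<comment> \<open>By symmetry the slice over - \<gamma> has the same positive mass as the one over
    \<gamma>. If \<open>B\<close> were Lebesgue null, absolute continuity would leave this mass to
    the null set \<open>Z\<close>.\<close>
  have "emeasure lborel B > 0"
  proof (rule ccontr)
    assume "\<not> ?thesis"
    then have "emeasure lborel B = 0" by (simp add: zero_less_iff_neq_zero)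
    then have "{- \<gamma>} \<times> B \<in> null_sets haar"
      using B by (auto simp: null_sets_def haar_def lborel.emeasure_pair_measure_Times)
    with p(4) have "emeasure p ({- \<gamma>} \<times> B) = 0" by (auto simp: absolutely_continuous_def null_sets_def)
    moreover have "emeasure p ({- \<gamma>} \<times> UNIV) \<le> emeasure p (({- \<gamma>} \<times> B) \<union> Z)"
      using Z(3) sl[OF B] by (intro emeasure_mono) (auto simp: B_def)
    moreover have "\<dots> \<le> emeasure p ({- \<gamma>} \<times> B) + emeasure p Z"
      using Z(3) sl[OF B] by (intro emeasure_subadditive)
    ultimately have "emeasure p ({- \<gamma>} \<times> UNIV) = 0" using Z(2) by simp
    moreover have "emeasure p ({- \<gamma>} \<times> UNIV) = emeasure p ({\<gamma>} \<times> UNIV)"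
    proof -
      have "uminus \<in> p \<rightarrow>\<^sub>M p" using p(2) by (rule uminus_measurable_prod)
      then have "emeasure (distr p p uminus) ({\<gamma>} \<times> UNIV) = emeasure p (uminus -` ({\<gamma>} \<times> UNIV))"
        using sl[of UNIV \<gamma>] by (simp add: emeasure_distr)
      moreover have "uminus -` ({\<gamma>} \<times> UNIV) = {- \<gamma>} \<times> (UNIV :: real set)"
        by (auto simp: minus_equation_iff)
      ultimately show ?thesis using p(3) by (simp add: symmetric_measure_def)
    qed
    ultimately show False using \<gamma> by simp
  qed
  \<comment> \<open>\<open>T\<close> is closed under differences and contains \<open>t + B\<close>,
    hence all differences of points of \<open>B\<close> and so an interval around 0. The multiples
    of that interval exhaust the reals.\<close>
  from steinhaus[OF B this] obtain d where d: "d > 0" "\<And>r. \<bar>r\<bar> < d \<Longrightarrow> \<exists>x\<in>B. \<exists>y\<in>B. x - y = r" by blast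
  have small: "r \<in> T" if "\<bar>r\<bar> < d" for r
  proof -
    from d(2)[OF that] obtain x y where "x \<in> B" "y \<in> B" "x - y = r" by blast
    moreover have "(t + x) - (t + y) = x - y" by simp
    ultimately show ?thesis using T_diff[OF BT BT, of x y] by simp
  qed
  have mult: "real n * r \<in> T" if "\<bar>r\<bar> < d" for n r
  proof (induction n)
    case 0
    then show ?case using small[of 0] d(1) by simp
  next
    case (Suc n)
    from T_diff[OF this small[of "- r"]] that show ?case by (simp add: algebra_simps)
  qed
  obtain n where n: "\<bar>s\<bar> < real n * d" using reals_Archimedean3[OF d(1)] by blast
  then have "n > 0" using d(1) by (cases n) auto
  with n have "\<bar>s / real n\<bar> < d" by (simp add: field_simps)
  from mult[OF this, of n] \<open>n > 0\<close> have "s \<in> T" by simp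
  then show ?thesis by (simp add: T_def)
qed

subsection \<open>Fibres of elements of the hull\<close>

lemma translate_eq_vimage: "translate g Q = (\<lambda>q. q + g) -` Q"
  by (auto simp: mem_translate_iff)

definition fiber :: "('g \<times> real) set \<Rightarrow> 'g \<Rightarrow> real set" where
  "fiber Q \<gamma> = Pair \<gamma> -` Q"

lemma mem_fiber_iff: "t \<in> fiber Q \<gamma> \<longleftrightarrow> (\<gamma>, t) \<in> Q"
  by (simp add: fiber_def)

lemma fiber_translate: "fiber (translate g Q) \<gamma> = translate (snd g) (fiber Q (\<gamma> + fst g))"
  by (cases g) (auto simp: mem_fiber_iff mem_translate_iff)

lemma fiber_twist: "fiber (twist P \<phi>) \<gamma> = translate (\<phi> \<gamma>) P"
  by (auto simp: mem_fiber_iff mem_translate_iff twist_def add.commute)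

lemma closed_fiber: "closed Q \<Longrightarrow> closed (fiber (Q :: ('g::topological_space \<times> real) set) \<gamma>)"
  unfolding fiber_def by (intro closed_vimage continuous_intros)

lemma continuous_on_discrete_fun: "continuous_on X (f :: 'a::discrete_topology \<Rightarrow> 'b::topological_space)"
  unfolding continuous_on_open_invariant
proof (intro allI impI)
  fix B :: "'b set"
  show "\<exists>A. open A \<and> A \<inter> X = f -` B \<inter> X"
    by (intro exI[of _ "f -` B"]) (simp add: discrete_topology_class.open_discrete)
qed

lemma continuous_on_plus_prod:
  "continuous_on UNIV (\<lambda>q :: 'g::{group_add, discrete_topology} \<times> real. q + g)"
proof -
  have "continuous_on UNIV (\<lambda>q :: 'g \<times> real. fst q + fst g)"
    by (rule continuous_on_compose2[OF continuous_on_discrete_fun[of UNIV "\<lambda>x. x + fst g"] continuous_on_fst[OF continuous_on_id]]) simp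
  then have "continuous_on UNIV (\<lambda>q :: 'g \<times> real. (fst q + fst g, snd q + snd g))"
    by (intro continuous_intros)
  then show ?thesis by (simp add: plus_prod_def)
qed

lemma continuous_map_chabautyI:
  fixes f :: "'a set \<Rightarrow> 'b::topological_space set"
  assumes "\<And>x. x \<in> topspace X \<Longrightarrow> closed (f x)"
    and "\<And>K. compact K \<Longrightarrow> openin X {x \<in> topspace X. f x \<inter> K = {}}"
    and "\<And>U. open U \<Longrightarrow> openin X {x \<in> topspace X. f x \<inter> U \<noteq> {}}"
  shows "continuous_map X chabauty_fell f"
  unfolding chabauty_fell_def
proof (rule continuous_on_generated_topo)
  fix U assume "U \<in> {{Q :: 'b set. closed Q \<and> Q \<inter> K = {}} |K. compact K} \<union> {{Q. closed Q \<and> Q \<inter> U \<noteq> {}} |U. open U}"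
  then consider K where "compact K" "U = {Q. closed Q \<and> Q \<inter> K = {}}"
    | V where "open V" "U = {Q. closed Q \<and> Q \<inter> V \<noteq> {}}" by blast
  then show "openin X (f -` U \<inter> topspace X)"
  proof cases
    case 1
    then have "f -` U \<inter> topspace X = {x \<in> topspace X. f x \<inter> K = {}}" using assms(1) by blast
    then show ?thesis using assms(2)[OF 1(1)] by simp
  next
    case 2
    then have "f -` U \<inter> topspace X = {x \<in> topspace X. f x \<inter> V \<noteq> {}}" using assms(1) by blast
    then show ?thesis using assms(3)[OF 2(1)] by simp
  qed
next
  have "{Q :: 'b set. closed Q} \<in> {{Q. closed Q \<and> Q \<inter> K = {}} |K. compact K}"
    by (auto intro!: exI[of _ "{}"])
  moreover have "f ` topspace X \<subseteq> {Q. closed Q}" using assms(1) by (rule image_subsetI[OF CollectI])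
  ultimately show "f ` topspace X \<subseteq> \<Union> ({{Q. closed Q \<and> Q \<inter> K = {}} |K. compact K} \<union> {{Q. closed Q \<and> Q \<inter> U \<noteq> {}} |U. open U})"
    by (meson UnI1 Union_upper order_trans)
qed

lemma continuous_map_fiber:
  "continuous_map chabauty_fell chabauty_fell (\<lambda>Q :: ('g::discrete_topology \<times> real) set. fiber Q \<gamma>)"
proof (rule continuous_map_chabautyI)
  fix K :: "real set" assume "compact K"
  have "{Q \<in> topspace chabauty_fell. fiber Q \<gamma> \<inter> K = {}} = {Q. closed Q \<and> Q \<inter> ({\<gamma>} \<times> K) = {}}"
    by (auto simp: topspace_chabauty_fell mem_fiber_iff)
  with \<open>compact K\<close> show "openin chabauty_fell {Q \<in> topspace chabauty_fell. fiber Q \<gamma> \<inter> K = {}}"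
    by (simp add: openin_misses compact_Times)
next
  fix U :: "real set" assume "open U"
  have "{Q \<in> topspace chabauty_fell. fiber Q \<gamma> \<inter> U \<noteq> {}} = {Q. closed Q \<and> Q \<inter> ({\<gamma>} \<times> U) \<noteq> {}}"
    by (auto simp: topspace_chabauty_fell mem_fiber_iff)
  with \<open>open U\<close> show "openin chabauty_fell {Q \<in> topspace chabauty_fell. fiber Q \<gamma> \<inter> U \<noteq> {}}"
    by (simp add: openin_hits open_Times discrete_topology_class.open_discrete)
qed (simp add: topspace_chabauty_fell closed_fiber)

lemma continuous_map_translate:
  fixes g :: "'a::{group_add, topological_space}"
  assumes cont: "\<And>g :: 'a. continuous_on UNIV (\<lambda>q. q + g)"
  shows "continuous_map chabauty_fell chabauty_fell (translate g)"
proof (rule continuous_map_chabautyI)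
  fix K :: "'a set" assume "compact K"
  then have "compact ((\<lambda>q. q + g) ` K)"
    using cont by (intro compact_continuous_image continuous_on_subset[OF cont]) auto
  moreover have "{Q \<in> topspace chabauty_fell. translate g Q \<inter> K = {}} = {Q. closed Q \<and> Q \<inter> (\<lambda>q. q + g) ` K = {}}"
    by (auto simp: topspace_chabauty_fell mem_translate_iff)
  ultimately show "openin chabauty_fell {Q \<in> topspace chabauty_fell. translate g Q \<inter> K = {}}"
    by (simp add: openin_misses)
next
  fix U :: "'a set" assume "open U"
  then have "open ((\<lambda>q. q + - g) -` U)" using cont by (intro open_vimage)
  moreover have "{Q \<in> topspace chabauty_fell. translate g Q \<inter> U \<noteq> {}} = {Q. closed Q \<and> Q \<inter> (\<lambda>q. q + - g) -` U \<noteq> {}}"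
  proof -
    have "translate g Q \<inter> U \<noteq> {} \<longleftrightarrow> Q \<inter> (\<lambda>q. q + - g) -` U \<noteq> {}" for Q
      unfolding translate_def by (auto simp: image_iff)
    then show ?thesis by (simp add: topspace_chabauty_fell)
  qed
  ultimately show "openin chabauty_fell {Q \<in> topspace chabauty_fell. translate g Q \<inter> U \<noteq> {}}"
    by (simp add: openin_hits)
next
  fix Q :: "'a set" assume "Q \<in> topspace chabauty_fell"
  then show "closed (translate g Q)"
    unfolding translate_eq_vimage using cont by (intro closed_vimage) (auto simp: topspace_chabauty_fell)
qed

lemma closedin_hull: "closedin chabauty_fell (chabauty_hull Q)"
  by (simp add: chabauty_hull_def)

lemma closed_in_hull: "R \<in> chabauty_hull Q \<Longrightarrow> closed R"
  using closedin_subset[OF closedin_hull] by (auto simp: topspace_chabauty_fell)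

lemma self_in_hull: "closed Q \<Longrightarrow> (\<And>g. closed (translate g Q)) \<Longrightarrow> translate g Q \<in> chabauty_hull Q"
  unfolding chabauty_hull_def
  by (rule subsetD[OF closure_of_subset]) (auto simp: topspace_chabauty_fell)

lemma continuous_map_hull:
  assumes "continuous_map chabauty_fell chabauty_fell f"
    and "\<And>g. \<exists>h. f (translate g Q) = translate h P" and "R \<in> chabauty_hull Q"
  shows "f R \<in> chabauty_hull P"
proof -
  have "f ` (chabauty_fell closure_of range (\<lambda>g. translate g Q)) \<subseteq> chabauty_fell closure_of f ` range (\<lambda>g. translate g Q)"
    by (rule continuous_map_image_closure_subset[OF assms(1)])
  also have "\<dots> \<subseteq> chabauty_fell closure_of range (\<lambda>g. translate g P)"
    using assms(2) by (intro closure_of_mono) (auto simp: image_iff)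
  finally show ?thesis using assms(3) by (auto simp: chabauty_hull_def)
qed

lemma continuous_map_translate_real: "continuous_map chabauty_fell chabauty_fell (translate (s :: real))"
  by (intro continuous_map_translate continuous_intros)

lemma continuous_map_translate_prod:
  "continuous_map chabauty_fell chabauty_fell (translate (g :: 'g::{group_add, discrete_topology} \<times> real))"
  by (intro continuous_map_translate continuous_on_plus_prod)

lemma translate_in_hull_real: "R \<in> chabauty_hull P \<Longrightarrow> translate (s :: real) R \<in> chabauty_hull P"
  by (rule continuous_map_hull[OF continuous_map_translate_real]) (auto simp: translate_translate)

lemma translate_in_hull_prod:
  "R \<in> chabauty_hull Q \<Longrightarrow> translate (g :: 'g::{group_add, discrete_topology} \<times> real) R \<in> chabauty_hull Q"
  by (rule continuous_map_hull[OF continuous_map_translate_prod]) (unfold translate_translate, blast)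

lemma closed_translate_real: "closed R \<Longrightarrow> closed (translate (s :: real) R)"
  unfolding translate_eq_vimage by (intro closed_vimage continuous_intros)

lemma closed_translate_prod:
  "closed Q \<Longrightarrow> closed (translate (g :: 'g::{group_add, discrete_topology} \<times> real) Q)"
  unfolding translate_eq_vimage by (intro closed_vimage continuous_on_plus_prod)

lemma closed_twist:
  assumes "closed P"
  shows "closed (twist P (\<phi> :: 'g::discrete_topology \<Rightarrow> real))"
proof -
  have "continuous_on UNIV (\<lambda>q :: 'g \<times> real. \<phi> (fst q))"
    by (rule continuous_on_compose2[OF continuous_on_discrete_fun[of UNIV \<phi>] continuous_on_fst[OF continuous_on_id]]) simp
  then have "closed ((\<lambda>q. \<phi> (fst q) + snd q) -` P)"
    using assms by (intro closed_vimage continuous_intros)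
  also have "(\<lambda>q. \<phi> (fst q) + snd q) -` P = twist P \<phi>" by (auto simp: twist_def)
  finally show ?thesis .
qed

text \<open>Compactness of the parameter interval is what makes this work. If no shift fits
  \<open>Q\<close>, then each \<open>s\<close> is refuted by one point, and the refutation persists
  for all sets near \<open>Q\<close> and all shifts near \<open>s\<close>; finitely many of these
  ranges of shifts cover the interval.\<close>

lemma closedin_fiber_shift:
  "closedin chabauty_fell {Q :: ('g::discrete_topology \<times> real) set.
    closed Q \<and> (\<exists>s\<in>{a..b}. fiber Q \<gamma> = translate s (fiber Q h))}" (is "closedin _ ?S")
  unfolding closedin_def
proof
  show "?S \<subseteq> topspace chabauty_fell" by (auto simp: topspace_chabauty_fell)
  have "\<exists>T. openin chabauty_fell T \<and> Q \<in> T \<and> T \<subseteq> topspace chabauty_fell - ?S"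
    if Q: "Q \<in> topspace chabauty_fell - ?S" for Q
  proof -
    have cl: "closed Q" and ne: "\<And>s. s \<in> {a..b} \<Longrightarrow> fiber Q \<gamma> \<noteq> translate s (fiber Q h)"
      using Q by (auto simp: topspace_chabauty_fell)
    have box: "open ({x} \<times> ball t e)" "compact ({x} \<times> cball t e)" for x :: 'g and t e :: real
      by (auto simp: open_Times discrete_topology_class.open_discrete compact_Times)
    have "\<exists>N e. openin chabauty_fell N \<and> Q \<in> N \<and> e > 0 \<and>
        (\<forall>Q'\<in>N. \<forall>s'. \<bar>s' - s\<bar> < e \<longrightarrow> fiber Q' \<gamma> \<noteq> translate s' (fiber Q' h))" if s: "s \<in> {a..b}" for s
    proof -
      have sep: "\<exists>e>0. cball r (2 * e) \<inter> fiber Q x = {}" if "r \<notin> fiber Q x" for r x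
      proof -
        have "open (- fiber Q x)" "r \<in> - fiber Q x" using cl that by (auto simp: closed_fiber open_Compl)
        then obtain e where "e > 0" "cball r e \<subseteq> - fiber Q x" using open_contains_cball by blast
        then show ?thesis by (intro exI[of _ "e / 2"]) auto
      qed
      obtain t where "(t \<in> fiber Q \<gamma>) \<noteq> (t + s \<in> fiber Q h)"
        using ne[OF s] unfolding set_eq_iff mem_translate_iff by blast
      then consider "t \<in> fiber Q \<gamma>" "t + s \<notin> fiber Q h" | "t \<notin> fiber Q \<gamma>" "t + s \<in> fiber Q h" by blast
      then show ?thesis
      proof cases
        case 1
        \<comment> \<open>The radius 2 e allows an error of e for the point near \<open>t\<close>
          and another e for the passage from \<open>s\<close> to \<open>s'\<close>.\<close>
        obtain e where e: "e > 0" "cball (t + s) (2 * e) \<inter> fiber Q h = {}" using sep[OF 1(2)] by blast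
        let ?N = "{Q. closed Q \<and> Q \<inter> ({\<gamma>} \<times> ball t e) \<noteq> {}} \<inter> {Q. closed Q \<and> Q \<inter> ({h} \<times> cball (t + s) (2 * e)) = {}}"
        have "openin chabauty_fell ?N" by (intro openin_Int openin_hits openin_misses box)
        moreover have "Q \<in> ?N" using cl e 1(1) by (force simp: mem_fiber_iff)
        moreover have "\<forall>Q'\<in>?N. \<forall>s'. \<bar>s' - s\<bar> < e \<longrightarrow> fiber Q' \<gamma> \<noteq> translate s' (fiber Q' h)"
        proof (intro ballI allI impI notI)
          fix Q' s' assume N: "Q' \<in> ?N" and s': "\<bar>s' - s\<bar> < e" and eq: "fiber Q' \<gamma> = translate s' (fiber Q' h)"
          obtain r where r: "r \<in> fiber Q' \<gamma>" "dist t r < e" using N by (auto simp: mem_fiber_iff)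
          then have "r + s' \<in> fiber Q' h" using eq by (simp add: mem_translate_iff)
          moreover have "r + s' \<in> cball (t + s) (2 * e)" using r(2) s' by (simp add: dist_real_def)
          ultimately show False using N by (auto simp: mem_fiber_iff)
        qed
        ultimately show ?thesis using e(1) by (intro exI[of _ ?N] exI[of _ e] conjI)
      next
        case 2
        obtain e where e: "e > 0" "cball t (2 * e) \<inter> fiber Q \<gamma> = {}" using sep[OF 2(1)] by blast
        let ?N = "{Q. closed Q \<and> Q \<inter> ({h} \<times> ball (t + s) e) \<noteq> {}} \<inter> {Q. closed Q \<and> Q \<inter> ({\<gamma>} \<times> cball t (2 * e)) = {}}"
        have "openin chabauty_fell ?N" by (intro openin_Int openin_hits openin_misses box)
        moreover have "Q \<in> ?N" using cl e 2(2) by (force simp: mem_fiber_iff)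
        moreover have "\<forall>Q'\<in>?N. \<forall>s'. \<bar>s' - s\<bar> < e \<longrightarrow> fiber Q' \<gamma> \<noteq> translate s' (fiber Q' h)"
        proof (intro ballI allI impI notI)
          fix Q' s' assume N: "Q' \<in> ?N" and s': "\<bar>s' - s\<bar> < e" and eq: "fiber Q' \<gamma> = translate s' (fiber Q' h)"
          obtain r where r: "r \<in> fiber Q' h" "dist (t + s) r < e" using N by (auto simp: mem_fiber_iff)
          then have "r - s' \<in> fiber Q' \<gamma>" using eq by (simp add: mem_translate_iff)
          moreover have "r - s' \<in> cball t (2 * e)" using r(2) s' by (simp add: dist_real_def)
          ultimately show False using N by (auto simp: mem_fiber_iff)
        qed
        ultimately show ?thesis using e(1) by (intro exI[of _ ?N] exI[of _ e] conjI)
      qed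
    qed
    then have "\<forall>s\<in>{a..b}. \<exists>Ne. openin chabauty_fell (fst Ne) \<and> Q \<in> fst Ne \<and> snd Ne > 0 \<and>
        (\<forall>Q'\<in>fst Ne. \<forall>s'. \<bar>s' - s\<bar> < snd Ne \<longrightarrow> fiber Q' \<gamma> \<noteq> translate s' (fiber Q' h))"
      by (metis fst_conv snd_conv)
    from bchoice[OF this] obtain Ne where Ne: "\<forall>s\<in>{a..b}. openin chabauty_fell (fst (Ne s)) \<and> Q \<in> fst (Ne s) \<and> snd (Ne s) > 0 \<and>
        (\<forall>Q'\<in>fst (Ne s). \<forall>s'. \<bar>s' - s\<bar> < snd (Ne s) \<longrightarrow> fiber Q' \<gamma> \<noteq> translate s' (fiber Q' h))" by blast
    obtain C where C: "C \<subseteq> {a..b}" "finite C" "{a..b} \<subseteq> (\<Union>s\<in>C. ball s (snd (Ne s)))"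
    proof (rule compactE_image[of "{a..b}" "{a..b}" "\<lambda>s. ball s (snd (Ne s))"])
      show "{a..b} \<subseteq> (\<Union>s\<in>{a..b}. ball s (snd (Ne s)))" using Ne by force
    qed auto
    let ?T = "topspace chabauty_fell \<inter> (\<Inter>s\<in>C. fst (Ne s))"
    have "openin chabauty_fell ?T"
    proof (cases "C = {}")
      case False
      then show ?thesis using C Ne by (intro openin_Int openin_topspace openin_Inter) auto
    qed simp
    moreover have "Q \<in> ?T" using Q C(1) Ne by blast
    moreover have "?T \<subseteq> topspace chabauty_fell - ?S"
    proof
      fix Q' assume Q': "Q' \<in> ?T"
      have "fiber Q' \<gamma> \<noteq> translate s (fiber Q' h)" if "s \<in> {a..b}" for s
      proof -
        obtain s0 where s0: "s0 \<in> C" "s \<in> ball s0 (snd (Ne s0))" using C(3) \<open>s \<in> {a..b}\<close> by blast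
        then have "\<bar>s - s0\<bar> < snd (Ne s0)" by (simp add: dist_real_def abs_minus_commute)
        moreover have "Q' \<in> fst (Ne s0)" "s0 \<in> {a..b}" using s0 Q' C(1) by auto
        ultimately show ?thesis using Ne by blast
      qed
      then show "Q' \<in> topspace chabauty_fell - ?S" using Q' by auto
    qed
    ultimately show ?thesis by blast
  qed
  then show "openin chabauty_fell (topspace chabauty_fell - ?S)" by (subst openin_subopen) blast
qed

lemma topological_basis_prod_real:
  fixes R :: "real set set"
  assumes "topological_basis R" "countable R"
  shows "topological_basis ((\<lambda>(\<gamma> :: 'g::{countable, discrete_topology}, V). {\<gamma>} \<times> V) ` (UNIV \<times> R))"
    and "countable ((\<lambda>(\<gamma> :: 'g, V). {\<gamma>} \<times> V) ` (UNIV \<times> R))"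
proof -
  have "topological_basis (range (\<lambda>x :: 'g. {x}))"
    unfolding topological_basis_def
  proof (intro conjI ballI allI impI)
    fix X :: "'g set"
    show "\<exists>B'\<subseteq>range (\<lambda>x. {x}). \<Union> B' = X" by (intro exI[of _ "(\<lambda>x. {x}) ` X"]) auto
  qed (auto simp: discrete_topology_class.open_discrete)
  from topological_basis_prod[OF this assms(1)]
  have "topological_basis ((\<lambda>(a, b). a \<times> b) ` (range (\<lambda>x :: 'g. {x}) \<times> R))" .
  moreover have "(\<lambda>(a, b). a \<times> b) ` (range (\<lambda>x :: 'g. {x}) \<times> R) = (\<lambda>(\<gamma>, V). {\<gamma>} \<times> V) ` (UNIV \<times> R)"
    by force
  ultimately show "topological_basis ((\<lambda>(\<gamma> :: 'g, V). {\<gamma>} \<times> V) ` (UNIV \<times> R))" by simp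
  show "countable ((\<lambda>(\<gamma> :: 'g, V). {\<gamma>} \<times> V) ` (UNIV \<times> R))"
    using assms(2) by (intro countable_image countable_SIGMA) auto
qed

lemma ex_countable_basis_prod_real:
  "\<exists>B :: ('g::{countable, discrete_topology} \<times> real) set set. topological_basis B \<and> countable B"
proof -
  obtain R :: "real set set" where "countable R" "topological_basis R" using ex_countable_basis by blast
  from topological_basis_prod_real[OF this(2,1)] show ?thesis by blast
qed

lemma measurable_prod_real_chabautyI:
  fixes f :: "'a \<Rightarrow> ('g::{countable, discrete_topology} \<times> real) set"
  assumes "\<And>x. x \<in> space M \<Longrightarrow> closed (f x)"
    and "\<And>\<gamma> V. open V \<Longrightarrow> {x \<in> space M. fiber (f x) \<gamma> \<inter> V \<noteq> {}} \<in> sets M"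
  shows "f \<in> M \<rightarrow>\<^sub>M borel_of chabauty_fell"
proof -
  obtain R :: "real set set" where R: "countable R" "topological_basis R" using ex_countable_basis by blast
  show ?thesis
  proof (rule measurable_chabautyI[OF topological_basis_prod_real[OF R(2,1)] assms(1)])
    fix U assume "U \<in> (\<lambda>(\<gamma> :: 'g, V). {\<gamma>} \<times> V) ` (UNIV \<times> R)"
    then obtain \<gamma> V where "U = {\<gamma>} \<times> V" "V \<in> R" by auto
    moreover from this have "{x \<in> space M. f x \<inter> U \<noteq> {}} = {x \<in> space M. fiber (f x) \<gamma> \<inter> V \<noteq> {}}"
      by (auto simp: mem_fiber_iff)
    ultimately show "{x \<in> space M. f x \<inter> U \<noteq> {}} \<in> sets M"
      using assms(2) topological_basis_open[OF R(2)] by simp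
  qed
qed

text \<open>Countably many boxes suffice because subtraction of reals is continuous.\<close>

lemma sets_translate_hits:
  fixes f :: "'a \<Rightarrow> real set" and c :: "'a \<Rightarrow> real"
  assumes c: "c \<in> borel_measurable M"
    and f: "\<And>W. open W \<Longrightarrow> {x \<in> space M. f x \<inter> W \<noteq> {}} \<in> sets M" and V: "open V"
  shows "{x \<in> space M. translate (c x) (f x) \<inter> V \<noteq> {}} \<in> sets M"
proof -
  obtain R :: "real set set" where R: "countable R" "topological_basis R" using ex_countable_basis by blast
  let ?I = "{(A, W) \<in> R \<times> R. \<forall>s\<in>A. \<forall>t\<in>W. t - s \<in> V}"
  have "countable ?I" using R(1) by (intro countable_subset[OF _ countable_SIGMA[of R "\<lambda>_. R"]]) auto
  have "{x \<in> space M. translate (c x) (f x) \<inter> V \<noteq> {}}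
      = (\<Union>(A, W)\<in>?I. (c -` A \<inter> space M) \<inter> {x \<in> space M. f x \<inter> W \<noteq> {}})" (is "?L = ?R")
  proof (intro equalityI subsetI)
    fix x assume "x \<in> ?L"
    then obtain t where t: "t + c x \<in> f x" "t \<in> V" and x: "x \<in> space M" by (auto simp: mem_translate_iff)
    have "open ((\<lambda>z. snd z - fst z) -` V)" using V by (intro open_vimage continuous_intros)
    moreover have "(c x, t + c x) \<in> (\<lambda>z. snd z - fst z) -` V" using t by simp
    ultimately obtain A' W' where AW: "open A'" "open W'" "c x \<in> A'" "t + c x \<in> W'" "A' \<times> W' \<subseteq> (\<lambda>z. snd z - fst z) -` V"
      by (elim open_prod_elim[of _ "(c x, t + c x)"]) auto
    obtain A where A: "A \<in> R" "c x \<in> A" "A \<subseteq> A'" using topological_basisE[OF R(2) AW(1,3)] by blast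
    obtain W where W: "W \<in> R" "t + c x \<in> W" "W \<subseteq> W'" using topological_basisE[OF R(2) AW(2,4)] by blast
    have "(A, W) \<in> ?I" using A W AW(5) by (auto simp: subset_iff)
    then show "x \<in> ?R" using A W t x by (intro UN_I[of "(A, W)"]) auto
  next
    fix x assume "x \<in> ?R"
    then obtain A W t where "(A, W) \<in> ?I" "c x \<in> A" "x \<in> space M" "t \<in> f x" "t \<in> W" by auto
    then have "t - c x \<in> translate (c x) (f x) \<inter> V" by (auto simp: mem_translate_iff)
    with \<open>x \<in> space M\<close> show "x \<in> ?L" by auto
  qed
  also have "\<dots> \<in> sets M"
  proof (rule sets.countable_UN''[OF \<open>countable ?I\<close>])
    fix i assume "i \<in> ?I"
    then show "(case i of (A, W) \<Rightarrow> (c -` A \<inter> space M) \<inter> {x \<in> space M. f x \<inter> W \<noteq> {}}) \<in> sets M"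
      using c f topological_basis_open[OF R(2)] by (auto intro!: sets.Int measurable_sets[OF c])
  qed
  finally show ?thesis .
qed

text \<open>For each of the countably many values of the first coordinate of the group element, the
  fibre of the translate is one fixed fibre of \<open>Q\<close> moved by a measurable real number,
  so \<open>sets_translate_hits\<close> applies piecewise.\<close>

lemma measurable_translate:
  fixes p :: "('g::{group_add, countable, discrete_topology} \<times> real) measure"
  assumes p: "sets p = sets borel" and N: "sets N = sets (restrict_space (borel_of chabauty_fell) X)"
    and X: "X \<subseteq> {Q. closed Q}" "\<And>g Q. Q \<in> X \<Longrightarrow> translate g Q \<in> X"
  shows "(\<lambda>(g, Q). translate g Q) \<in> p \<Otimes>\<^sub>M N \<rightarrow>\<^sub>M N"
proof -
  have sN: "space N = X" using sets_eq_imp_space_eq[OF N] X(1) by (auto simp: space_restrict_space)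
  have hitN: "{Q \<in> X. fiber Q \<gamma> \<inter> V \<noteq> {}} \<in> sets N" if "open V" for \<gamma> :: 'g and V
  proof -
    have "open ({\<gamma>} \<times> V)" using that by (simp add: open_Times discrete_topology_class.open_discrete)
    then have "{Q. closed Q \<and> Q \<inter> ({\<gamma>} \<times> V) \<noteq> {}} \<in> sets (borel_of chabauty_fell)"
      by (intro borel_of_open openin_hits)
    moreover have "{Q \<in> X. fiber Q \<gamma> \<inter> V \<noteq> {}} = X \<inter> {Q. closed Q \<and> Q \<inter> ({\<gamma>} \<times> V) \<noteq> {}}"
      using X(1) by (auto simp: mem_fiber_iff)
    ultimately show ?thesis unfolding N sets_restrict_space by blast
  qed
  have f: "fst \<in> p \<Otimes>\<^sub>M N \<rightarrow>\<^sub>M p" "snd \<in> p \<Otimes>\<^sub>M N \<rightarrow>\<^sub>M N" by simp_all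
  have "(\<lambda>z. translate (fst z) (snd z)) \<in> p \<Otimes>\<^sub>M N \<rightarrow>\<^sub>M borel_of chabauty_fell"
  proof (rule measurable_prod_real_chabautyI)
    fix z assume "z \<in> space (p \<Otimes>\<^sub>M N)"
    then have "translate (fst z) (snd z) \<in> X" by (auto simp: space_pair_measure sN intro: X(2))
    with X(1) show "closed (translate (fst z) (snd z))" by auto
  next
    fix \<gamma> :: 'g and V :: "real set" assume "open V"
    let ?H = "\<lambda>a. {z \<in> space (p \<Otimes>\<^sub>M N). translate (snd (fst z)) (fiber (snd z) (\<gamma> + a)) \<inter> V \<noteq> {}}"
    have "?H a \<in> sets (p \<Otimes>\<^sub>M N)" for a
    proof (rule sets_translate_hits[OF _ _ \<open>open V\<close>])
      show "(\<lambda>z. snd (fst z)) \<in> borel_measurable (p \<Otimes>\<^sub>M N)"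
        using measurable_compose[OF f(1) snd_measurable_prod[OF p]] .
      fix W :: "real set" assume "open W"
      from measurable_sets[OF f(2) hitN[OF this, of "\<gamma> + a"]]
      show "{z \<in> space (p \<Otimes>\<^sub>M N). fiber (snd z) (\<gamma> + a) \<inter> W \<noteq> {}} \<in> sets (p \<Otimes>\<^sub>M N)"
        by (rule back_subst[of "\<lambda>A. A \<in> _"]) (auto simp: space_pair_measure sN)
    qed
    moreover have "{z \<in> space (p \<Otimes>\<^sub>M N). fst (fst z) = a} \<in> sets (p \<Otimes>\<^sub>M N)" for a
      using measurable_sets[OF measurable_compose[OF f(1) fst_measurable_prod[OF p]], of "{a}"]
      by (auto simp: vimage_def Int_def conj_commute)
    ultimately have "(\<Union>a. {z \<in> space (p \<Otimes>\<^sub>M N). fst (fst z) = a} \<inter> ?H a) \<in> sets (p \<Otimes>\<^sub>M N)"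
      by (intro sets.countable_UN' sets.Int) auto
    also have "(\<Union>a. {z \<in> space (p \<Otimes>\<^sub>M N). fst (fst z) = a} \<inter> ?H a)
        = {z \<in> space (p \<Otimes>\<^sub>M N). fiber (translate (fst z) (snd z)) \<gamma> \<inter> V \<noteq> {}}"
      unfolding fiber_translate by auto
    finally show "{z \<in> space (p \<Otimes>\<^sub>M N). fiber (translate (fst z) (snd z)) \<gamma> \<inter> V \<noteq> {}} \<in> sets (p \<Otimes>\<^sub>M N)" .
  qed
  then have "(\<lambda>z. translate (fst z) (snd z)) \<in> p \<Otimes>\<^sub>M N \<rightarrow>\<^sub>M restrict_space (borel_of chabauty_fell) X"
    by (intro measurable_restrict_space2) (auto simp: space_pair_measure sN X(2))
  then show ?thesis by (simp add: case_prod_unfold N cong: measurable_cong_sets)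
qed

text \<open>Asking for the shift bound between any two fibres, not only from the fibre over 0, makes this set
  invariant under translation.\<close>

definition quasi_twists :: "real set \<Rightarrow> ('g::{group_add, topological_space} \<Rightarrow> real) \<Rightarrow> real \<Rightarrow> ('g \<times> real) set set" where
  "quasi_twists P \<psi> D = {Q. closed Q \<and> (\<forall>h. fiber Q h \<in> chabauty_hull P) \<and>
     (\<forall>\<gamma> h. \<exists>s\<in>{\<psi> \<gamma> - D..\<psi> \<gamma> + D}. fiber Q (\<gamma> + h) = translate s (fiber Q h))}"

text \<open>The function eta of the overview. The description singles out a number for members of
  \<open>quasi_twists\<close>, provided that the reals act freely on the hull of
  \<open>P\<close>.\<close>

definition fiber_shift :: "('g::zero \<times> real) set \<Rightarrow> 'g \<Rightarrow> real" where
  "fiber_shift Q \<gamma> = (THE s. fiber Q \<gamma> = translate s (fiber Q 0))"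

lemma closedin_quasi_twists:
  "closedin chabauty_fell (quasi_twists P (\<psi> :: 'g::{group_add, discrete_topology} \<Rightarrow> real) D)"
proof -
  have "closedin chabauty_fell {Q :: ('g \<times> real) set. closed Q \<and> fiber Q h \<in> chabauty_hull P}" for h
    using closedin_continuous_map_preimage[OF continuous_map_fiber closedin_hull, of h P]
    by (simp add: topspace_chabauty_fell)
  moreover have "quasi_twists P \<psi> D = (\<Inter>h. {Q. closed Q \<and> fiber Q h \<in> chabauty_hull P}) \<inter>
      (\<Inter>(\<gamma>, h). {Q. closed Q \<and> (\<exists>s\<in>{\<psi> \<gamma> - D..\<psi> \<gamma> + D}. fiber Q (\<gamma> + h) = translate s (fiber Q h))})"
    by (auto simp: quasi_twists_def)
  ultimately show ?thesis
    by (auto intro!: closedin_Int closedin_INT closedin_fiber_shift)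
qed

lemma quasi_twists_closed: "quasi_twists P \<psi> D \<subseteq> {Q. closed Q}"
  by (auto simp: quasi_twists_def)

lemma translate_in_quasi_twists:
  fixes \<psi> :: "'g::{group_add, discrete_topology} \<Rightarrow> real"
  assumes "Q \<in> quasi_twists P \<psi> D"
  shows "translate g Q \<in> quasi_twists P \<psi> D"
proof -
  have "\<exists>s\<in>{\<psi> \<gamma> - D..\<psi> \<gamma> + D}. fiber (translate g Q) (\<gamma> + h) = translate s (fiber (translate g Q) h)" for \<gamma> h
  proof -
    obtain s where s: "s \<in> {\<psi> \<gamma> - D..\<psi> \<gamma> + D}" "fiber Q (\<gamma> + (h + fst g)) = translate s (fiber Q (h + fst g))"
      using assms unfolding quasi_twists_def by blast
    have "fiber (translate g Q) (\<gamma> + h) = translate s (fiber (translate g Q) h)"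
      by (simp add: fiber_translate add.assoc s(2) translate_translate add.commute[of "snd g"])
    with s(1) show ?thesis by blast
  qed
  with assms show ?thesis
    by (simp add: quasi_twists_def closed_translate_prod fiber_translate translate_in_hull_real del: Bex_def)
qed

text \<open>In the twist itself the fibre over \<gamma> + h is the fibre over h shifted by \<theta>
  (\<gamma> + h) - \<theta> h, and \<open>quasi_twists\<close> is closed and invariant, so it
  contains the hull. With a separate \<theta> the lemma serves for \<phi> and for \<psi>, which
  places both hulls in one common space.\<close>

lemma hull_twist_subset_quasi_twists:
  fixes \<psi> \<theta> :: "'g::{group_add, discrete_topology} \<Rightarrow> real"
  assumes "closed P" and D: "\<And>\<gamma> h. \<bar>\<theta> (\<gamma> + h) - \<theta> h - \<psi> \<gamma>\<bar> \<le> D"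
  shows "chabauty_hull (twist P \<theta>) \<subseteq> quasi_twists P \<psi> D"
  unfolding chabauty_hull_def
proof (rule closure_of_minimal[OF _ closedin_quasi_twists], safe)
  fix g :: "'g \<times> real"
  have "twist P \<theta> \<in> quasi_twists P \<psi> D"
    unfolding quasi_twists_def
  proof (intro CollectI conjI allI)
    show "closed (twist P \<theta>)" using assms(1) by (rule closed_twist)
    fix h
    show "fiber (twist P \<theta>) h \<in> chabauty_hull P"
      unfolding fiber_twist using assms(1) by (intro self_in_hull closed_translate_real)
    fix \<gamma>
    show "\<exists>s\<in>{\<psi> \<gamma> - D..\<psi> \<gamma> + D}. fiber (twist P \<theta>) (\<gamma> + h) = translate s (fiber (twist P \<theta>) h)"
      by (rule bexI[of _ "\<theta> (\<gamma> + h) - \<theta> h"]) (use D[of \<gamma> h] in \<open>auto simp: fiber_twist translate_translate abs_le_iff\<close>)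
  qed
  then show "translate g (twist P \<theta>) \<in> quasi_twists P \<psi> D" by (rule translate_in_quasi_twists)
qed

section \<open>The shift cocycle of a set with translated fibres\<close>

context
  fixes P :: "real set" and \<psi> :: "'g::{group_add, countable, discrete_topology} \<Rightarrow> real" and D :: real
  assumes free: "free_on (chabauty_hull P)"
begin

lemma shift_eqI:
  assumes "fiber Q 0 \<in> chabauty_hull P" "fiber Q \<gamma> = translate s (fiber Q 0)"
  shows "fiber_shift Q \<gamma> = s"
  unfolding fiber_shift_def
proof (rule the_equality)
  fix s' assume "fiber Q \<gamma> = translate s' (fiber Q 0)"
  with assms(2) have "translate (- s) (translate s' (fiber Q 0)) = translate (- s) (translate s (fiber Q 0))" by simp
  then have "translate (- s + s') (fiber Q 0) = fiber Q 0" by (simp add: translate_translate translate_0)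
  with free assms(1) have "- s + s' = 0" unfolding free_on_def by blast
  then show "s' = s" by simp
qed (rule assms(2))

lemma
  assumes "Q \<in> quasi_twists P \<psi> D"
  shows fiber_eq_translate_shift: "fiber Q \<gamma> = translate (fiber_shift Q \<gamma>) (fiber Q 0)"
    and shift_bound: "\<bar>fiber_shift Q \<gamma> - \<psi> \<gamma>\<bar> \<le> D"
    and shift_0: "fiber_shift Q 0 = 0"
proof -
  have 0: "fiber Q 0 \<in> chabauty_hull P" using assms by (simp add: quasi_twists_def)
  obtain s where s: "s \<in> {\<psi> \<gamma> - D..\<psi> \<gamma> + D}" "fiber Q (\<gamma> + 0) = translate s (fiber Q 0)"
    using assms unfolding quasi_twists_def by blast
  then have "fiber_shift Q \<gamma> = s" by (intro shift_eqI[OF 0]) simp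
  with s show "fiber Q \<gamma> = translate (fiber_shift Q \<gamma>) (fiber Q 0)" "\<bar>fiber_shift Q \<gamma> - \<psi> \<gamma>\<bar> \<le> D"
    by (auto simp: abs_le_iff)
  show "fiber_shift Q 0 = 0" by (rule shift_eqI[OF 0]) (simp add: translate_0)
qed

text \<open>The real component of \<open>g\<close> moves all fibres by the same amount and cancels.
  Therefore the cocycle depends on \<open>g\<close> only through \<open>fst g\<close> and is
  constant under the reals.\<close>

lemma shift_translate:
  assumes Q: "Q \<in> quasi_twists P \<psi> D"
  shows "fiber_shift (translate g Q) \<gamma> = fiber_shift Q (\<gamma> + fst g) - fiber_shift Q (fst g)"
proof (rule shift_eqI)
  show "fiber (translate g Q) 0 \<in> chabauty_hull P"
    using translate_in_quasi_twists[OF Q, of g] by (simp add: quasi_twists_def)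
  have "fiber (translate g Q) \<gamma> = translate (snd g + fiber_shift Q (\<gamma> + fst g)) (fiber Q 0)"
    unfolding fiber_translate by (subst fiber_eq_translate_shift[OF Q]) (simp add: translate_translate)
  moreover have "fiber (translate g Q) 0 = translate (snd g + fiber_shift Q (fst g)) (fiber Q 0)"
    unfolding fiber_translate by (subst fiber_eq_translate_shift[OF Q]) (simp add: translate_translate)
  ultimately show "fiber (translate g Q) \<gamma> = translate (fiber_shift Q (\<gamma> + fst g) - fiber_shift Q (fst g)) (fiber (translate g Q) 0)"
    by (simp add: translate_translate algebra_simps)
qed

lemma closedin_shift_between:
  "closedin chabauty_fell {Q \<in> quasi_twists P \<psi> D. fiber_shift Q \<gamma> \<in> {a..b}}"
proof -
  have "{Q \<in> quasi_twists P \<psi> D. fiber_shift Q \<gamma> \<in> {a..b}}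
      = quasi_twists P \<psi> D \<inter> {Q. closed Q \<and> (\<exists>s\<in>{a..b}. fiber Q \<gamma> = translate s (fiber Q 0))}" (is "?L = ?R")
  proof (intro equalityI subsetI)
    fix Q assume "Q \<in> ?L"
    then show "Q \<in> ?R"
      using fiber_eq_translate_shift[of Q \<gamma>] by (auto simp: quasi_twists_closed[THEN subsetD, simplified])
  next
    fix Q assume "Q \<in> ?R"
    then obtain s where "Q \<in> quasi_twists P \<psi> D" "s \<in> {a..b}" "fiber Q \<gamma> = translate s (fiber Q 0)" by auto
    moreover from this have "fiber_shift Q \<gamma> = s" by (intro shift_eqI) (auto simp: quasi_twists_def)
    ultimately show "Q \<in> ?L" by simp
  qed
  then show ?thesis by (auto intro!: closedin_Int closedin_quasi_twists closedin_fiber_shift)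
qed

lemma measurable_shift:
  "(\<lambda>Q. fiber_shift Q \<gamma>) \<in> borel_measurable (restrict_space (borel_of chabauty_fell) (quasi_twists P \<psi> D))"
  unfolding borel_measurable_iff_le
proof
  fix a
  let ?M = "restrict_space (borel_of chabauty_fell) (quasi_twists P \<psi> D)"
  have sp: "space ?M = quasi_twists P \<psi> D"
    using quasi_twists_closed by (auto simp: space_restrict_space)
  \<comment> \<open>The a priori bound on the shift replaces the half-line by a compact interval, as
    \<open>closedin_shift_between\<close> requires.\<close>
  have "{Q \<in> space ?M. fiber_shift Q \<gamma> \<le> a} = {Q \<in> quasi_twists P \<psi> D. fiber_shift Q \<gamma> \<in> {\<psi> \<gamma> - D..a}}"
    unfolding sp using shift_bound[of _ \<gamma>] by (fastforce simp: abs_le_iff)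
  then show "{Q \<in> space ?M. fiber_shift Q \<gamma> \<le> a} \<in> sets ?M"
    unfolding sets_restrict_space
    by (intro image_eqI[of _ _ "{Q \<in> quasi_twists P \<psi> D. fiber_shift Q \<gamma> \<in> {\<psi> \<gamma> - D..a}}"])
      (auto intro: borel_of_closed closedin_shift_between simp del: atLeastAtMost_iff)
qed

text \<open>Being at distance at least \<open>e\<close> from the shift of \<open>Q\<close> at some
  index in \<open>J\<close> is a finite union of closed conditions, since shifts range over compact
  intervals. Its complement is a neighbourhood of \<open>Q\<close> and meets the orbit. This carries
  identities from the orbit to the hull.\<close>

lemma hull_approx_shift:
  assumes X: "chabauty_hull X \<subseteq> quasi_twists P \<psi> D" and "\<And>g. closed (translate g X)"
    and Q: "Q \<in> chabauty_hull X" and J: "finite J" and e: "e > 0"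
  shows "\<exists>g. \<forall>\<gamma>\<in>J. \<bar>fiber_shift (translate g X) \<gamma> - fiber_shift Q \<gamma>\<bar> < e"
proof -
  let ?C = "\<lambda>\<gamma>. {Q' \<in> quasi_twists P \<psi> D. fiber_shift Q' \<gamma> \<in> {\<psi> \<gamma> - D..fiber_shift Q \<gamma> - e}} \<union>
      {Q' \<in> quasi_twists P \<psi> D. fiber_shift Q' \<gamma> \<in> {fiber_shift Q \<gamma> + e..\<psi> \<gamma> + D}}"
  let ?T = "topspace chabauty_fell - (\<Union>\<gamma>\<in>J. ?C \<gamma>)"
  have "closedin chabauty_fell (\<Union>\<gamma>\<in>J. ?C \<gamma>)"
    using J by (intro closedin_Union) (auto intro!: closedin_Un closedin_shift_between simp del: atLeastAtMost_iff)
  then have T: "openin chabauty_fell ?T" by (intro openin_diff openin_topspace)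
  have QT: "Q \<in> ?T" using closed_in_hull[OF Q] e by (auto simp: topspace_chabauty_fell)
  have "\<forall>T. Q \<in> T \<and> openin chabauty_fell T \<longrightarrow> (\<exists>y\<in>range (\<lambda>g. translate g X). y \<in> T)"
    using Q unfolding chabauty_hull_def in_closure_of by simp
  from mp[OF spec[OF this, of ?T] conjI[OF QT T]] obtain g where g: "translate g X \<in> ?T"
    by (elim bexE rangeE) simp
  have "translate g X \<in> chabauty_hull X"
    by (rule self_in_hull) (use assms(2)[of 0] assms(2) in \<open>auto simp: translate_0\<close>)
  then have E: "translate g X \<in> quasi_twists P \<psi> D" using X by blast
  have "\<bar>fiber_shift (translate g X) \<gamma> - fiber_shift Q \<gamma>\<bar> < e" if "\<gamma> \<in> J" for \<gamma>
    using g that E shift_bound[OF E, of \<gamma>] by (fastforce simp: abs_le_iff abs_less_iff)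
  then show ?thesis by blast
qed

end

subsection \<open>The corrector\<close>

text \<open>\<open>left_harmonic\<close> averages over - \<gamma>' + \<gamma>, whereas translating a
  set produces shifts at \<gamma>' + \<gamma>. Symmetry of \<open>p\<close> exchanges the two
  forms.\<close>

lemma left_harmonic_integral:
  fixes p :: "('g::{group_add, countable, discrete_topology} \<times> real) measure"
  assumes p: "prob_space p" "sets p = sets borel" "symmetric_measure p" and harm: "left_harmonic p \<psi>"
  shows "integrable p (\<lambda>g. \<psi> (fst g + \<gamma>))" "(\<integral>g. \<psi> (fst g + \<gamma>) \<partial>p) = \<psi> \<gamma>"
proof -
  interpret p: prob_space p by fact
  note fst_p [measurable] = fst_measurable_prod[OF p(2)]
  let ?q = "distr p (count_space UNIV) fst"
  let ?h = "\<lambda>\<gamma>'. \<psi> (- \<gamma>' + \<gamma>)"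
  interpret q: prob_space ?q by (intro p.prob_space_distr) simp
  have q: "?q = density (count_space UNIV) (\<lambda>\<gamma>'. ennreal (proj_mass p \<gamma>'))"
  proof (rule measure_eqI_countable[of _ UNIV])
    fix \<gamma>' :: 'g
    show "emeasure ?q {\<gamma>'} = emeasure (density (count_space UNIV) (\<lambda>\<gamma>'. ennreal (proj_mass p \<gamma>'))) {\<gamma>'}"
      by (simp add: emeasure_density nn_integral_count_space_indicator[symmetric] proj_mass_def q.emeasure_eq_measure)
  qed auto
  have sum: "((\<lambda>\<gamma>'. proj_mass p \<gamma>' * ?h \<gamma>') has_sum \<psi> \<gamma>) UNIV"
    using harm by (simp add: left_harmonic_def)
  then have "(\<lambda>\<gamma>'. proj_mass p \<gamma>' * ?h \<gamma>') summable_on UNIV" by (rule has_sum_imp_summable)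
  then have abs: "Infinite_Set_Sum.abs_summable_on (\<lambda>\<gamma>'. proj_mass p \<gamma>' * ?h \<gamma>') UNIV"
    by (intro abs_summable_equivalent[THEN iffD1] summable_on_iff_abs_summable_on_real[THEN iffD1])
  then have int: "integrable (count_space UNIV) (\<lambda>\<gamma>'. proj_mass p \<gamma>' * ?h \<gamma>')"
    by (simp add: Infinite_Set_Sum.abs_summable_on_def)
  have val: "(\<integral>\<gamma>'. proj_mass p \<gamma>' * ?h \<gamma>' \<partial>count_space UNIV) = \<psi> \<gamma>"
    using infsetsum_infsum[OF abs] infsumI[OF sum] by (simp add: infsetsum_def)
  have nonneg: "0 \<le> proj_mass p \<gamma>'" for \<gamma>' by (simp add: proj_mass_def)
  have "integrable ?q ?h" "integral\<^sup>L ?q ?h = \<psi> \<gamma>"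
    unfolding q using int val by (auto simp: integrable_density integral_density nonneg)
  then have 1: "integrable p (\<lambda>g. ?h (fst g))" "(\<integral>g. ?h (fst g) \<partial>p) = \<psi> \<gamma>"
    by (simp_all add: integrable_distr_eq integral_distr)
  note um [measurable] = uminus_measurable_prod[OF p(2)]
  have sym: "distr p p uminus = p" using p(3) by (simp add: symmetric_measure_def)
  have m [measurable]: "(\<lambda>g. \<psi> (fst g + \<gamma>)) \<in> borel_measurable p"
    using measurable_compose[OF fst_p, of "\<lambda>x. \<psi> (x + \<gamma>)" borel] by simp
  have "integrable (distr p p uminus) (\<lambda>g. \<psi> (fst g + \<gamma>))"
    using 1(1) by (subst integrable_distr_eq) (simp_all add: um m)
  then show "integrable p (\<lambda>g. \<psi> (fst g + \<gamma>))" by (simp add: sym)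
  have "(\<integral>g. \<psi> (fst g + \<gamma>) \<partial>distr p p uminus) = \<psi> \<gamma>"
    using 1(2) by (subst integral_distr) (simp_all add: um m)
  then show "(\<integral>g. \<psi> (fst g + \<gamma>) \<partial>p) = \<psi> \<gamma>" by (simp add: sym)
qed

text \<open>The function f of the overview. Subtracting \<psi> makes the integrand bounded and does
  not change the mean, because a harmonic \<psi> with \<psi> 0 = 0 has mean 0.\<close>

definition drift :: "('g::zero \<times> real) measure \<Rightarrow> ('g \<Rightarrow> real) \<Rightarrow> ('g \<times> real) set \<Rightarrow> real" where
  "drift p \<psi> Q = (\<integral>g. fiber_shift Q (fst g) - \<psi> (fst g) \<partial>p)"

text \<open>The partial sum f + P f + ... + P^(n-1) f of the overview, for f the drift.\<close>

primrec potential ::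
    "('g::group_add \<times> real) measure \<Rightarrow> ('g \<Rightarrow> real) \<Rightarrow> nat \<Rightarrow> ('g \<times> real) set \<Rightarrow> real" where
  "potential p \<psi> 0 Q = 0"
| "potential p \<psi> (Suc n) Q = drift p \<psi> Q + (\<integral>g. potential p \<psi> n (translate g Q) \<partial>p)"

definition tail_sup :: "('g::group_add \<times> real) measure \<Rightarrow> ('g \<Rightarrow> real) \<Rightarrow> nat \<Rightarrow> ('g \<times> real) set \<Rightarrow> real" where
  "tail_sup p \<psi> j Q = (SUP n\<in>{j..}. potential p \<psi> n Q)"

definition corrector :: "('g::group_add \<times> real) measure \<Rightarrow> ('g \<Rightarrow> real) \<Rightarrow> ('g \<times> real) set \<Rightarrow> real" where
  "corrector p \<psi> Q = (INF j. tail_sup p \<psi> j Q)"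

text \<open>All constructions take place on the closed invariant set \<open>E\<close>, which
  contains both hulls once \<open>D\<close> is large enough. So the corrector is defined before any
  measure on a hull is chosen, and its bounds hold at every point of \<open>E\<close> rather than
  almost everywhere.\<close>

locale harmonic_twists =
  fixes p :: "('g::{group_add, countable, discrete_topology} \<times> real) measure"
    and P :: "real set" and \<psi> :: "'g \<Rightarrow> real" and D :: real
  assumes prob_p: "prob_space p" and sets_p: "sets p = sets borel" and symmetric_p: "symmetric_measure p"
    and free: "free_on (chabauty_hull P)" and harmonic: "left_harmonic p \<psi>" and \<psi>_0: "\<psi> 0 = 0"
begin

abbreviation "E \<equiv> quasi_twists P \<psi> D"
abbreviation "M \<equiv> restrict_space (borel_of chabauty_fell) E"

sublocale p: prob_space p by (rule prob_p)

lemma space_p [simp]: "space p = UNIV"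
  using sets_eq_imp_space_eq[OF sets_p] by simp

lemma space_M [simp]: "space M = E"
  using quasi_twists_closed by (auto simp: space_restrict_space)

lemmas translate_E = translate_in_quasi_twists[of _ P \<psi> D]
lemmas shift_bound' = shift_bound[OF free, of _ \<psi> D]
lemmas shift_0' [simp] = shift_0[OF free, of _ \<psi> D]
lemmas shift_translate' = shift_translate[OF free, of _ \<psi> D]
lemmas psi_integrable = left_harmonic_integral(1)[OF prob_p sets_p symmetric_p harmonic]
lemmas psi_mean = left_harmonic_integral(2)[OF prob_p sets_p symmetric_p harmonic]

lemma measurable_fst_p: "(\<lambda>g. h (fst g)) \<in> borel_measurable p"
  using measurable_compose[OF fst_measurable_prod[OF sets_p], of h borel] by simp

lemma translate_measurable [measurable]: "(\<lambda>(g, Q). translate g Q) \<in> p \<Otimes>\<^sub>M M \<rightarrow>\<^sub>M M"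
  by (rule measurable_translate[OF sets_p refl quasi_twists_closed translate_E])

lemma translate_measurable_fst: "Q \<in> E \<Longrightarrow> (\<lambda>g. translate g Q) \<in> p \<rightarrow>\<^sub>M M"
  using measurable_Pair1[OF translate_measurable, of Q] by simp

lemma translate_measurable_snd: "translate g \<in> M \<rightarrow>\<^sub>M M"
  using measurable_Pair2[OF translate_measurable, of g] by simp

lemma deviation_integrable:
  assumes "Q \<in> E"
  shows "integrable p (\<lambda>g. fiber_shift Q (fst g + \<gamma>) - \<psi> (fst g + \<gamma>))"
  by (rule p.integrable_bounded[of _ D]) (use assms in \<open>auto intro!: shift_bound' measurable_fst_p\<close>)

text \<open>Along an orbit the drift is the coboundary P delta - delta of the bounded function delta
  = shift - \<psi>. The terms in \<psi> that the translation produces integrate to \<psi> (fst g) by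
  harmonicity.\<close>

lemma drift_translate:
  assumes Q: "Q \<in> E"
  shows "drift p \<psi> (translate g Q)
    = (\<integral>h. fiber_shift Q (fst h + fst g) - \<psi> (fst h + fst g) \<partial>p) - (fiber_shift Q (fst g) - \<psi> (fst g))"
proof -
  let ?\<delta> = "\<lambda>h. fiber_shift Q (fst h + fst g) - \<psi> (fst h + fst g)"
  \<comment> \<open>The summand 0 is written out so that \<open>psi_mean\<close> covers both
    occurrences of \<psi>, at \<open>fst g\<close> and at 0.\<close>
  have "drift p \<psi> (translate g Q) = (\<integral>h. (?\<delta> h + (\<psi> (fst h + fst g) - \<psi> (fst h + 0))) - fiber_shift Q (fst g) \<partial>p)"
    unfolding drift_def by (rule Bochner_Integration.integral_cong) (simp_all add: shift_translate'[OF Q])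
  also have "\<dots> = (\<integral>h. ?\<delta> h \<partial>p) + (\<psi> (fst g) - \<psi> 0) - fiber_shift Q (fst g)"
  proof -
    have "(\<integral>h. (a h + (b h - c h)) - s \<partial>p) = (\<integral>h. a h \<partial>p) + ((\<integral>h. b h \<partial>p) - (\<integral>h. c h \<partial>p)) - s"
      if "integrable p a" "integrable p b" "integrable p c" for a b c :: "'g \<times> real \<Rightarrow> real" and s
      using that p.prob_space by simp
    from this[OF deviation_integrable[OF Q] psi_integrable psi_integrable]
    show ?thesis by (simp only: psi_mean)
  qed
  finally show ?thesis by (simp add: \<psi>_0)
qed

lemma drift_measurable: "drift p \<psi> \<in> borel_measurable M"
proof -
  have "(\<lambda>z. fiber_shift (fst z) (fst (snd z)) - \<psi> (fst (snd z))) \<in> borel_measurable (M \<Otimes>\<^sub>M p)"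
  proof (rule measurable_compose_countable'[where I = UNIV and g = "\<lambda>z. fst (snd z)" and f = "\<lambda>\<gamma> z. fiber_shift (fst z) \<gamma> - \<psi> \<gamma>"])
    show "(\<lambda>z. fst (snd z)) \<in> M \<Otimes>\<^sub>M p \<rightarrow>\<^sub>M count_space UNIV"
      by (rule measurable_compose[OF measurable_snd fst_measurable_prod[OF sets_p]])
    show "(\<lambda>z. fiber_shift (fst z) \<gamma> - \<psi> \<gamma>) \<in> borel_measurable (M \<Otimes>\<^sub>M p)" for \<gamma>
      by (rule borel_measurable_diff[OF measurable_compose[OF measurable_fst measurable_shift[OF free]] borel_measurable_const])
  qed auto
  then show ?thesis unfolding drift_def[abs_def]
    by (intro p.borel_measurable_lebesgue_integral) (simp add: case_prod_unfold)
qed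

lemma potential_measurable: "potential p \<psi> n \<in> borel_measurable M"
proof (induction n)
  case (Suc n)
  note [measurable] = Suc drift_measurable
  have "(\<lambda>z. translate (snd z) (fst z)) \<in> M \<Otimes>\<^sub>M p \<rightarrow>\<^sub>M M"
    using measurable_compose[OF measurable_Pair[OF measurable_snd measurable_fst] translate_measurable]
    by (simp add: case_prod_unfold)
  then have "(\<lambda>Q. \<integral>g. potential p \<psi> n (translate g Q) \<partial>p) \<in> borel_measurable M"
    by (intro p.borel_measurable_lebesgue_integral) (simp add: case_prod_unfold)
  then show ?case by simp
qed simp

text \<open>Along an orbit the left-hand side satisfies \<open>H (Suc n) = P (H n)\<close> for the averaging operator
  \<open>P\<close> of \<open>p\<close>, because \<open>\<psi>\<close> is harmonic; so the bound for \<open>n = 0\<close> persists.\<close>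

lemma potential_deviation_bound:
  assumes Q: "Q \<in> E"
  shows "\<bar>potential p \<psi> n (translate g Q) + (fiber_shift Q (fst g) - \<psi> (fst g))\<bar> \<le> D"
proof (induction n arbitrary: g)
  case 0
  then show ?case using shift_bound'[OF Q] by simp
next
  case (Suc n)
  let ?\<delta> = "\<lambda>h. fiber_shift Q (fst h + fst g) - \<psi> (fst h + fst g)"
  let ?f = "\<lambda>h. potential p \<psi> n (translate (h + g) Q)"
  have f_meas: "?f \<in> borel_measurable p"
    using measurable_compose[OF translate_measurable_fst[OF translate_E[OF Q, of g]] potential_measurable[of n]]
    by (simp add: translate_translate)
  have le: "\<bar>?f h + ?\<delta> h\<bar> \<le> D" for h using Suc[of "h + g"] by simp
  \<comment> \<open>This bound serves integrability only; the constant \<open>D\<close> is preserved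
    because the sum of \<open>?f\<close> and the deviation is averaged as a whole.\<close>
  have "\<bar>?f h\<bar> \<le> 2 * D" for h using le[of h] shift_bound'[OF Q, of "fst h + fst g"] by linarith
  then have f_int: "integrable p ?f" by (intro p.integrable_bounded[of _ "2 * D"] f_meas)
  have "potential p \<psi> (Suc n) (translate g Q) + (fiber_shift Q (fst g) - \<psi> (fst g)) = (\<integral>h. ?f h + ?\<delta> h \<partial>p)"
    using f_int deviation_integrable[OF Q, of "fst g"]
    by (simp add: drift_translate[OF Q] translate_translate)
  moreover have "\<bar>\<integral>h. ?f h + ?\<delta> h \<partial>p\<bar> \<le> D"
  proof -
    have i: "integrable p (\<lambda>h. ?f h + ?\<delta> h)" using f_int deviation_integrable[OF Q] by simp
    have ge: "- D \<le> ?f h + ?\<delta> h" for h using le[of h] by linarith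
    have "(\<integral>h. ?f h + ?\<delta> h \<partial>p) \<le> D"
      using i le by (intro p.integral_le_const) (auto simp: abs_le_iff)
    moreover have "- D \<le> (\<integral>h. ?f h + ?\<delta> h \<partial>p)"
      by (intro p.integral_ge_const AE_I2 i ge)
    ultimately show ?thesis by linarith
  qed
  ultimately show ?case by simp
qed

lemma potential_bound: "Q \<in> E \<Longrightarrow> \<bar>potential p \<psi> n Q\<bar> \<le> D"
  using potential_deviation_bound[of Q n 0] by (simp add: translate_0 \<psi>_0)

lemma potential_real_translate:
  assumes "Q \<in> E"
  shows "potential p \<psi> n (translate (0, s) Q) = potential p \<psi> n Q"
  using assms
proof (induction n arbitrary: Q)
  case (Suc n)
  have "translate g (translate (0, s) Q) = translate (0, s) (translate g Q)" for g
    by (cases g) (simp add: translate_translate add.commute)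
  with Suc show ?case
    by (simp add: drift_def shift_translate' translate_E)
qed simp

lemma potential_bdd: "Q \<in> E \<Longrightarrow> bdd_above ((\<lambda>n. potential p \<psi> n Q) ` J)"
  using potential_bound by (intro bdd_aboveI[of _ D]) (auto simp: abs_le_iff)

lemma tail_sup_bound:
  assumes "Q \<in> E"
  shows "\<bar>tail_sup p \<psi> j Q\<bar> \<le> D"
proof -
  have "tail_sup p \<psi> j Q \<le> D"
    unfolding tail_sup_def using potential_bound[OF assms] by (intro cSUP_least) (auto simp: abs_le_iff)
  moreover have "potential p \<psi> j Q \<le> tail_sup p \<psi> j Q"
    unfolding tail_sup_def by (intro cSUP_upper potential_bdd assms) simp
  then have "- D \<le> tail_sup p \<psi> j Q" using potential_bound[OF assms, of j] by linarith
  ultimately show ?thesis by linarith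
qed

lemma tail_sup_measurable: "tail_sup p \<psi> j \<in> borel_measurable M"
  unfolding tail_sup_def[abs_def]
  by (intro borel_measurable_cSUP potential_measurable) (auto intro: potential_bdd)

lemma tail_sup_LIMSEQ:
  assumes "Q \<in> E"
  shows "(\<lambda>j. tail_sup p \<psi> j Q) \<longlonglongrightarrow> corrector p \<psi> Q"
  unfolding corrector_def
proof (rule LIMSEQ_decseq_INF)
  show "bdd_below (range (\<lambda>j. tail_sup p \<psi> j Q))"
    using tail_sup_bound[OF assms] by (intro bdd_belowI[of _ "- D"]) (auto simp: abs_le_iff minus_le_iff)
  show "decseq (\<lambda>j. tail_sup p \<psi> j Q)"
    unfolding tail_sup_def using potential_bdd[OF assms]
    by (intro decseq_SucI cSUP_subset_mono) auto
qed

lemma corrector_bound: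
  assumes "Q \<in> E"
  shows "\<bar>corrector p \<psi> Q\<bar> \<le> D"
proof (rule LIMSEQ_le_const2[OF tendsto_rabs[OF tail_sup_LIMSEQ[OF assms]]])
qed (use tail_sup_bound[OF assms] in auto)

lemma corrector_measurable: "corrector p \<psi> \<in> borel_measurable M"
  by (rule borel_measurable_LIMSEQ_real[OF tail_sup_LIMSEQ tail_sup_measurable]) simp

lemma corrector_real_translate:
  "Q \<in> E \<Longrightarrow> corrector p \<psi> (translate (0, s) Q) = corrector p \<psi> Q"
  by (simp add: corrector_def tail_sup_def potential_real_translate)

lemma corrector_translate_integrable:
  "Q \<in> E \<Longrightarrow> integrable p (\<lambda>g. corrector p \<psi> (translate g Q))"
  using measurable_compose[OF translate_measurable_fst corrector_measurable, of Q]
  by (intro p.integrable_bounded[of _ D]) (auto intro!: corrector_bound translate_E)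

text \<open>The reverse Fatou lemma, in the form of dominated convergence for the decreasing tail suprema.\<close>

lemma corrector_subsolution:
  assumes Q: "Q \<in> E"
  shows "corrector p \<psi> Q \<le> drift p \<psi> Q + (\<integral>g. corrector p \<psi> (translate g Q) \<partial>p)"
proof -
  have tm: "(\<lambda>g. tail_sup p \<psi> j (translate g Q)) \<in> borel_measurable p" for j
    using measurable_compose[OF translate_measurable_fst[OF Q] tail_sup_measurable] .
  have ti: "integrable p (\<lambda>g. tail_sup p \<psi> j (translate g Q))" for j
    using tm by (intro p.integrable_bounded[of _ D]) (auto intro!: tail_sup_bound translate_E Q)
  have le: "tail_sup p \<psi> (Suc j) Q \<le> drift p \<psi> Q + (\<integral>g. tail_sup p \<psi> j (translate g Q) \<partial>p)" for j
    unfolding tail_sup_def[of p \<psi> "Suc j" Q]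
  proof (rule cSUP_least)
    fix n assume "n \<in> {Suc j..}"
    then obtain k where k: "n = Suc k" "j \<le> k" by (cases n) auto
    have "(\<integral>g. potential p \<psi> k (translate g Q) \<partial>p) \<le> (\<integral>g. tail_sup p \<psi> j (translate g Q) \<partial>p)"
    proof (rule integral_mono[OF _ ti])
      show "integrable p (\<lambda>g. potential p \<psi> k (translate g Q))"
        using measurable_compose[OF translate_measurable_fst[OF Q] potential_measurable]
        by (intro p.integrable_bounded[of _ D]) (auto intro!: potential_bound translate_E Q)
      show "potential p \<psi> k (translate g Q) \<le> tail_sup p \<psi> j (translate g Q)" for g
        unfolding tail_sup_def using k(2) by (intro cSUP_upper potential_bdd translate_E Q) simp
    qed
    then show "potential p \<psi> n Q \<le> drift p \<psi> Q + (\<integral>g. tail_sup p \<psi> j (translate g Q) \<partial>p)"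
      by (simp add: k(1))
  qed auto
  have "(\<lambda>j. \<integral>g. tail_sup p \<psi> j (translate g Q) \<partial>p) \<longlonglongrightarrow> (\<integral>g. corrector p \<psi> (translate g Q) \<partial>p)"
    by (rule integral_dominated_convergence[where w = "\<lambda>_. D"])
      (use tm corrector_translate_integrable[OF Q] in \<open>auto intro!: tail_sup_LIMSEQ tail_sup_bound translate_E Q\<close>)
  then have "(\<lambda>j. drift p \<psi> Q + (\<integral>g. tail_sup p \<psi> j (translate g Q) \<partial>p))
      \<longlonglongrightarrow> drift p \<psi> Q + (\<integral>g. corrector p \<psi> (translate g Q) \<partial>p)"
    by (intro tendsto_intros)
  from LIMSEQ_le[OF LIMSEQ_Suc[OF tail_sup_LIMSEQ[OF Q]] this] le show ?thesis by blast
qed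

text \<open>The shift of \<open>twist P \<psi>\<close> is \<psi> itself, so its deviation vanishes
  and the drift is 0 along its orbit. The drift at a point of the hull is a limit of such values, by
  dominated convergence with the uniform bound \<open>D\<close>.\<close>

lemma drift_hull_eq_0:
  assumes P: "closed P" and hull: "chabauty_hull (twist P \<psi>) \<subseteq> E" and Q: "Q \<in> chabauty_hull (twist P \<psi>)"
  shows "drift p \<psi> Q = 0"
proof -
  let ?X = "twist P \<psi>"
  have cl: "closed (translate g ?X)" for g :: "'g \<times> real" using P by (intro closed_translate_prod closed_twist)
  have X: "?X \<in> E"
    using self_in_hull[OF _ cl, of 0] cl[of 0] hull by (auto simp: translate_0)
  have shift_X: "fiber_shift ?X \<gamma> = \<psi> \<gamma>" for \<gamma>
  proof (rule shift_eqI[OF free])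
    show "fiber ?X 0 \<in> chabauty_hull P" using X by (simp add: quasi_twists_def)
  qed (simp add: fiber_twist \<psi>_0 translate_0)
  have drift_orbit: "drift p \<psi> (translate g ?X) = 0" for g
    by (simp add: drift_translate[OF X] shift_X)
  \<comment> \<open>Approximation is available on finite sets only; taking the first n + 1 entries
    of an enumeration with error 1/(n+1) gives a sequence in the orbit whose shifts converge at
    every group element.\<close>
  have "\<exists>g. \<forall>\<gamma>\<in>from_nat_into (UNIV :: 'g set) ` {..n}. \<bar>fiber_shift (translate g ?X) \<gamma> - fiber_shift Q \<gamma>\<bar> < inverse (real (Suc n))" for n
    by (rule hull_approx_shift[OF free hull cl Q]) auto
  then obtain g where g: "\<And>n \<gamma>. \<gamma> \<in> from_nat_into (UNIV :: 'g set) ` {..n} \<Longrightarrow>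
      \<bar>fiber_shift (translate (g n) ?X) \<gamma> - fiber_shift Q \<gamma>\<bar> < inverse (real (Suc n))" by metis
  have lim: "(\<lambda>n. fiber_shift (translate (g n) ?X) \<gamma>) \<longlonglongrightarrow> fiber_shift Q \<gamma>" for \<gamma>
  proof -
    obtain k where k: "\<gamma> = from_nat_into UNIV k" using from_nat_into_surj[of "UNIV :: 'g set" \<gamma>] by auto
    have "(\<lambda>n. fiber_shift (translate (g n) ?X) \<gamma> - fiber_shift Q \<gamma>) \<longlonglongrightarrow> 0"
    proof (rule Lim_null_comparison[OF _ LIMSEQ_inverse_real_of_nat])
      show "\<forall>\<^sub>F n in sequentially. norm (fiber_shift (translate (g n) ?X) \<gamma> - fiber_shift Q \<gamma>) \<le> inverse (real (Suc n))"
        using eventually_ge_at_top[of k]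
        by eventually_elim (use g[of \<gamma>] k in \<open>auto intro!: less_imp_le\<close>)
    qed
    then show ?thesis by (simp add: LIM_zero_iff)
  qed
  have "(\<lambda>n. drift p \<psi> (translate (g n) ?X)) \<longlonglongrightarrow> drift p \<psi> Q"
    unfolding drift_def
  proof (rule integral_dominated_convergence[where w = "\<lambda>_. D"])
    show "AE x in p. (\<lambda>n. fiber_shift (translate (g n) ?X) (fst x) - \<psi> (fst x)) \<longlonglongrightarrow> fiber_shift Q (fst x) - \<psi> (fst x)"
      by (intro AE_I2 tendsto_intros lim)
    show "AE x in p. norm (fiber_shift (translate (g n) ?X) (fst x) - \<psi> (fst x)) \<le> D" for n
      by (intro AE_I2) (simp add: shift_bound' translate_E X)
  qed (auto intro: measurable_fst_p)
  then show ?thesis by (simp add: drift_orbit LIMSEQ_const_iff)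
qed

end

subsection \<open>Product structure of stationary measures\<close>

text \<open>An event described by \<zeta> is invariant under \<open>b\<close>, so conditioning
  \<open>N\<close> on it preserves invariance. The image of the conditioned measure under \<pi> is
  then an invariant probability measure on the hull of \<open>P\<close>, hence equal to \<mu>
  whatever the event, which is independence.\<close>

lemma distr_pair_uniquely_ergodic:
  fixes P :: "real set" and N :: "'x measure" and b :: "real \<Rightarrow> 'x \<Rightarrow> 'x"
  defines "K \<equiv> borel_of (subtopology chabauty_fell (chabauty_hull P))"
  assumes unique: "uniquely_ergodic_hull P"
    and \<mu>: "hull_prob P \<mu>" "\<And>s. distr \<mu> \<mu> (translate s) = \<mu>"
    and N: "prob_space N" and b: "\<And>s. b s \<in> N \<rightarrow>\<^sub>M N" "\<And>s. distr N N (b s) = N"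
    and \<pi>: "\<pi> \<in> N \<rightarrow>\<^sub>M K" "\<And>s x. x \<in> space N \<Longrightarrow> \<pi> (b s x) = translate s (\<pi> x)"
    and \<zeta>: "\<zeta> \<in> N \<rightarrow>\<^sub>M L" "\<And>s x. x \<in> space N \<Longrightarrow> \<zeta> (b s x) = \<zeta> x"
  shows "distr N (K \<Otimes>\<^sub>M L) (\<lambda>x. (\<pi> x, \<zeta> x)) = \<mu> \<Otimes>\<^sub>M distr N L \<zeta>"
proof -
  interpret N: prob_space N by fact
  have sets_\<mu>: "sets \<mu> = sets K" using \<mu>(1) by (simp add: hull_prob_def K_def)
  have sp_K: "space K = chabauty_hull P"
    using closedin_subset[OF closedin_hull[of P]] by (auto simp: K_def space_borel_of)
  have tr: "translate s \<in> K \<rightarrow>\<^sub>M K" for s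
    unfolding K_def
  proof (intro measurable_borel_of_continuous, unfold continuous_map_in_subtopology, intro conjI)
    show "continuous_map (subtopology chabauty_fell (chabauty_hull P)) chabauty_fell (translate s)"
      by (intro continuous_map_from_subtopology continuous_map_translate_real)
    show "translate s \<in> topspace (subtopology chabauty_fell (chabauty_hull P)) \<rightarrow> chabauty_hull P"
      by (auto intro: translate_in_hull_real)
  qed
  have "\<mu> \<Otimes>\<^sub>M distr N L \<zeta> = distr N (K \<Otimes>\<^sub>M L) (\<lambda>x. (\<pi> x, \<zeta> x))"
  proof (rule pair_measure_eqI)
    show "sigma_finite_measure \<mu>" using \<mu>(1) by (simp add: hull_prob_def prob_space_imp_sigma_finite)
    show "sigma_finite_measure (distr N L \<zeta>)"
      by (intro prob_space_imp_sigma_finite N.prob_space_distr \<zeta>(1))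
    show "sets (\<mu> \<Otimes>\<^sub>M distr N L \<zeta>) = sets (distr N (K \<Otimes>\<^sub>M L) (\<lambda>x. (\<pi> x, \<zeta> x)))"
      by (simp add: sets_\<mu> cong: sets_pair_measure_cong)
    fix A B assume A: "A \<in> sets \<mu>" and B: "B \<in> sets (distr N L \<zeta>)"
    define S where "S = \<zeta> -` B \<inter> space N"
    define T where "T = \<pi> -` A \<inter> space N"
    have S: "S \<in> sets N" using B \<zeta>(1) by (auto simp: S_def)
    have T: "T \<in> sets N" using A \<pi>(1) by (auto simp: T_def sets_\<mu>)
    have eq: "emeasure \<mu> A * emeasure N S = emeasure N (S \<inter> T)"
    proof (cases "emeasure N S = 0")
      case True
      have "emeasure N (S \<inter> T) \<le> emeasure N S" by (intro emeasure_mono S) auto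
      with True show ?thesis by simp
    next
      case False
      let ?N' = "uniform_measure N S"
      have Sfin: "emeasure N S \<noteq> \<infinity>" by simp
      interpret N': prob_space ?N' by (rule prob_space_uniform_measure[OF False Sfin])
      have \<pi>': "\<pi> \<in> ?N' \<rightarrow>\<^sub>M K" using \<pi>(1) by simp
      let ?\<mu>' = "distr ?N' K \<pi>"
      have "hull_prob P ?\<mu>'"
        unfolding hull_prob_def by (intro conjI N'.prob_space_distr \<pi>') (simp add: K_def)
      moreover have "distr ?\<mu>' ?\<mu>' (translate s) = ?\<mu>'" for s
      proof (rule measure_eqI)
        fix A assume "A \<in> sets (distr ?\<mu>' ?\<mu>' (translate s))"
        then have A: "A \<in> sets K" by simp
        have tA: "translate s -` A \<inter> space K \<in> sets K" using measurable_sets[OF tr A] .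
        let ?T = "\<pi> -` A \<inter> space N"
        have T: "?T \<in> sets N" using measurable_sets[OF \<pi>(1) A] .
        have "emeasure (distr ?\<mu>' ?\<mu>' (translate s)) A = emeasure ?\<mu>' (translate s -` A \<inter> space K)"
          using tr A by (subst emeasure_distr) (auto simp: measurable_def)
        also have "\<dots> = emeasure ?N' (\<pi> -` (translate s -` A \<inter> space K) \<inter> space N)"
          using \<pi>' tA by (subst emeasure_distr) auto
        also have "\<pi> -` (translate s -` A \<inter> space K) \<inter> space N = b s -` ?T \<inter> space N"
          using measurable_space[OF \<pi>(1)] measurable_space[OF b(1)] by (auto simp: \<pi>(2))
        also have "emeasure ?N' \<dots> = emeasure N (S \<inter> (b s -` ?T \<inter> space N)) / emeasure N S"
          using measurable_sets[OF b(1) T] S by (intro emeasure_uniform_measure) auto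
        also have "S \<inter> (b s -` ?T \<inter> space N) = b s -` (S \<inter> ?T) \<inter> space N"
          using measurable_space[OF b(1)] by (auto simp: S_def \<zeta>(2))
        also have "emeasure N \<dots> = emeasure (distr N N (b s)) (S \<inter> ?T)"
          using S T b(1) by (subst emeasure_distr) auto
        also have "\<dots> = emeasure N (S \<inter> ?T)" by (simp add: b(2))
        also have "\<dots> / emeasure N S = emeasure ?N' ?T"
          using S T by (intro emeasure_uniform_measure[symmetric]) auto
        also have "\<dots> = emeasure ?\<mu>' A" using \<pi>' A by (subst emeasure_distr) auto
        finally show "emeasure (distr ?\<mu>' ?\<mu>' (translate s)) A = emeasure ?\<mu>' A" .
      qed simp
      ultimately have "?\<mu>' = \<mu>" using unique \<mu> unfolding uniquely_ergodic_hull_def by blast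
      then have "emeasure \<mu> A = emeasure ?\<mu>' A" by simp
      also have "\<dots> = emeasure ?N' T"
        using \<pi>' A by (subst emeasure_distr) (auto simp: sets_\<mu> T_def)
      also have "\<dots> = emeasure N (S \<inter> T) / emeasure N S"
        using S T by (intro emeasure_uniform_measure)
      finally have "emeasure \<mu> A * emeasure N S = emeasure N (S \<inter> T) * (emeasure N S / emeasure N S)"
        by (simp add: ennreal_divide_times)
      also have "emeasure N S / emeasure N S = 1"
        using False Sfin by (intro ennreal_divide_self) (simp_all add: less_top[symmetric])
      finally show ?thesis by simp
    qed
    have "emeasure (distr N (K \<Otimes>\<^sub>M L) (\<lambda>x. (\<pi> x, \<zeta> x))) (A \<times> B) = emeasure N (S \<inter> T)"
      using A B \<pi>(1) \<zeta>(1) by (subst emeasure_distr) (auto simp: sets_\<mu> S_def T_def intro!: arg_cong[where f = "emeasure N"])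
    moreover have "emeasure (distr N L \<zeta>) B = emeasure N S"
      using B \<zeta>(1) by (subst emeasure_distr) (auto simp: S_def)
    ultimately show "emeasure \<mu> A * emeasure (distr N L \<zeta>) B = emeasure (distr N (K \<Otimes>\<^sub>M L) (\<lambda>x. (\<pi> x, \<zeta> x))) (A \<times> B)"
      using eq by simp
  qed
  then show ?thesis by simp
qed

text \<open>A set in \<open>quasi_twists\<close> is, for a free action, the twist of its fibre over
  0 by its shift function. Through this map the law of the set is recovered from the joint law of
  these two data.\<close>

lemma measurable_twist:
  fixes P :: "real set"
  defines "K \<equiv> borel_of (subtopology chabauty_fell (chabauty_hull P))"
  shows "(\<lambda>(R, z). twist R z) \<in> K \<Otimes>\<^sub>M (\<Pi>\<^sub>M \<gamma>\<in>(UNIV :: 'g::{countable, discrete_topology} set). (borel :: real measure))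
    \<rightarrow>\<^sub>M borel_of chabauty_fell" (is "_ \<in> ?KL \<rightarrow>\<^sub>M _")
proof (rule measurable_prod_real_chabautyI)
  fix x :: "real set \<times> ('g \<Rightarrow> real)" assume "x \<in> space ?KL"
  then have "fst x \<in> chabauty_hull P" by (auto simp: space_pair_measure K_def space_borel_of)
  then show "closed (case x of (R, z) \<Rightarrow> twist R z)"
    by (auto simp: case_prod_unfold intro: closed_twist closed_in_hull)
next
  fix \<gamma> :: 'g and V :: "real set" assume V: "open V"
  have "{x \<in> space ?KL. translate (snd x \<gamma>) (fst x) \<inter> V \<noteq> {}} \<in> sets ?KL"
  proof (rule sets_translate_hits[OF _ _ V])
    show "(\<lambda>x. snd x \<gamma>) \<in> borel_measurable ?KL"
      by (rule measurable_compose[OF measurable_snd measurable_component_singleton]) simp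
    fix W :: "real set" assume W: "open W"
    have "{R \<in> chabauty_hull P. R \<inter> W \<noteq> {}} \<in> sets K"
      unfolding K_def
    proof (rule borel_of_open, unfold openin_subtopology, intro exI conjI)
      show "openin chabauty_fell {R. closed R \<and> R \<inter> W \<noteq> {}}" by (rule openin_hits[OF W])
      show "{R \<in> chabauty_hull P. R \<inter> W \<noteq> {}} = {R. closed R \<and> R \<inter> W \<noteq> {}} \<inter> chabauty_hull P"
        using closed_in_hull by blast
    qed
    from measurable_sets[OF measurable_fst this]
    show "{x \<in> space ?KL. fst x \<inter> W \<noteq> {}} \<in> sets ?KL"
      by (rule back_subst[of "\<lambda>A. A \<in> _"])
        (auto simp: space_pair_measure K_def space_borel_of topspace_chabauty_fell)
  qed
  then show "{x \<in> space ?KL. fiber (case x of (R, z) \<Rightarrow> twist R z) \<gamma> \<inter> V \<noteq> {}} \<in> sets ?KL"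
    by (simp add: case_prod_unfold fiber_twist)
qed

lemma fiber_eqI: "(\<And>\<gamma>. fiber A \<gamma> = fiber B \<gamma>) \<Longrightarrow> A = B"
  by (auto simp: fiber_def set_eq_iff)

context harmonic_twists
begin

text \<open>Translating the fibre over \<open>\<gamma>\<close> by the corrector at \<open>\<gamma>.Q\<close> is equivariant because the corrector
  is invariant under the reals.\<close>

definition correct :: "('g \<times> real) set \<Rightarrow> ('g \<times> real) set" where
  "correct Q = {(\<gamma>, t). (\<gamma>, t + corrector p \<psi> (translate (\<gamma>, 0) Q)) \<in> Q}"

text \<open>The shift of \<open>correct Q\<close> relative to its own fibre over 0. The last term is
  present because that fibre has been moved as well, and it makes this cocycle cohomologous to the
  original one.\<close>

definition corrected_shift :: "'g \<Rightarrow> ('g \<times> real) set \<Rightarrow> real" where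
  "corrected_shift \<gamma> Q = fiber_shift Q \<gamma> + corrector p \<psi> (translate (\<gamma>, 0) Q) - corrector p \<psi> Q"

lemma fiber_correct: "fiber (correct Q) \<gamma> = translate (corrector p \<psi> (translate (\<gamma>, 0) Q)) (fiber Q \<gamma>)"
  by (auto simp: correct_def mem_fiber_iff mem_translate_iff)

lemma fiber_correct_0: "fiber (correct Q) 0 = translate (corrector p \<psi> Q) (fiber Q 0)"
  by (simp add: fiber_correct translate_0 flip: zero_prod_def)

lemma corrector_translate_fst:
  assumes "Q \<in> E"
  shows "corrector p \<psi> (translate g Q) = corrector p \<psi> (translate (fst g, 0) Q)"
proof -
  have "translate g Q = translate (0, snd g) (translate (fst g, 0) Q)"
    by (simp add: translate_translate)
  then show ?thesis using assms by (simp add: corrector_real_translate translate_E)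
qed

lemma correct_translate:
  assumes Q: "Q \<in> E"
  shows "correct (translate g Q) = translate g (correct Q)"
proof (rule fiber_eqI)
  fix \<gamma>
  have "corrector p \<psi> (translate (\<gamma>, 0) (translate g Q)) = corrector p \<psi> (translate (\<gamma> + fst g, 0) Q)"
    unfolding translate_translate by (subst corrector_translate_fst[OF Q]) simp
  then show "fiber (correct (translate g Q)) \<gamma> = fiber (translate g (correct Q)) \<gamma>"
    by (simp add: fiber_correct fiber_translate translate_translate add.commute)
qed

lemma correct_eq_twist:
  assumes Q: "Q \<in> E"
  shows "correct Q = twist (fiber (correct Q) 0) (\<lambda>\<gamma>. corrected_shift \<gamma> Q)"
proof (rule fiber_eqI)
  fix \<gamma>
  show "fiber (correct Q) \<gamma> = fiber (twist (fiber (correct Q) 0) (\<lambda>\<gamma>. corrected_shift \<gamma> Q)) \<gamma>"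
    unfolding fiber_twist fiber_correct_0
    by (simp add: fiber_correct fiber_eq_translate_shift[OF free Q, of \<gamma>] translate_translate corrected_shift_def add.commute)
qed

lemma eq_twist_shift: "Q \<in> E \<Longrightarrow> Q = twist (fiber Q 0) (fiber_shift Q)"
  by (rule fiber_eqI) (unfold fiber_twist, rule fiber_eq_translate_shift[OF free])

lemma corrected_shift_measurable: "corrected_shift \<gamma> \<in> borel_measurable M"
  unfolding corrected_shift_def[abs_def]
  by (intro borel_measurable_diff borel_measurable_add measurable_shift[OF free] corrector_measurable
      measurable_compose[OF translate_measurable_snd])

lemma corrected_shift_cocycle:
  assumes Q: "Q \<in> E"
  shows "corrected_shift (\<gamma> + fst g) Q = corrected_shift \<gamma> (translate g Q) + corrected_shift (fst g) Q"
proof -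
  have "corrector p \<psi> (translate (\<gamma>, 0) (translate g Q)) = corrector p \<psi> (translate (\<gamma> + fst g, 0) Q)"
    unfolding translate_translate by (subst corrector_translate_fst[OF Q]) simp
  then show ?thesis
    by (simp add: corrected_shift_def shift_translate'[OF Q] corrector_translate_fst[OF Q, of g])
qed

lemma corrected_shift_bound:
  assumes Q: "Q \<in> E"
  shows "\<bar>corrected_shift \<gamma> Q - \<psi> \<gamma>\<bar> \<le> 3 * D"
  using shift_bound'[OF Q, of \<gamma>] corrector_bound[OF Q] corrector_bound[OF translate_E[OF Q, of "(\<gamma>, 0)"]]
  unfolding corrected_shift_def by linarith

text \<open>Inserting \<psi> splits the integrand into integrable pieces. Since the drift of
  \<open>Q'\<close> is 0, what remains is f + P c - c at \<open>Q\<close>, which is nonnegative by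
  \<open>corrector_subsolution\<close>.\<close>

lemma corrected_shift_mean:
  assumes Q: "Q \<in> E" and Q': "Q' \<in> E" "drift p \<psi> Q' = 0"
  shows "0 \<le> (\<integral>g. corrected_shift (fst g) Q - fiber_shift Q' (fst g) \<partial>p)"
proof -
  have "(\<integral>g. corrected_shift (fst g) Q - fiber_shift Q' (fst g) \<partial>p)
      = (\<integral>g. ((fiber_shift Q (fst g) - \<psi> (fst g)) - (fiber_shift Q' (fst g) - \<psi> (fst g)))
          + (corrector p \<psi> (translate g Q) - corrector p \<psi> Q) \<partial>p)"
  proof (rule Bochner_Integration.integral_cong[OF refl])
    fix g
    show "corrected_shift (fst g) Q - fiber_shift Q' (fst g)
      = ((fiber_shift Q (fst g) - \<psi> (fst g)) - (fiber_shift Q' (fst g) - \<psi> (fst g)))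
          + (corrector p \<psi> (translate g Q) - corrector p \<psi> Q)"
      unfolding corrected_shift_def corrector_translate_fst[OF Q, of g] by simp
  qed
  also have "\<dots> = (drift p \<psi> Q - drift p \<psi> Q') + ((\<integral>g. corrector p \<psi> (translate g Q) \<partial>p) - corrector p \<psi> Q)"
  proof -
    have "(\<integral>g. (a g - b g) + (c g - s) \<partial>p) = ((\<integral>g. a g \<partial>p) - (\<integral>g. b g \<partial>p)) + ((\<integral>g. c g \<partial>p) - s)"
      if "integrable p a" "integrable p b" "integrable p c" for a b c :: "'g \<times> real \<Rightarrow> real" and s
      using that p.prob_space by simp
    from this[OF deviation_integrable[OF Q, of 0] deviation_integrable[OF Q'(1), of 0] corrector_translate_integrable[OF Q]]
    show ?thesis by (simp add: drift_def)
  qed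
  finally show ?thesis using corrector_subsolution[OF Q] Q'(2) by simp
qed

end

lemma (in harmonic_twists) measurable_translate_fiber:
  assumes N: "sets N = sets (restrict_space (borel_of chabauty_fell) X)" and X: "X \<subseteq> E"
    and c: "c \<in> borel_measurable N"
  shows "(\<lambda>Q. translate (c Q) (fiber Q 0)) \<in> N \<rightarrow>\<^sub>M borel_of (subtopology chabauty_fell (chabauty_hull P))"
proof -
  have sN: "space N = X"
    using sets_eq_imp_space_eq[OF N] X quasi_twists_closed[of P \<psi> D] by (auto simp: space_restrict_space)
  have hullP: "fiber Q 0 \<in> chabauty_hull P" if "Q \<in> X" for Q using X that by (auto simp: quasi_twists_def)
  obtain R :: "real set set" where R: "countable R" "topological_basis R" using ex_countable_basis by blast
  have "(\<lambda>Q. translate (c Q) (fiber Q 0)) \<in> N \<rightarrow>\<^sub>M borel_of chabauty_fell"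
  proof (rule measurable_chabautyI[OF R(2,1)])
    show "closed (translate (c Q) (fiber Q 0))" if "Q \<in> space N" for Q
      using closed_in_hull[OF hullP] that by (simp add: sN closed_translate_real)
    fix U assume "U \<in> R"
    show "{Q \<in> space N. translate (c Q) (fiber Q 0) \<inter> U \<noteq> {}} \<in> sets N"
    proof (rule sets_translate_hits[OF c _ topological_basis_open[OF R(2) \<open>U \<in> R\<close>]])
      fix W :: "real set" assume "open W"
      then have "open ({0 :: 'g} \<times> W)" by (simp add: open_Times discrete_topology_class.open_discrete)
      then have "{Q. closed Q \<and> Q \<inter> ({0 :: 'g} \<times> W) \<noteq> {}} \<in> sets (borel_of chabauty_fell)"
        by (intro borel_of_open openin_hits)
      moreover have "{Q \<in> space N. fiber Q 0 \<inter> W \<noteq> {}} = X \<inter> {Q. closed Q \<and> Q \<inter> ({0} \<times> W) \<noteq> {}}"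
        using X quasi_twists_closed[of P \<psi> D] by (auto simp: sN mem_fiber_iff)
      ultimately show "{Q \<in> space N. fiber Q 0 \<inter> W \<noteq> {}} \<in> sets N"
        unfolding N sets_restrict_space by blast
    qed
  qed
  then have "(\<lambda>Q. translate (c Q) (fiber Q 0)) \<in> N \<rightarrow>\<^sub>M restrict_space (borel_of chabauty_fell) (chabauty_hull P)"
    by (intro measurable_restrict_space2) (auto simp: sN intro!: translate_in_hull_real hullP)
  moreover have "sets (borel_of (subtopology chabauty_fell (chabauty_hull P)))
      = sets (restrict_space (borel_of chabauty_fell) (chabauty_hull P))"
    by (rule sets_borel_of_subtopology) (rule closedin_subset[OF closedin_hull])
  ultimately show ?thesis by (simp cong: measurable_cong_sets)
qed

text \<open>Stationarity yields invariance under (0, s), which translates the fibre over 0 and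
  leaves \<open>c\<close> and \<zeta> fixed. So the fibre plays the part of \<pi> in
  \<open>distr_pair_uniquely_ergodic\<close>, also after it has been moved by
  \<open>c\<close>.\<close>

lemma (in harmonic_twists) product_law:
  fixes \<zeta> :: "'g \<Rightarrow> ('g \<times> real) set \<Rightarrow> real"
  assumes ac: "absolutely_continuous haar p"
    and unique: "uniquely_ergodic_hull P" "hull_prob P \<mu>" "\<And>s. distr \<mu> \<mu> (translate s) = \<mu>"
    and N: "prob_space N" "sets N = sets (restrict_space (borel_of chabauty_fell) X)"
      "distr (p \<Otimes>\<^sub>M N) N (\<lambda>(g, Q). translate g Q) = N"
    and X: "X \<subseteq> E" "\<And>g Q. Q \<in> X \<Longrightarrow> translate g Q \<in> X"
    and c: "c \<in> borel_measurable N" "\<And>s Q. Q \<in> X \<Longrightarrow> c (translate (0, s) Q) = c Q"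
    and \<zeta>: "\<And>\<gamma>. \<zeta> \<gamma> \<in> borel_measurable N" "\<And>\<gamma> s Q. Q \<in> X \<Longrightarrow> \<zeta> \<gamma> (translate (0, s) Q) = \<zeta> \<gamma> Q"
  shows "distr N (borel_of (subtopology chabauty_fell (chabauty_hull P)) \<Otimes>\<^sub>M (\<Pi>\<^sub>M \<gamma>\<in>UNIV. borel))
      (\<lambda>Q. (translate (c Q) (fiber Q 0), \<lambda>\<gamma>. \<zeta> \<gamma> Q))
    = \<mu> \<Otimes>\<^sub>M distr N (\<Pi>\<^sub>M \<gamma>\<in>UNIV. borel) (\<lambda>Q \<gamma>. \<zeta> \<gamma> Q)"
proof -
  have X_closed: "X \<subseteq> {Q. closed Q}" using X(1) quasi_twists_closed[of P \<psi> D] by blast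
  have sN: "space N = X"
    using sets_eq_imp_space_eq[OF N(2)] X_closed by (auto simp: space_restrict_space)
  have act: "(\<lambda>(g, Q). translate g Q) \<in> p \<Otimes>\<^sub>M N \<rightarrow>\<^sub>M N"
    by (rule measurable_translate[OF sets_p N(2) X_closed X(2)])
  obtain B :: "('g \<times> real) set set" where B: "topological_basis B" "countable B"
    using ex_countable_basis_prod_real by blast
  obtain G where G: "countable G" "Int_stable G" "X \<in> G" "G \<subseteq> Pow X"
    "sets (restrict_space (borel_of chabauty_fell) X) = sigma_sets X G"
    using chabauty_generator[OF B X_closed] by blast
  have inv: "distr N N (translate (0, s)) = N" for s
    by (rule stationary_invariant_under_reals[OF prob_p sets_p symmetric_p ac N(1) act N(3), of G])
      (use G in \<open>auto simp: sN N(2) translate_translate translate_0\<close>)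
  show ?thesis
  proof (rule distr_pair_uniquely_ergodic[OF unique N(1), of "\<lambda>s. translate (0, s)"])
    show "translate (0, s) \<in> N \<rightarrow>\<^sub>M N" for s
      using measurable_Pair2[OF act, of "(0, s)"] by simp
    show "(\<lambda>Q. translate (c Q) (fiber Q 0)) \<in> N \<rightarrow>\<^sub>M borel_of (subtopology chabauty_fell (chabauty_hull P))"
      by (rule measurable_translate_fiber[OF N(2) X(1) c(1)])
    show "(\<lambda>Q \<gamma>. \<zeta> \<gamma> Q) \<in> N \<rightarrow>\<^sub>M (\<Pi>\<^sub>M \<gamma>\<in>UNIV. borel)"
      by (rule measurable_PiM_single') (auto simp: \<zeta>(1))
  qed (auto simp: inv sN c(2) \<zeta>(2) fiber_translate translate_translate add.commute)
qed

lemma (in harmonic_twists) id_measurable_M: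
  assumes N: "sets N = sets (restrict_space (borel_of chabauty_fell) X)" and X: "X \<subseteq> E"
  shows "(\<lambda>Q. Q) \<in> N \<rightarrow>\<^sub>M M"
proof -
  have "(\<lambda>Q. Q) \<in> restrict_space (borel_of chabauty_fell) X \<rightarrow>\<^sub>M M"
    using X by (intro measurable_restrict_space2 measurable_restrict_space1 measurable_ident) (auto simp: space_restrict_space)
  then show ?thesis using N by (simp cong: measurable_cong_sets)
qed

section \<open>Assembling the factor map from the two product laws\<close>

theorem theorem1p4:
  fixes P :: "real set"
    and \<phi> \<psi> :: "'g::{group_add, countable, discrete_topology} \<Rightarrow> real"
    and p :: "('g \<times> real) measure"
    and \<nu>\<^sub>\<psi> \<nu> :: "('g \<times> real) set measure"
  assumes "closed P"
    and "free_on (chabauty_hull P)"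
    and "uniquely_ergodic_hull P"
    and "quasimorphism \<phi>"
    and "\<phi> 0 = 0"
    and "\<not> (\<exists>\<alpha>. homomorphism \<alpha> \<and> bounded_distance \<phi> \<alpha>)"
    and "sets p = sets borel"
    and "prob_space p"
    and "symmetric_measure p"
    and "absolutely_continuous haar p"
    and "generates_semigroup (supp p)"
    and "integrable_wrt p \<phi>"
    and "\<psi> \<in> harmonic_class p \<phi>"
    and "stationary_hull p (twist P \<psi>) \<nu>\<^sub>\<psi>"
    and "stationary_hull p (twist P \<phi>) \<nu>"
  shows "\<exists>F. ae_equivariant_factor \<nu> \<nu>\<^sub>\<psi> F"
proof -
  have \<psi>: "\<psi> 0 = 0" "bounded_distance \<psi> \<phi>" "left_harmonic p \<psi>"
    using assms(13) by (auto simp: harmonic_class_def)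
  obtain C where C: "\<And>g. \<bar>\<psi> g - \<phi> g\<bar> \<le> C"
    using \<psi>(2) by (auto simp: bounded_distance_def bounded_iff)
  obtain D0 where D0: "\<And>g h. \<bar>\<phi> (g + h) - \<phi> g - \<phi> h\<bar> \<le> D0"
    using assms(4) by (auto simp: quasimorphism_def)
  \<comment> \<open>For \<psi> three values are compared with those of \<phi>, each at cost
    \<open>C\<close>; for the hull of \<open>twist P \<phi>\<close> only \<psi> \<gamma> is
    replaced. The larger constant serves both hulls.\<close>
  define D where "D = D0 + 3 * C"
  have C0: "0 \<le> C" using C[of 0] by linarith
  interpret harmonic_twists p P \<psi> D
    using assms \<psi> by (simp add: harmonic_twists_def)
  let ?H\<phi> = "chabauty_hull (twist P \<phi>)" and ?H\<psi> = "chabauty_hull (twist P \<psi>)"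
  have H\<phi>: "?H\<phi> \<subseteq> E"
  proof (rule hull_twist_subset_quasi_twists[OF assms(1)])
    fix \<gamma> h show "\<bar>\<phi> (\<gamma> + h) - \<phi> h - \<psi> \<gamma>\<bar> \<le> D"
      using D0[of \<gamma> h] C[of \<gamma>] C0 unfolding D_def by linarith
  qed
  have H\<psi>: "?H\<psi> \<subseteq> E"
  proof (rule hull_twist_subset_quasi_twists[OF assms(1)])
    fix \<gamma> h show "\<bar>\<psi> (\<gamma> + h) - \<psi> h - \<psi> \<gamma>\<bar> \<le> D"
      using D0[of \<gamma> h] C[of \<gamma>] C[of h] C[of "\<gamma> + h"] unfolding D_def by linarith
  qed
  have hull_sets: "sets (borel_of (subtopology chabauty_fell (chabauty_hull Q))) = sets (restrict_space (borel_of chabauty_fell) (chabauty_hull Q))"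
    for Q :: "('g \<times> real) set"
    by (rule sets_borel_of_subtopology) (rule closedin_subset[OF closedin_hull])
  have \<nu>: "prob_space \<nu>" "sets \<nu> = sets (restrict_space (borel_of chabauty_fell) ?H\<phi>)"
      "distr (p \<Otimes>\<^sub>M \<nu>) \<nu> (\<lambda>(g, Q). translate g Q) = \<nu>"
    using assms(15) by (auto simp: stationary_hull_def hull_prob_def hull_sets)
  have \<nu>\<psi>: "prob_space \<nu>\<^sub>\<psi>" "sets \<nu>\<^sub>\<psi> = sets (restrict_space (borel_of chabauty_fell) ?H\<psi>)"
      "distr (p \<Otimes>\<^sub>M \<nu>\<^sub>\<psi>) \<nu>\<^sub>\<psi> (\<lambda>(g, Q). translate g Q) = \<nu>\<^sub>\<psi>"
    using assms(14) by (auto simp: stationary_hull_def hull_prob_def hull_sets)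
  interpret \<nu>: prob_space \<nu> by (rule \<nu>(1))
  interpret \<nu>\<psi>: prob_space \<nu>\<^sub>\<psi> by (rule \<nu>\<psi>(1))
  have closed_hulls: "?H\<phi> \<subseteq> {Q. closed Q}" "?H\<psi> \<subseteq> {Q. closed Q}" using closed_in_hull by blast+
  have sp: "space \<nu> = ?H\<phi>" "space \<nu>\<^sub>\<psi> = ?H\<psi>"
    using sets_eq_imp_space_eq[OF \<nu>(2)] sets_eq_imp_space_eq[OF \<nu>\<psi>(2)] closed_hulls
    by (auto simp: space_restrict_space)
  note id\<nu> = id_measurable_M[OF \<nu>(2) H\<phi>] and id\<nu>\<psi> = id_measurable_M[OF \<nu>\<psi>(2) H\<psi>]
  have cs_meas: "corrected_shift \<gamma> \<in> borel_measurable \<nu>" for \<gamma>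
    using measurable_compose[OF id\<nu> corrected_shift_measurable] .
  have c_meas: "corrector p \<psi> \<in> borel_measurable \<nu>"
    using measurable_compose[OF id\<nu> corrector_measurable] .
  have s_meas: "(\<lambda>Q. fiber_shift Q \<gamma>) \<in> borel_measurable \<nu>\<^sub>\<psi>" for \<gamma>
    using measurable_compose[OF id\<nu>\<psi> measurable_shift[OF free]] .
  obtain \<mu> where \<mu>: "hull_prob P \<mu>" "\<And>s. distr \<mu> \<mu> (translate s) = \<mu>"
    using assms(3) unfolding uniquely_ergodic_hull_def by blast
  let ?K = "borel_of (subtopology chabauty_fell (chabauty_hull P))"
  let ?L = "\<Pi>\<^sub>M \<gamma>\<in>(UNIV :: 'g set). (borel :: real measure)"
  let ?CF = "borel_of chabauty_fell :: ('g \<times> real) set measure"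
  let ?f = "\<lambda>Q. (translate (corrector p \<psi> Q) (fiber Q 0), \<lambda>\<gamma>. corrected_shift \<gamma> Q)"
  \<comment> \<open>Translation by 0 brings the uncorrected data into the form of
    \<open>product_law\<close> with \<open>c\<close> constantly 0.\<close>
  let ?f' = "\<lambda>Q. (translate 0 (fiber Q 0), \<lambda>\<gamma>. fiber_shift Q \<gamma>)"
  have cs_real: "corrected_shift \<gamma> (translate (0, s) Q) = corrected_shift \<gamma> Q" if "Q \<in> E" for \<gamma> s Q
    using corrected_shift_cocycle[OF that, of \<gamma> "(0, s)"] that by (simp add: corrected_shift_def translate_0 flip: zero_prod_def)
  have law1: "distr \<nu> (?K \<Otimes>\<^sub>M ?L) ?f = \<mu> \<Otimes>\<^sub>M distr \<nu> ?L (\<lambda>Q \<gamma>. corrected_shift \<gamma> Q)"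
    by (rule product_law[OF assms(10,3) \<mu> \<nu> H\<phi> translate_in_hull_prod c_meas _ cs_meas])
      (use H\<phi> in \<open>auto intro!: corrector_real_translate cs_real\<close>)
  have law2: "distr \<nu>\<^sub>\<psi> (?K \<Otimes>\<^sub>M ?L) ?f' = \<mu> \<Otimes>\<^sub>M distr \<nu>\<^sub>\<psi> ?L (\<lambda>Q \<gamma>. fiber_shift Q \<gamma>)"
    by (rule product_law[OF assms(10,3) \<mu> \<nu>\<psi> H\<psi> translate_in_hull_prod _ _ s_meas])
      (use H\<psi> in \<open>auto simp: shift_translate' subset_iff\<close>)
  have law3: "distr \<nu> ?L (\<lambda>Q \<gamma>. corrected_shift \<gamma> Q) = distr \<nu>\<^sub>\<psi> ?L (\<lambda>Q \<gamma>. fiber_shift Q \<gamma>)"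
  proof (rule cocycle_laws_eq[OF prob_p sets_p assms(11) \<nu>(1) _ \<nu>(3) \<nu>\<psi>(1) _ \<nu>\<psi>(3) cs_meas s_meas, where C = "4 * D"])
    show "(\<lambda>(g, Q). translate g Q) \<in> p \<Otimes>\<^sub>M \<nu> \<rightarrow>\<^sub>M \<nu>"
      by (rule measurable_translate[OF sets_p \<nu>(2) closed_hulls(1) translate_in_hull_prod])
    show "(\<lambda>(g, Q). translate g Q) \<in> p \<Otimes>\<^sub>M \<nu>\<^sub>\<psi> \<rightarrow>\<^sub>M \<nu>\<^sub>\<psi>"
      by (rule measurable_translate[OF sets_p \<nu>\<psi>(2) closed_hulls(2) translate_in_hull_prod])
    fix \<gamma> Q Q' assume "Q \<in> space \<nu>" "Q' \<in> space \<nu>\<^sub>\<psi>"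
    then have Q: "Q \<in> E" and Q': "Q' \<in> E" "Q' \<in> ?H\<psi>" using H\<phi> H\<psi> sp by auto
    show "\<bar>corrected_shift \<gamma> Q - fiber_shift Q' \<gamma>\<bar> \<le> 4 * D"
      using corrected_shift_bound[OF Q, of \<gamma>] shift_bound'[OF Q'(1), of \<gamma>] by linarith
    show "0 \<le> (\<integral>g. corrected_shift (fst g) Q - fiber_shift Q' (fst g) \<partial>p)"
      by (rule corrected_shift_mean[OF Q Q'(1) drift_hull_eq_0[OF assms(1) H\<psi> Q'(2)]])
  next
    fix \<gamma> g Q assume "Q \<in> space \<nu>"
    then have Q: "Q \<in> E" using H\<phi> sp by auto
    show "corrected_shift (\<gamma> + fst g) Q = corrected_shift \<gamma> (translate g Q) + corrected_shift (fst g) Q"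
      by (rule corrected_shift_cocycle[OF Q])
    show "corrected_shift 0 Q = 0"
      using Q by (simp add: corrected_shift_def translate_0 flip: zero_prod_def)
  next
    fix \<gamma> g Q assume "Q \<in> space \<nu>\<^sub>\<psi>"
    then have Q: "Q \<in> E" using H\<psi> sp by auto
    show "fiber_shift Q (\<gamma> + fst g) = fiber_shift (translate g Q) \<gamma> + fiber_shift Q (fst g)"
      using Q by (simp add: shift_translate')
    show "fiber_shift Q 0 = 0" using Q by simp
  qed
  have f_meas: "?f \<in> \<nu> \<rightarrow>\<^sub>M ?K \<Otimes>\<^sub>M ?L"
    by (intro measurable_Pair measurable_translate_fiber[OF \<nu>(2) H\<phi> c_meas] measurable_PiM_single') (auto simp: cs_meas)
  have f'_meas: "?f' \<in> \<nu>\<^sub>\<psi> \<rightarrow>\<^sub>M ?K \<Otimes>\<^sub>M ?L"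
    by (intro measurable_Pair measurable_translate_fiber[OF \<nu>\<psi>(2) H\<psi>] measurable_PiM_single') (auto simp: s_meas)
  have tw: "(\<lambda>(R, z). twist R z) \<in> ?K \<Otimes>\<^sub>M ?L \<rightarrow>\<^sub>M ?CF" by (rule measurable_twist)
  have twist_f: "(case ?f Q of (R, z) \<Rightarrow> twist R z) = correct Q" if "Q \<in> ?H\<phi>" for Q
    using correct_eq_twist[of Q] H\<phi> that by (auto simp: fiber_correct_0)
  have twist_f': "(case ?f' Q of (R, z) \<Rightarrow> twist R z) = Q" if "Q \<in> ?H\<psi>" for Q
    using eq_twist_shift[of Q] H\<psi> that by (auto simp: translate_0)
  have correct_meas: "correct \<in> \<nu> \<rightarrow>\<^sub>M ?CF"
    using measurable_compose[OF f_meas tw] by (rule measurable_cong[THEN iffD1, rotated]) (simp only: sp twist_f)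
  \<comment> \<open>Stated for Borel sets of all closed sets, because \<open>correct Q\<close> is
    not yet known to lie in the hull of \<open>twist P \<psi>\<close>. Both sides are images under
    twisting of the same product measure.\<close>
  have correct_law: "emeasure \<nu> (correct -` A \<inter> space \<nu>) = emeasure \<nu>\<^sub>\<psi> (A \<inter> ?H\<psi>)" if A: "A \<in> sets ?CF" for A
  proof -
    have "distr \<nu> ?CF correct = distr \<nu> ?CF (\<lambda>Q. case ?f Q of (R, z) \<Rightarrow> twist R z)"
      by (rule distr_cong) (simp_all only: sp twist_f)
    also have "\<dots> = distr (distr \<nu> (?K \<Otimes>\<^sub>M ?L) ?f) ?CF (\<lambda>(R, z). twist R z)"
      by (subst distr_distr[OF tw f_meas]) (simp add: comp_def)
    also have "\<dots> = distr (distr \<nu>\<^sub>\<psi> (?K \<Otimes>\<^sub>M ?L) ?f') ?CF (\<lambda>(R, z). twist R z)"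
      by (simp only: law1 law2 law3)
    also have "\<dots> = distr \<nu>\<^sub>\<psi> ?CF (\<lambda>Q. case ?f' Q of (R, z) \<Rightarrow> twist R z)"
      by (subst distr_distr[OF tw f'_meas]) (simp add: comp_def)
    also have "\<dots> = distr \<nu>\<^sub>\<psi> ?CF (\<lambda>Q. Q)"
      by (rule distr_cong) (simp_all only: sp twist_f')
    finally have eq: "distr \<nu> ?CF correct = distr \<nu>\<^sub>\<psi> ?CF (\<lambda>Q. Q)" .
    have idm: "(\<lambda>Q. Q) \<in> \<nu>\<^sub>\<psi> \<rightarrow>\<^sub>M ?CF"
    proof -
      have "(\<lambda>Q. Q) \<in> restrict_space ?CF ?H\<psi> \<rightarrow>\<^sub>M ?CF" by (intro measurable_restrict_space1) simp
      then show ?thesis using \<nu>\<psi>(2) by (simp cong: measurable_cong_sets)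
    qed
    have "emeasure \<nu> (correct -` A \<inter> space \<nu>) = emeasure (distr \<nu> ?CF correct) A"
      using correct_meas A by (simp add: emeasure_distr)
    also have "\<dots> = emeasure \<nu>\<^sub>\<psi> (A \<inter> ?H\<psi>)"
      unfolding eq using idm A by (simp add: emeasure_distr sp)
    finally show ?thesis .
  qed
  have H\<psi>_sets: "?H\<psi> \<in> sets ?CF" by (rule borel_of_closed[OF closedin_hull])
  \<comment> \<open>On the exceptional null set any value in the target hull will do;
    \<open>twist P \<psi>\<close> is a point at hand.\<close>
  define F where "F Q = (if correct Q \<in> ?H\<psi> then correct Q else twist P \<psi>)" for Q
  have "translate 0 (twist P \<psi>) \<in> ?H\<psi>"
    by (intro self_in_hull closed_translate_prod closed_twist assms(1))
  then have F_in: "F Q \<in> ?H\<psi>" for Q by (simp add: F_def translate_0)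
  have F_meas: "F \<in> \<nu> \<rightarrow>\<^sub>M \<nu>\<^sub>\<psi>"
  proof -
    have "F \<in> \<nu> \<rightarrow>\<^sub>M ?CF"
      unfolding F_def[abs_def]
    proof (rule measurable_If[OF correct_meas])
      show "(\<lambda>x. twist P \<psi>) \<in> \<nu> \<rightarrow>\<^sub>M ?CF" by (rule measurable_const) (simp add: closed_twist[OF assms(1)])
      show "{x \<in> space \<nu>. correct x \<in> ?H\<psi>} \<in> sets \<nu>"
        using measurable_sets[OF correct_meas H\<psi>_sets] by (simp add: vimage_def Int_def conj_commute)
    qed
    then have "F \<in> \<nu> \<rightarrow>\<^sub>M restrict_space ?CF ?H\<psi>" by (intro measurable_restrict_space2) (auto simp: F_in)
    then show ?thesis using \<nu>\<psi>(2) by (simp cong: measurable_cong_sets)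
  qed
  have compl: "space ?CF - ?H\<psi> \<in> sets ?CF" by (rule sets.compl_sets[OF H\<psi>_sets])
  have AE_F: "AE Q in \<nu>. correct Q \<in> ?H\<psi>"
  proof (rule AE_I')
    have "correct -` (space ?CF - ?H\<psi>) \<inter> space \<nu> \<in> sets \<nu>"
      by (rule measurable_sets[OF correct_meas compl])
    moreover have "emeasure \<nu> (correct -` (space ?CF - ?H\<psi>) \<inter> space \<nu>) = 0"
      unfolding correct_law[OF compl] by (simp add: Diff_disjoint Int_commute)
    ultimately show "correct -` (space ?CF - ?H\<psi>) \<inter> space \<nu> \<in> null_sets \<nu>" by (simp add: null_sets_def)
    show "{Q \<in> space \<nu>. \<not> correct Q \<in> ?H\<psi>} \<subseteq> correct -` (space ?CF - ?H\<psi>) \<inter> space \<nu>"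
      using measurable_space[OF correct_meas] by auto
  qed
  have F_law: "distr \<nu> \<nu>\<^sub>\<psi> F = \<nu>\<^sub>\<psi>"
  proof (rule measure_eqI)
    fix A assume "A \<in> sets (distr \<nu> \<nu>\<^sub>\<psi> F)"
    then have A: "A \<in> sets \<nu>\<^sub>\<psi>" by simp
    have A': "A \<subseteq> ?H\<psi>" "A \<in> sets ?CF"
      using A sets.sets_into_space[OF A] unfolding sp(2) by (auto simp: \<nu>\<psi>(2) sets_restrict_space H\<psi>_sets)
    have "emeasure (distr \<nu> \<nu>\<^sub>\<psi> F) A = emeasure \<nu> (F -` A \<inter> space \<nu>)"
      using F_meas A by (rule emeasure_distr)
    also have "\<dots> = emeasure \<nu> (correct -` A \<inter> space \<nu>)"
    proof (rule emeasure_eq_AE)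
      show "AE Q in \<nu>. Q \<in> F -` A \<inter> space \<nu> \<longleftrightarrow> Q \<in> correct -` A \<inter> space \<nu>"
        using AE_F by eventually_elim (simp add: F_def)
    qed (use measurable_sets[OF F_meas A] measurable_sets[OF correct_meas A'(2)] in auto)
    also have "\<dots> = emeasure \<nu>\<^sub>\<psi> A" using correct_law[OF A'(2)] A'(1) by (simp add: inf_absorb1)
    finally show "emeasure (distr \<nu> \<nu>\<^sub>\<psi> F) A = emeasure \<nu>\<^sub>\<psi> A" .
  qed simp
  \<comment> \<open>The condition that \<open>correct Q\<close> lies in the hull is inherited by
    every translate of \<open>Q\<close>, as \<open>correct\<close> is equivariant on all of
    \<open>E\<close>. Thus one null set serves for all group elements at once.\<close>
  have "AE Q in \<nu>. \<forall>g. F (translate g Q) = translate g (F Q)"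
    using AE_F AE_space
  proof eventually_elim
    case (elim Q)
    then have Q: "Q \<in> E" using H\<phi> sp by auto
    have "correct (translate g Q) \<in> ?H\<psi>" for g
      unfolding correct_translate[OF Q] using elim(1) by (rule translate_in_hull_prod)
    with elim(1) show ?case by (simp add: F_def correct_translate[OF Q])
  qed
  with F_meas F_law have "ae_equivariant_factor \<nu> \<nu>\<^sub>\<psi> F"
    by (simp add: ae_equivariant_factor_def measurable_completion distr_completion)
  then show ?thesis by blast
qed

end
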